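(* Let $\mu(\mathfrak g)$ denote the least $N$ such that the real Lie algebra $\mathfrak g$ has a faithful representation in $\mathfrak{gl}(N,\mathbb R)$. For the Lie algebras $L_{5.1}$, $L_{6.1},\dots,L_{6.4}$, $L_{7.1},\dots,L_{7.7}$ defined in the context (in each case, for all permitted values of the parameters), one has $$\mu(L_{5.1})=\mu(L_{6.3})=3,$$ $$\mu(L_{6.1})=\mu(L_{6.2})=\mu(L_{6.4})=\mu(L_{7.1})=\mu(L_{7.3})=\mu(L_{7.4})=\mu(L_{7.5})=\mu(L_{7.7})=4,$$ $$\mu(L_{7.2})=\mu(L_{7.6})=5.$$
   Context: Each of the following is the real Lie algebra (under the commutator) of all matrices of the displayed form, where the letters $a,b,c,d,e,f,g$ run over all real numbers and $\lambda,\nu$ are fixed real parameters. (These are Turkowski's Lie algebras of dimensions 5, 6, 7 with non-trivial Levi decomposition; the first digit of the index is the dimension.) $L_{5.1}$: $\begin{pmatrix} a&b&d\\ c&-a&e\\ 0&0&0\end{pmatrix}$. $L_{6.1}$: $\begin{pmatrix}0&c&-b&d\\ -c&0&a&e\\ b&-a&0&f\\ 0&0&0&0\end{pmatrix}$; $L_{6.2}$: $\begin{pmatrix}a&b&0&d\\ c&-a&0&e\\ e&-d&0&f\\ 0&0&0&0\end{pmatrix}$; $L_{6.3}$: $\begin{pmatrix}a+\lambda f&b&d\\ -c&\lambda f-a&e\\ 0&0&(1+\lambda)f\end{pmatrix}$ (the isomorphism type does not depend on $\lambda$); $L_{6.4}$: $\begin{pmatrix}2a&2b&0&d\\ c&0&b&e\\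 0&2c&-2a&f\\ 0&0&0&0\end{pmatrix}$. $L_{7.1}$ ($\lambda\ne\nu$): $\begin{pmatrix}\lambda g&c&-b&d\\ -c&\lambda g&a&e\\ b&-a&\lambda g&f\\ 0&0&0&\nu g\end{pmatrix}$; $L_{7.2}$: $\begin{pmatrix}0&-a&-b&-c&d\\ a&0&-c&b&e\\ b&c&0&-a&f\\ c&-b&a&0&g\\ 0&0&0&0&0\end{pmatrix}$; $L_{7.3}$ (with parameter $p=\frac1{\lambda-\nu}$, $\lambda\neq\nu$): $\begin{pmatrix}a+\lambda g&b&0&d\\ c&\lambda g-a&0&e\\ 0&0&(\nu+1)g&f\\ 0&0&0&\nu g\end{pmatrix}$; $L_{7.4}$ ($\lambda\ne\nu$): $\begin{pmatrix}a+\lambda g&b&0&d\\ c&\lambda g-a&0&e\\ -e&d&\nu g&f\\ 0&0&0&(2\lambda-\nu)g\end{pmatrix}$; $L_{7.5}$ ($\lambda\neq\nu$): $\begin{pmatrix}2a+\lambda g&2c&0&f\\ b&\lambda g&c&e\\ 0&2b&\lambda g-2a&d\\ 0&0&0&\nu g\end{pmatrix}$; $L_{7.6}$: $\begin{pmatrix}3a&3b&0&0&d\\ c&a&2b&0&e\\ 0&2c&-a&b&f\\ 0&0&3c&-3a&g\\ 0&0&0&0&0\end{pmatrix}$; $L_{7.7}$: $\begin{pmatrix}a&b&d&f\\ c&-a&e&g\\ 0&0&0&0\\ 0&0&0&0\end{pmatrix}$. *)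

theory Defs
  imports "Jordan_Normal_Form.VS_Connect"
begin

text \<open>
  A real Lie algebra is represented by a record extending \<open>module\<close>. As usual for modules in
  HOL-Algebra, the inherited fields \<open>mult\<close> and \<open>one\<close> carry no meaning.
\<close>

record 'a lie_alg = "(real, 'a) module" +
  bracket :: "'a \<Rightarrow> 'a \<Rightarrow> 'a"

locale real_lie_algebra = vectorspace "class_ring :: real ring" L for L :: "'a lie_alg" +
  assumes bracket_closed:
      "\<lbrakk>x \<in> carrier L; y \<in> carrier L\<rbrakk> \<Longrightarrow> bracket L x y \<in> carrier L"
    and bracket_add_left:
      "\<lbrakk>x \<in> carrier L; y \<in> carrier L; z \<in> carrier L\<rbrakk> \<Longrightarrow>
        bracket L (x \<oplus>\<^bsub>L\<^esub> y) z = bracket L x z \<oplus>\<^bsub>L\<^esub> bracket L y z"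
    and bracket_add_right:
      "\<lbrakk>x \<in> carrier L; y \<in> carrier L; z \<in> carrier L\<rbrakk> \<Longrightarrow>
        bracket L x (y \<oplus>\<^bsub>L\<^esub> z) = bracket L x y \<oplus>\<^bsub>L\<^esub> bracket L x z"
    and bracket_smult_left:
      "\<lbrakk>x \<in> carrier L; y \<in> carrier L\<rbrakk> \<Longrightarrow>
        bracket L (r \<odot>\<^bsub>L\<^esub> x) y = r \<odot>\<^bsub>L\<^esub> bracket L x y"
    and bracket_smult_right:
      "\<lbrakk>x \<in> carrier L; y \<in> carrier L\<rbrakk> \<Longrightarrow>
        bracket L x (r \<odot>\<^bsub>L\<^esub> y) = r \<odot>\<^bsub>L\<^esub> bracket L x y"
    and bracket_self:
      "x \<in> carrier L \<Longrightarrow> bracket L x x = \<zero>\<^bsub>L\<^esub>"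
    and jacobi:
      "\<lbrakk>x \<in> carrier L; y \<in> carrier L; z \<in> carrier L\<rbrakk> \<Longrightarrow>
        bracket L x (bracket L y z) \<oplus>\<^bsub>L\<^esub> bracket L y (bracket L z x)
          \<oplus>\<^bsub>L\<^esub> bracket L z (bracket L x y) = \<zero>\<^bsub>L\<^esub>"

definition lie_hom :: "'a lie_alg \<Rightarrow> 'b lie_alg \<Rightarrow> ('a \<Rightarrow> 'b) set" where
  "lie_hom L M = {\<phi> \<in> carrier L \<rightarrow> carrier M.
     (\<forall>x\<in>carrier L. \<forall>y\<in>carrier L. \<phi> (x \<oplus>\<^bsub>L\<^esub> y) = \<phi> x \<oplus>\<^bsub>M\<^esub> \<phi> y) \<and>
     (\<forall>r. \<forall>x\<in>carrier L. \<phi> (r \<odot>\<^bsub>L\<^esub> x) = r \<odot>\<^bsub>M\<^esub> \<phi> x) \<and>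
     (\<forall>x\<in>carrier L. \<forall>y\<in>carrier L. \<phi> (bracket L x y) = bracket M (\<phi> x) (\<phi> y))}"

definition gl :: "nat \<Rightarrow> real mat lie_alg" where
  "gl n = module.extend (module_mat TYPE(real) n n)
            (lie_alg.fields (\<lambda>X Y. X * Y - Y * X))"

locale faithful_representation = real_lie_algebra L for L :: "'a lie_alg" +
  fixes N :: nat and \<phi> :: "'a \<Rightarrow> real mat"
  assumes hom: "\<phi> \<in> lie_hom L (gl N)"
    and inj: "inj_on \<phi> (carrier L)"

text \<open>\<open>mu L\<close> is unspecified if \<open>L\<close> has no finite-dimensional faithful representation (by Ado's theorem
  this does not occur for finite-dimensional \<open>L\<close>).\<close>

definition mu :: "'a lie_alg \<Rightarrow> nat" where
  "mu L = (LEAST N. \<exists>\<phi>. faithful_representation L N \<phi>)"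

definition matrix_lie_alg :: "nat \<Rightarrow> real mat set \<Rightarrow> real mat lie_alg" where
  "matrix_lie_alg n S = (gl n)\<lparr>carrier := S\<rparr>"

definition L5_1 :: "real mat lie_alg" where
  "L5_1 = matrix_lie_alg 3 {mat_of_rows_list 3
     [[a,  b, d],
      [c, -a, e],
      [0,  0, 0]] | a b c d e. True}"

definition L6_1 :: "real mat lie_alg" where
  "L6_1 = matrix_lie_alg 4 {mat_of_rows_list 4
     [[ 0,  c, -b, d],
      [-c,  0,  a, e],
      [ b, -a,  0, f],
      [ 0,  0,  0, 0]] | a b c d e f. True}"

definition L6_2 :: "real mat lie_alg" where
  "L6_2 = matrix_lie_alg 4 {mat_of_rows_list 4
     [[a,  b, 0, d],
      [c, -a, 0, e],
      [e, -d, 0, f],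
      [0,  0, 0, 0]] | a b c d e f. True}"

definition L6_3 :: "real \<Rightarrow> real mat lie_alg" where
  "L6_3 l = matrix_lie_alg 3 {mat_of_rows_list 3
     [[a + l * f, b,         d],
      [-c,        l * f - a, e],
      [0,         0,         (1 + l) * f]] | a b c d e f. True}"

definition L6_4 :: "real mat lie_alg" where
  "L6_4 = matrix_lie_alg 4 {mat_of_rows_list 4
     [[2 * a, 2 * b, 0,        d],
      [c,     0,     b,        e],
      [0,     2 * c, - 2 * a,  f],
      [0,     0,     0,        0]] | a b c d e f. True}"

definition L7_1 :: "real \<Rightarrow> real \<Rightarrow> real mat lie_alg" where
  "L7_1 l \<nu> = matrix_lie_alg 4 {mat_of_rows_list 4
     [[l * g, c,     -b,    d],
      [-c,    l * g, a,     e],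
      [b,     -a,    l * g, f],
      [0,     0,     0,     \<nu> * g]] | a b c d e f g. True}"

definition L7_2 :: "real mat lie_alg" where
  "L7_2 = matrix_lie_alg 5 {mat_of_rows_list 5
     [[0, -a, -b, -c, d],
      [a,  0, -c,  b, e],
      [b,  c,  0, -a, f],
      [c, -b,  a,  0, g],
      [0,  0,  0,  0, 0]] | a b c d e f g. True}"

definition L7_3 :: "real \<Rightarrow> real \<Rightarrow> real mat lie_alg" where
  "L7_3 l \<nu> = matrix_lie_alg 4 {mat_of_rows_list 4
     [[a + l * g, b,         0,           d],
      [c,         l * g - a, 0,           e],
      [0,         0,         (\<nu> + 1) * g, f],
      [0,         0,         0,           \<nu> * g]] | a b c d e f g. True}"

definition L7_4 :: "real \<Rightarrow> real \<Rightarrow> real mat lie_alg" where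
  "L7_4 l \<nu> = matrix_lie_alg 4 {mat_of_rows_list 4
     [[a + l * g, b,         0,     d],
      [c,         l * g - a, 0,     e],
      [-e,        d,         \<nu> * g, f],
      [0,         0,         0,     (2 * l - \<nu>) * g]] | a b c d e f g. True}"

definition L7_5 :: "real \<Rightarrow> real \<Rightarrow> real mat lie_alg" where
  "L7_5 l \<nu> = matrix_lie_alg 4 {mat_of_rows_list 4
     [[2 * a + l * g, 2 * c, 0,             f],
      [b,             l * g, c,             e],
      [0,             2 * b, l * g - 2 * a, d],
      [0,             0,     0,             \<nu> * g]] | a b c d e f g. True}"

definition L7_6 :: "real mat lie_alg" where
  "L7_6 = matrix_lie_alg 5 {mat_of_rows_list 5
     [[3 * a, 3 * b, 0,     0,       d],
      [c,     a,     2 * b, 0,       e],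
      [0,     2 * c, -a,    b,       f],
      [0,     0,     3 * c, - 3 * a, g],
      [0,     0,     0,     0,       0]] | a b c d e f g. True}"

definition L7_7 :: "real mat lie_alg" where
  "L7_7 = matrix_lie_alg 4 {mat_of_rows_list 4
     [[a,  b, d, f],
      [c, -a, e, g],
      [0,  0, 0, 0],
      [0,  0, 0, 0]] | a b c d e f g. True}"

end

(*
  A faithful real representation of size k extends to the complexification, which in every case
  contains an sl2-triple A, B, C.  On a finite-dimensional complex space the eigenvalues of A are
  integers, and with p all integers j of the same parity with |j| <= |p| are eigenvalues; a nonzero
  X with [A, X] = w X yields two eigenvalues of A that differ by w; and A = [B, C] has trace 0.

  For small k this determines the spectrum of A.  A nonzero X of odd weight forces the eigenvalues
  0, 1, -1: impossible for k = 2, and for k = 4 the spectrum is 0, 0, 1, -1, which excludes weight 3.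
  For k = 3, A is conjugate to diag(a, -a, 0) with a = 1 or a = 2, so matrices of given weight have
  at most two nonzero entries off the diagonal, or are diagonal, and the relations in the radical
  become contradictory.  Since so(3) complexifies to sl2, the algebras containing it are no
  exception.  L7.2 is: its complexification does have a representation of size 4, and only
  the compatibility with complex conjugation rules it out.
*)

theory Submission
  imports Defs "Jordan_Normal_Form.Schur_Decomposition"
begin

section \<open>Commutators and matrix Lie algebras\<close>

text \<open>The eigenvalues of A come from strings of vectors under B and C. A string stops because
  A has finitely many eigenvalues, and the place where it stops is what forces integrality. Size 3
  cannot carry any of four configurations: X, Y of weights 1 and -1 with [X, Y] nonzero and [X,
  [X, Y]] = 0 (Heisenberg radical); a nonzero X of weight 2 with [X, [C, X]] = 0 (abelian copy of
  the adjoint module); two noncommuting elements of weight 0; two commuting, linearly independent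
  elements of weight 1. In each case the weights leave so few matrix entries that the relations
  become a tiny polynomial system. L7.2 resists the purely complex argument because the quaternions,
  complexified, are two copies of the natural module: L7.2 and L7.7 have the same complexification,
  and L7.7 has a faithful representation of size 4. Over the reals the natural module of su(2) is
  quaternionic, and a real structure on it would require a scalar with squared modulus -1.\<close>

lemma sum_lessThan_small:
  "(\<Sum>l<(3::nat). f l) = f 0 + f (Suc 0) + f 2"
  "(\<Sum>l<(4::nat). f l) = f 0 + f (Suc 0) + f 2 + f 3"
  "(\<Sum>l<(5::nat). f l) = f 0 + f (Suc 0) + f 2 + f 3 + f 4"
  by (simp_all add: eval_nat_numeral add.assoc)

lemma all_less_small:
  "(\<forall>i<(3::nat). R i) \<longleftrightarrow> R 0 \<and> R (Suc 0) \<and> R 2"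
  "(\<forall>i<(4::nat). R i) \<longleftrightarrow> R 0 \<and> R (Suc 0) \<and> R 2 \<and> R 3"
  "(\<forall>i<(5::nat). R i) \<longleftrightarrow> R 0 \<and> R (Suc 0) \<and> R 2 \<and> R 3 \<and> R 4"
  by (auto simp: eval_nat_numeral less_Suc_eq)

lemma mat_of_rows_list_simps:
  "length rs = n \<Longrightarrow> mat_of_rows_list k rs \<in> carrier_mat n k"
  "i < length rs \<Longrightarrow> j < k \<Longrightarrow> mat_of_rows_list k rs $$ (i, j) = rs ! i ! j"
  "dim_row (mat_of_rows_list k rs) = length rs"
  "dim_col (mat_of_rows_list k rs) = k"
  by (auto simp: mat_of_rows_list_def)

lemmas small_mat_simps = sum_lessThan_small all_less_small mat_of_rows_list_simps

lemma square_mat_eqI: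
  assumes "X \<in> carrier_mat n n" "Y \<in> carrier_mat n n" "\<forall>i<n. \<forall>j<n. X $$ (i, j) = Y $$ (i, j)"
  shows "X = Y"
  using assms by (intro eq_matI) auto

lemma mat3_eq_iff:
  assumes "X \<in> carrier_mat 3 3" "Y \<in> carrier_mat 3 3"
  shows "X = Y \<longleftrightarrow> (\<forall>i<3. \<forall>j<3. X $$ (i, j) = Y $$ (i, j))"
  using square_mat_eqI[OF assms] by auto

definition comm :: "'a::comm_ring_1 mat \<Rightarrow> 'a mat \<Rightarrow> 'a mat" where
  "comm X Y = X * Y - Y * X"

lemma comm_carrier [simp]:
  "X \<in> carrier_mat n n \<Longrightarrow> Y \<in> carrier_mat n n \<Longrightarrow> comm X Y \<in> carrier_mat n n"
  unfolding comm_def by auto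

lemma comm_dim [simp]: "dim_row (comm X Y) = dim_row Y" "dim_col (comm X Y) = dim_col X"
  unfolding comm_def by auto

lemma comm_index:
  assumes "X \<in> carrier_mat n n" "Y \<in> carrier_mat n n" "i < n" "j < n"
  shows "comm X Y $$ (i, j) = (\<Sum>l<n. X $$ (i, l) * Y $$ (l, j) - Y $$ (i, l) * X $$ (l, j))"
  using assms unfolding comm_def
  by (simp add: scalar_prod_def lessThan_atLeast0 sum_subtractf)

lemma gl_simps [simp]:
  "carrier (gl n) = carrier_mat n n"
  "add (gl n) = (+)"
  "zero (gl n) = 0\<^sub>m n n"
  "Module.smult (gl n) = (\<cdot>\<^sub>m)"
  "bracket (gl n) = comm"
  by (auto simp: gl_def module_mat_def module.defs lie_alg.defs comm_def fun_eq_iff)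

lemma matrix_lie_alg_simps [simp]:
  "carrier (matrix_lie_alg n S) = S"
  "add (matrix_lie_alg n S) = (+)"
  "zero (matrix_lie_alg n S) = 0\<^sub>m n n"
  "Module.smult (matrix_lie_alg n S) = (\<cdot>\<^sub>m)"
  "bracket (matrix_lie_alg n S) = comm"
  by (simp_all add: matrix_lie_alg_def)

text \<open>This gives every upper bound: the inclusion of a matrix Lie algebra is faithful. Most of
  the work is the Lie algebra axioms, since they are part of
  \<open>faithful_representation\<close>.\<close>

lemma faithful_representation_matrix_lie_alg:
  assumes carr: "S \<subseteq> carrier_mat n n" and zero: "0\<^sub>m n n \<in> S"
    and add: "\<And>X Y. X \<in> S \<Longrightarrow> Y \<in> S \<Longrightarrow> X + Y \<in> S"
    and smult: "\<And>r X. X \<in> S \<Longrightarrow> r \<cdot>\<^sub>m X \<in> S"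
    and br: "\<And>X Y. X \<in> S \<Longrightarrow> Y \<in> S \<Longrightarrow> comm X Y \<in> S"
  shows "faithful_representation (matrix_lie_alg n S) n (\<lambda>X. X)"
proof -
  let ?L = "matrix_lie_alg n S"
  have c: "X \<in> carrier_mat n n" if "X \<in> S" for X using that carr by auto
  have dims: "dim_row X = n" "dim_col X = n" if "X \<in> S" for X using c[OF that] by auto
  have neg: "\<exists>Y\<in>S. Y + X = 0\<^sub>m n n" if "X \<in> S" for X
  proof -
    have "(-1) \<cdot>\<^sub>m X + X = 0\<^sub>m n n" using c[OF that] by (intro eq_matI) auto
    then show ?thesis using smult[OF that] by blast
  qed
  interpret A: abelian_group ?L
  proof (rule abelian_groupI, simp_all only: matrix_lie_alg_simps)
    fix x y z assume "x \<in> S" "y \<in> S" "z \<in> S"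
    then show "x + y + z = x + (y + z)" by (intro assoc_add_mat[of _ n n] c)
  next
    fix x y assume "x \<in> S" "y \<in> S"
    then show "x + y = y + x" by (intro comm_add_mat[of _ n n] c)
  qed (use c add zero neg in auto)
  interpret V: vectorspace "class_ring :: real ring" ?L
  proof -
    have "field (class_ring :: real ring)" by (rule class_field)
    moreover have "Module.module (class_ring :: real ring) ?L"
    proof (rule Module.module.intro)
      show "cring (class_ring :: real ring)" using class_field[where 'a = real] by (simp add: field_def domain_def)
      show "abelian_group ?L" by (rule A.abelian_group_axioms)
      show "module_axioms (class_ring :: real ring) ?L"
        by unfold_locales
          (use smult in \<open>auto simp: dims class_ring_simps intro!: eq_matI simp: algebra_simps\<close>)
    qed
    ultimately show "vectorspace (class_ring :: real ring) ?L"
      by (simp add: vectorspace_def)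
  qed
  have eq: "X = Y" if "X \<in> carrier_mat n n" "Y \<in> carrier_mat n n"
    "\<And>i j. i < n \<Longrightarrow> j < n \<Longrightarrow> X $$ (i, j) = Y $$ (i, j)" for X Y :: "real mat"
    using that by (intro eq_matI) auto
  have lie: "real_lie_algebra ?L"
  proof (unfold_locales, goal_cases)
    case (1 x y) then show ?case using br by auto
  next
    case (2 x y z) then show ?case
      using c[of x] c[of y] c[of z]
      by (intro eq) (auto simp: comm_index[where n = n] sum.distrib[symmetric] algebra_simps)
  next
    case (3 x y z) then show ?case
      using c[of x] c[of y] c[of z]
      by (intro eq) (auto simp: comm_index[where n = n] sum.distrib[symmetric] algebra_simps)
  next
    case (4 x y r) then show ?case
      using c[of x] c[of y]
      by (intro eq) (auto simp: comm_index[where n = n] sum_distrib_left algebra_simps)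
  next
    case (5 x y r) then show ?case
      using c[of x] c[of y]
      by (intro eq) (auto simp: comm_index[where n = n] sum_distrib_left algebra_simps)
  next
    case (6 x) then show ?case
      using c[of x] by (intro eq) (auto simp: comm_index[where n = n])
  next
    case (7 x y z)
    then have xyz: "x \<in> carrier_mat n n" "y \<in> carrier_mat n n" "z \<in> carrier_mat n n"
      using c by auto
    \<comment> \<open>Jacobi is a cancellation of twelve triple products. They are kept as
      unexpanded, uniformly bracketed products, so that only additive arithmetic of entries
      remains.\<close>
    have d: "comm x (comm y z) = (x * (y * z) - x * (z * y)) - (y * z * x - z * y * x)"
      if "x \<in> carrier_mat n n" "y \<in> carrier_mat n n" "z \<in> carrier_mat n n" for x y z :: "real mat"
      using that unfolding comm_def
      by (simp add: mult_minus_distrib_mat[of _ n n _ n] minus_mult_distrib_mat[of _ n n _ _ n])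
    show ?case
      using xyz
      by (intro eq)
        (auto simp: d assoc_mult_mat[of _ n n _ n _ n] simp del: index_mult_mat(1))
  qed
  then interpret real_lie_algebra ?L .
  show ?thesis
    by unfold_locales (use carr in \<open>auto simp: lie_hom_def\<close>)
qed

section \<open>Complexified representations\<close>

text \<open>For a real subspace \<open>S\<close> of real matrices, the tensor product with the
  complex numbers embeds in the complex matrices as \<open>S + \<i> S\<close>; this describes it
  through real and imaginary parts.\<close>

definition complexified :: "nat \<Rightarrow> real mat set \<Rightarrow> complex mat set" where
  "complexified n S = {M \<in> carrier_mat n n. map_mat Re M \<in> S \<and> map_mat Im M \<in> S}"

lemma complexified_carrier: "M \<in> complexified n S \<Longrightarrow> M \<in> carrier_mat n n"
  by (simp add: complexified_def)

text \<open>The closure properties of \<open>S\<close> are recorded together with the map, so that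
  later arguments work with this interface alone. Compatibility with complex conjugation is kept
  outside, because a complex change of basis destroys it.\<close>

locale complex_rep =
  fixes n m :: nat and S :: "real mat set" and \<Psi> :: "complex mat \<Rightarrow> complex mat"
  assumes comm_closed: "\<lbrakk>M \<in> complexified n S; N \<in> complexified n S\<rbrakk> \<Longrightarrow> comm M N \<in> complexified n S"
    and add_closed: "\<lbrakk>M \<in> complexified n S; N \<in> complexified n S\<rbrakk> \<Longrightarrow> M + N \<in> complexified n S"
    and smult_closed: "M \<in> complexified n S \<Longrightarrow> c \<cdot>\<^sub>m M \<in> complexified n S"
    and rep_carrier: "M \<in> complexified n S \<Longrightarrow> \<Psi> M \<in> carrier_mat m m"
    and rep_add: "\<lbrakk>M \<in> complexified n S; N \<in> complexified n S\<rbrakk> \<Longrightarrow> \<Psi> (M + N) = \<Psi> M + \<Psi> N"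
    and rep_smult: "M \<in> complexified n S \<Longrightarrow> \<Psi> (c \<cdot>\<^sub>m M) = c \<cdot>\<^sub>m \<Psi> M"
    and rep_comm: "\<lbrakk>M \<in> complexified n S; N \<in> complexified n S\<rbrakk> \<Longrightarrow> \<Psi> (comm M N) = comm (\<Psi> M) (\<Psi> N)"
    and rep_inj: "M \<in> complexified n S \<Longrightarrow> \<Psi> M = 0\<^sub>m m m \<Longrightarrow> M = 0\<^sub>m n n"

text \<open>Padding with zeros makes the target size exactly \<open>m\<close>.\<close>

lemma complex_rep_exists:
  assumes rep: "faithful_representation (matrix_lie_alg n S) N \<phi>"
    and S: "S \<subseteq> carrier_mat n n" and Nm: "N \<le> m"
  obtains \<Psi> where "complex_rep n m S \<Psi>"
    "\<And>M. M \<in> complexified n S \<Longrightarrow> \<Psi> (map_mat cnj M) = map_mat cnj (\<Psi> M)"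
proof -
  interpret faithful_representation "matrix_lie_alg n S" N \<phi> by fact
  note [simp] = comm_index[where n = n] comm_index[where n = N] comm_index[where n = m]
  let ?C = "complexified n S"
  have c: "X \<in> carrier_mat n n" if "X \<in> S" for X using that S by auto
  have Sadd: "X + Y \<in> S" if "X \<in> S" "Y \<in> S" for X Y
    using that M.a_closed by simp
  have Ssmult: "r \<cdot>\<^sub>m X \<in> S" if "X \<in> S" for X r
    using that smult_closed[of r X] by (simp add: class_ring_simps)
  have Scomm: "comm X Y \<in> S" if "X \<in> S" "Y \<in> S" for X Y
    using that bracket_closed by simp
  have pc: "\<phi> X \<in> carrier_mat N N" if "X \<in> S" for X
    using that hom by (auto simp: lie_hom_def)
  have padd: "\<phi> (X + Y) = \<phi> X + \<phi> Y" if "X \<in> S" "Y \<in> S" for X Y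
    using that hom by (auto simp: lie_hom_def)
  have psmult: "\<phi> (r \<cdot>\<^sub>m X) = r \<cdot>\<^sub>m \<phi> X" if "X \<in> S" for X r
    using that hom by (auto simp: lie_hom_def)
  have pcomm: "\<phi> (comm X Y) = comm (\<phi> X) (\<phi> Y)" if "X \<in> S" "Y \<in> S" for X Y
    using that hom by (auto simp: lie_hom_def)
  have S0: "0\<^sub>m n n \<in> S" using M.zero_closed by simp
  have p0: "\<phi> (0\<^sub>m n n) = 0\<^sub>m N N"
  proof -
    have "\<phi> (0 \<cdot>\<^sub>m 0\<^sub>m n n) = 0 \<cdot>\<^sub>m \<phi> (0\<^sub>m n n)" by (rule psmult[OF S0])
    moreover have "0 \<cdot>\<^sub>m \<phi> (0\<^sub>m n n) = 0\<^sub>m N N" using pc[OF S0] by (auto intro!: eq_matI)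
    moreover have "0 \<cdot>\<^sub>m 0\<^sub>m n n = (0\<^sub>m n n :: real mat)" by (auto intro!: eq_matI)
    ultimately show ?thesis by simp
  qed
  have reim: "M \<in> carrier_mat n n" "map_mat Re M \<in> S" "map_mat Im M \<in> S" if "M \<in> ?C" for M
    using that by (auto simp: complexified_def)
  have comm_Re: "map_mat Re (comm M M') =
      comm (map_mat Re M) (map_mat Re M') + (-1) \<cdot>\<^sub>m comm (map_mat Im M) (map_mat Im M')"
    if "M \<in> ?C" "M' \<in> ?C" for M M'
    using reim(1)[OF that(1)] reim(1)[OF that(2)]
    by (intro eq_matI) (auto simp: sum.distrib[symmetric] sum_negf[symmetric] algebra_simps intro!: sum.cong)
  have comm_Im: "map_mat Im (comm M M') =
      comm (map_mat Re M) (map_mat Im M') + comm (map_mat Im M) (map_mat Re M')"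
    if "M \<in> ?C" "M' \<in> ?C" for M M'
    using reim(1)[OF that(1)] reim(1)[OF that(2)]
    by (intro eq_matI) (auto simp: sum.distrib[symmetric] algebra_simps intro!: sum.cong)
  have sm_Re: "map_mat Re (z \<cdot>\<^sub>m M) = Re z \<cdot>\<^sub>m map_mat Re M + (- Im z) \<cdot>\<^sub>m map_mat Im M"
    and sm_Im: "map_mat Im (z \<cdot>\<^sub>m M) = Re z \<cdot>\<^sub>m map_mat Im M + Im z \<cdot>\<^sub>m map_mat Re M"
    and ca: "map_mat Re (map_mat cnj M) = map_mat Re M"
      "map_mat Im (map_mat cnj M) = (-1) \<cdot>\<^sub>m map_mat Im M"
    for z M
    by (auto intro!: eq_matI)
  have ad: "map_mat Re (M + M') = map_mat Re M + map_mat Re M'"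
     "map_mat Im (M + M') = map_mat Im M + map_mat Im M'" if "M \<in> ?C" "M' \<in> ?C" for M M'
    using reim(1)[OF that(1)] reim(1)[OF that(2)] by (auto intro!: eq_matI)
  \<comment> \<open>The complex linear extension \<open>\<phi> (Re M) + \<i> \<phi> (Im M)\<close>
    in the upper left block of size \<open>N\<close>, and zeros elsewhere.\<close>
  define \<Psi> where "\<Psi> M = mat m m (\<lambda>(i, j). if i < N \<and> j < N
    then Complex (\<phi> (map_mat Re M) $$ (i, j)) (\<phi> (map_mat Im M) $$ (i, j)) else 0)" for M
  have \<Psi>c: "\<Psi> M \<in> carrier_mat m m" for M by (simp add: \<Psi>_def)
  have "complex_rep n m S \<Psi>"
  proof
    fix M M' z assume M: "M \<in> ?C"
    note r = reim[OF M]
    show "z \<cdot>\<^sub>m M \<in> ?C"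
      using r by (simp add: complexified_def sm_Re sm_Im Sadd Ssmult)
    show "\<Psi> M \<in> carrier_mat m m" by (rule \<Psi>c)
    show "\<Psi> (z \<cdot>\<^sub>m M) = z \<cdot>\<^sub>m \<Psi> M"
      using pc[OF r(2)] pc[OF r(3)]
      by (intro eq_matI) (auto simp: \<Psi>_def sm_Re sm_Im padd psmult Ssmult r complex_eq_iff)
    show "M = 0\<^sub>m n n" if "\<Psi> M = 0\<^sub>m m m"
    proof -
      have e: "Complex (\<phi> (map_mat Re M) $$ (i, j)) (\<phi> (map_mat Im M) $$ (i, j)) = 0"
        if "i < N" "j < N" for i j
      proof -
        have "\<Psi> M $$ (i, j) = 0\<^sub>m m m $$ (i, j)" using \<open>\<Psi> M = 0\<^sub>m m m\<close> by simp
        then show ?thesis using that Nm by (simp add: \<Psi>_def)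
      qed
      have "\<phi> (map_mat Re M) = 0\<^sub>m N N" "\<phi> (map_mat Im M) = 0\<^sub>m N N"
        using pc[OF r(2)] pc[OF r(3)] e by (auto intro!: eq_matI simp: complex_eq_iff)
      then have z: "map_mat Re M = 0\<^sub>m n n" "map_mat Im M = 0\<^sub>m n n"
        using inj r S0 p0 unfolding inj_on_def by (metis matrix_lie_alg_simps(1))+
      show ?thesis
      proof (rule eq_matI)
        fix i j assume "i < dim_row (0\<^sub>m n n :: complex mat)" "j < dim_col (0\<^sub>m n n :: complex mat)"
        then show "M $$ (i, j) = 0\<^sub>m n n $$ (i, j)"
          using r(1) arg_cong[OF z(1), of "\<lambda>X. X $$ (i, j)"] arg_cong[OF z(2), of "\<lambda>X. X $$ (i, j)"]
          by (auto simp: complex_eq_iff)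
      qed (use r in auto)
    qed
    assume M': "M' \<in> ?C"
    note r' = reim[OF M']
    show "comm M M' \<in> ?C"
      using r r' by (simp add: complexified_def comm_Re[OF M M'] comm_Im[OF M M'] Sadd Ssmult Scomm)
    show "M + M' \<in> ?C"
      using r r' by (simp add: complexified_def ad[OF M M'] Sadd)
    show "\<Psi> (M + M') = \<Psi> M + \<Psi> M'"
      using pc[OF r(2)] pc[OF r(3)] pc[OF r'(2)] pc[OF r'(3)]
      by (intro eq_matI) (auto simp: \<Psi>_def ad[OF M M'] padd r r' complex_eq_iff)
    \<comment> \<open>The padding adds only zero terms to the inner sum of a matrix product.\<close>
    have cut: "(\<Sum>l<m. if l < N then f l else 0) = (\<Sum>l<N. f l)" for f :: "nat \<Rightarrow> complex"
      using Nm by (intro sum.mono_neutral_cong_right) auto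
    show "\<Psi> (comm M M') = comm (\<Psi> M) (\<Psi> M')"
    proof (rule eq_matI)
      fix i j assume "i < dim_row (comm (\<Psi> M) (\<Psi> M'))" "j < dim_col (comm (\<Psi> M) (\<Psi> M'))"
      then have ij: "i < m" "j < m" using comm_carrier[OF \<Psi>c \<Psi>c, of M M'] by auto
      show "\<Psi> (comm M M') $$ (i, j) = comm (\<Psi> M) (\<Psi> M') $$ (i, j)"
      proof (cases "i < N \<and> j < N")
        case True
        have "comm (\<Psi> M) (\<Psi> M') $$ (i, j) =
            (\<Sum>l<m. if l < N then \<Psi> M $$ (i, l) * \<Psi> M' $$ (l, j) - \<Psi> M' $$ (i, l) * \<Psi> M $$ (l, j) else 0)"
          using ij by (simp add: \<Psi>c) (auto intro!: sum.cong simp: \<Psi>_def)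
        also have "\<dots> = (\<Sum>l<N. \<Psi> M $$ (i, l) * \<Psi> M' $$ (l, j) - \<Psi> M' $$ (i, l) * \<Psi> M $$ (l, j))"
          by (rule cut)
        also have "\<dots> = \<Psi> (comm M M') $$ (i, j)"
          using ij True Nm pc[OF r(2)] pc[OF r(3)] pc[OF r'(2)] pc[OF r'(3)]
          by (simp add: \<Psi>_def comm_Re[OF M M'] comm_Im[OF M M'] padd psmult pcomm Scomm Ssmult r r'
              complex_eq_iff sum.distrib[symmetric] sum_negf[symmetric] sum_subtractf[symmetric] algebra_simps)
        finally show ?thesis by simp
      next
        case False
        have "comm (\<Psi> M) (\<Psi> M') $$ (i, j) = 0"
          using ij False by (simp add: \<Psi>c) (auto intro!: sum.neutral simp: \<Psi>_def)
        then show ?thesis using ij False by (auto simp: \<Psi>_def)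
      qed
    qed (use comm_carrier[OF \<Psi>c \<Psi>c, of M M'] in \<open>auto simp: \<Psi>_def\<close>)
  qed
  moreover have "\<Psi> (map_mat cnj M) = map_mat cnj (\<Psi> M)" if "M \<in> ?C" for M
    using pc[OF reim(3)[OF that]] Nm
    by (intro eq_matI) (auto simp: \<Psi>_def ca psmult reim[OF that] complex_eq_iff)
  ultimately show ?thesis by (rule that)
qed

section \<open>Spectra of sl2-triples\<close>

text \<open>\<open>A\<close>, \<open>B\<close>, \<open>C\<close> are the standard H, E, F of
  sl2.\<close>

definition sl2_triple :: "nat \<Rightarrow> complex mat \<Rightarrow> complex mat \<Rightarrow> complex mat \<Rightarrow> bool" where
  "sl2_triple n A B C \<longleftrightarrow> A \<in> carrier_mat n n \<and> B \<in> carrier_mat n n \<and> C \<in> carrier_mat n n \<and>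
     comm A B = 2 \<cdot>\<^sub>m B \<and> comm A C = (-2) \<cdot>\<^sub>m C \<and> comm B C = A"

section \<open>Change of basis, triangular form, and weights as differences of eigenvalues\<close>

lemma comm_conj:
  assumes "X \<in> carrier_mat n n" "Y \<in> carrier_mat n n" "P \<in> carrier_mat n n" "Q \<in> carrier_mat n n"
    and "P * Q = 1\<^sub>m n"
  shows "comm (Q * X * P) (Q * Y * P) = Q * comm X Y * P"
proof -
  have *: "(Q * X * P) * (Q * Y * P) = Q * (X * Y) * P"
    if "X \<in> carrier_mat n n" "Y \<in> carrier_mat n n" for X Y :: "'a mat"
  proof -
    have "(Q * X * P) * (Q * Y * P) = Q * X * (P * Q) * (Y * P)"
      using that assms(3,4) by (simp add: assoc_mult_mat[of _ n n _ n _ n])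
    then show ?thesis
      using that assms(3-5) by (simp add: assoc_mult_mat[of _ n n _ n _ n])
  qed
  show ?thesis
    unfolding comm_def[of "Q * X * P"] *[OF assms(1,2)] *[OF assms(2,1)] using assms
    by (simp add: comm_def mult_minus_distrib_mat[of _ n n _ n] minus_mult_distrib_mat[of _ n n _ _ n])
qed

lemma mult_cancel_inverse:
  fixes P :: "'a::comm_ring_1 mat"
  assumes "P \<in> carrier_mat n n" "Q \<in> carrier_mat n n" "P * Q = 1\<^sub>m n" "X \<in> carrier_mat n k"
  shows "P * (Q * X) = X"
proof -
  have "P * (Q * X) = P * Q * X" by (rule assoc_mult_mat[symmetric]) fact+
  also have "\<dots> = X" unfolding assms(3) using assms(4) by simp
  finally show ?thesis .
qed

lemma conj_eq_zeroD:
  fixes X :: "'a::comm_ring_1 mat"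
  assumes X: "X \<in> carrier_mat n n" and PQ: "P \<in> carrier_mat n n" "Q \<in> carrier_mat n n" "P * Q = 1\<^sub>m n"
    and zero: "Q * X * P = 0\<^sub>m n n"
  shows "X = 0\<^sub>m n n"
proof -
  have QX: "Q * X \<in> carrier_mat n n" using X PQ by simp
  have "Q * X * P * Q = Q * X * (P * Q)" by (rule assoc_mult_mat) fact+
  also have "\<dots> = Q * X" unfolding PQ(3) using QX X by simp
  finally have "X = P * (0\<^sub>m n n * Q)"
    using mult_cancel_inverse[OF PQ X] zero by simp
  then show ?thesis using PQ by simp
qed

text \<open>The order of \<open>es\<close> is free and becomes the order of the diagonal. Later
  arguments depend on it: they choose which eigenvalue stands in the upper left corner.\<close>

lemma schur_similar:
  fixes A :: "complex mat"
  assumes A: "A \<in> carrier_mat n n" and cp: "char_poly A = (\<Prod>e\<leftarrow>es. [:- e, 1:])"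
  obtains P Q where "P \<in> carrier_mat n n" "Q \<in> carrier_mat n n" "P * Q = 1\<^sub>m n" "Q * P = 1\<^sub>m n"
    "upper_triangular (Q * A * P)" "diag_mat (Q * A * P) = es"
proof -
  obtain T P Q where s: "schur_decomposition A es = (T, P, Q)" by (metis prod_cases3)
  have sim: "similar_mat_wit A T P Q" and T: "upper_triangular T" "diag_mat T = es"
    using schur_decomposition[OF A cp s] by auto
  note w = similar_mat_witD2[OF A sim]
  have "Q * A * P = T"
    using w by (simp add: mult_cancel_inverse[of Q n P] assoc_mult_mat[of _ n n _ n _ n])
  then show ?thesis using that[of P Q] w T by simp
qed

lemma eigenvalue_iff_factor:
  fixes A :: "complex mat"
  assumes "A \<in> carrier_mat n n" "char_poly A = (\<Prod>e\<leftarrow>es. [:- e, 1:])"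
  shows "eigenvalue A x \<longleftrightarrow> x \<in> set es"
  unfolding eigenvalue_root_char_poly[OF assms(1)] assms(2)
  by (induction es) (auto simp: algebra_simps)

text \<open>\<open>X\<close> carries the generalized eigenspace for \<open>l - k\<close> into the
  one for \<open>l\<close>. In triangular form this becomes a statement about a single corner entry
  of the conjugate of \<open>X\<close>.\<close>

lemma eigenvalues_of_weight:
  fixes A X :: "complex mat"
  assumes A: "A \<in> carrier_mat n n" and X: "X \<in> carrier_mat n n"
    and w: "comm A X = k \<cdot>\<^sub>m X" and nz: "X \<noteq> 0\<^sub>m n n"
  obtains l where "eigenvalue A l" "eigenvalue A (l - k)"
proof -
  obtain es where es: "char_poly A = (\<Prod>e\<leftarrow>es. [:- e, 1:])" "length es = n"
    using char_poly_factorized[OF A] by auto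
  obtain P Q where PQ: "P \<in> carrier_mat n n" "Q \<in> carrier_mat n n" "P * Q = 1\<^sub>m n" "Q * P = 1\<^sub>m n"
    and ut: "upper_triangular (Q * A * P)" and dg: "diag_mat (Q * A * P) = es"
    using schur_similar[OF A es(1)] by metis
  define T where "T = Q * A * P"
  define Y where "Y = Q * X * P"
  have c: "T \<in> carrier_mat n n" "Y \<in> carrier_mat n n"
    using A X PQ by (auto simp: T_def Y_def)
  have TY: "comm T Y = k \<cdot>\<^sub>m Y"
    using A X PQ unfolding T_def Y_def comm_conj[OF A X PQ(1-3)] w
    by (simp add: mult_smult_distrib[of _ n n _ n] mult_smult_assoc_mat[of _ n n _ n])
  have T0: "T $$ (i, j) = 0" if "j < i" "i < n" for i j
    using ut that c by (auto simp: upper_triangular_def T_def)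
  have eig: "eigenvalue A (T $$ (i, i))" if "i < n" for i
    using that c dg[symmetric]
    by (auto simp: eigenvalue_iff_factor[OF A es(1)] T_def diag_mat_def)
  have "Y \<noteq> 0\<^sub>m n n" using conj_eq_zeroD[OF X PQ(1-3)] nz by (auto simp: Y_def)
  then obtain i0 j0 where ij0: "i0 < n" "j0 < n" "Y $$ (i0, j0) \<noteq> 0"
    using c by (metis carrier_matD eq_matI index_zero_mat)
  \<comment> \<open>The lowest and then leftmost nonzero entry of \<open>Y\<close> sees only the diagonal of \<open>T\<close>.\<close>
  define I where "I = {i. i < n \<and> (\<exists>j<n. Y $$ (i, j) \<noteq> 0)}"
  define i where "i = Max I"
  have I: "finite I" "I \<noteq> {}" using ij0 by (auto simp: I_def)
  have "i \<in> I" using Max_in[OF I] by (simp add: i_def)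
  then have i: "i < n" and ex: "\<exists>j. j < n \<and> Y $$ (i, j) \<noteq> 0" by (auto simp: I_def)
  have below: "Y $$ (l, j) = 0" if "i < l" "l < n" "j < n" for l j
    using that Max_ge[OF I(1), of l] unfolding i_def[symmetric] by (auto simp: I_def)
  define j where "j = (LEAST j. j < n \<and> Y $$ (i, j) \<noteq> 0)"
  have j: "j < n" "Y $$ (i, j) \<noteq> 0" using LeastI_ex[OF ex] by (simp_all add: j_def)
  have left: "Y $$ (i, l) = 0" if "l < j" for l
    using not_less_Least[of l "\<lambda>j. j < n \<and> Y $$ (i, j) \<noteq> 0"] that j by (auto simp: j_def)
  have "k * Y $$ (i, j) = comm T Y $$ (i, j)" using i j c by (simp add: TY)
  also have "\<dots> = (\<Sum>l<n. T $$ (i, l) * Y $$ (l, j)) - (\<Sum>l<n. Y $$ (i, l) * T $$ (l, j))"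
    by (simp add: comm_index[OF c i j(1)] sum_subtractf)
  also have "(\<Sum>l<n. T $$ (i, l) * Y $$ (l, j)) = (\<Sum>l\<in>{i}. T $$ (i, l) * Y $$ (l, j))"
    using i j(1) T0 below by (intro sum.mono_neutral_right) (auto, metis linorder_neqE_nat)
  also have "(\<Sum>l<n. Y $$ (i, l) * T $$ (l, j)) = (\<Sum>l\<in>{j}. Y $$ (i, l) * T $$ (l, j))"
    using i j(1) T0 left by (intro sum.mono_neutral_right) (auto, metis linorder_neqE_nat)
  finally have "(T $$ (i, i) - T $$ (j, j) - k) * Y $$ (i, j) = 0" by (simp add: algebra_simps)
  then have "T $$ (i, i) - T $$ (j, j) - k = 0" using j by (simp only: mult_eq_0_iff simp_thms)
  then have "T $$ (j, j) = T $$ (i, i) - k" by (simp add: algebra_simps)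
  then show ?thesis using that[of "T $$ (i, i)"] eig[OF i] eig[OF j(1)] by simp
qed

text \<open>The diagonal of the triangular form lists the eigenvalues with multiplicity, and this
  form is itself the commutator of the conjugates of \<open>B\<close> and \<open>C\<close>, so its
  trace vanishes.\<close>

lemma sl2_triple_spectrum:
  assumes "sl2_triple n A B C"
  obtains es where "char_poly A = (\<Prod>e\<leftarrow>es. [:- e, 1:])" "length es = n" "sum_list es = 0"
proof -
  have c: "A \<in> carrier_mat n n" "B \<in> carrier_mat n n" "C \<in> carrier_mat n n" and BC: "comm B C = A"
    using assms by (auto simp: sl2_triple_def)
  obtain es where es: "char_poly A = (\<Prod>e\<leftarrow>es. [:- e, 1:])" "length es = n"
    using char_poly_factorized[OF c(1)] by auto
  obtain P Q where PQ: "P \<in> carrier_mat n n" "Q \<in> carrier_mat n n" "P * Q = 1\<^sub>m n"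
    and dg: "diag_mat (Q * A * P) = es"
    using schur_similar[OF c(1) es(1)] by metis
  define B' where "B' = Q * B * P"
  define C' where "C' = Q * C * P"
  have c': "B' \<in> carrier_mat n n" "C' \<in> carrier_mat n n" using c PQ by (auto simp: B'_def C'_def)
  have T: "Q * A * P = comm B' C'"
    using comm_conj[OF c(2,3) PQ] BC by (simp add: B'_def C'_def)
  have "sum_list es = (\<Sum>i<n. comm B' C' $$ (i, i))"
    unfolding dg[symmetric] T using c'
    by (simp add: diag_mat_def interv_sum_list_conv_sum_set_nat lessThan_atLeast0)
  also have "\<dots> = (\<Sum>i<n. \<Sum>l<n. B' $$ (i, l) * C' $$ (l, i)) - (\<Sum>i<n. \<Sum>l<n. C' $$ (i, l) * B' $$ (l, i))"
    using c' by (simp add: comm_index[where n = n] sum_subtractf)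
  also have "(\<Sum>i<n. \<Sum>l<n. C' $$ (i, l) * B' $$ (l, i)) = (\<Sum>i<n. \<Sum>l<n. B' $$ (i, l) * C' $$ (l, i))"
    by (subst sum.swap) (simp add: mult.commute)
  finally show ?thesis using that es by simp
qed

section \<open>Strings of weight vectors and integrality of the eigenvalues\<close>

lemma finite_eigenvalues:
  fixes A :: "complex mat"
  assumes "A \<in> carrier_mat n n"
  shows "finite {x. eigenvalue A x}"
proof -
  obtain es where "char_poly A = (\<Prod>e\<leftarrow>es. [:- e, 1:])"
    using char_poly_factorized[OF assms] by auto
  from eigenvalue_iff_factor[OF assms this] show ?thesis by simp
qed

lemma smult_mat_mult_vec:
  assumes "X \<in> carrier_mat n m" "v \<in> carrier_vec m"
  shows "(c \<cdot>\<^sub>m X) *\<^sub>v v = c \<cdot>\<^sub>v (X *\<^sub>v v)"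
  using assms by (intro eq_vecI) (auto simp: scalar_prod_def sum_distrib_left mult.assoc)

lemma comm_mult_vec:
  assumes "X \<in> carrier_mat n n" "Y \<in> carrier_mat n n" "v \<in> carrier_vec n"
  shows "X *\<^sub>v (Y *\<^sub>v v) = Y *\<^sub>v (X *\<^sub>v v) + comm X Y *\<^sub>v v"
proof -
  have "comm X Y *\<^sub>v v = X * Y *\<^sub>v v - Y * X *\<^sub>v v"
    using assms unfolding comm_def by (intro minus_mult_distrib_mat_vec) auto
  then show ?thesis
    using assms by (auto simp: assoc_mult_mat_vec[of _ n n _ n])
qed

lemma smult_vec_eq_zeroD:
  fixes c :: "'a::idom"
  assumes "c \<cdot>\<^sub>v v = 0\<^sub>v n" "v \<in> carrier_vec n" "v \<noteq> 0\<^sub>v n"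
  shows "c = 0"
proof -
  obtain i where i: "i < n" "v $ i \<noteq> 0"
    using assms(2,3) by (metis carrier_vecD eq_vecI index_zero_vec)
  have "(c \<cdot>\<^sub>v v) $ i = 0" unfolding assms(1) using i by simp
  then show ?thesis using i assms(2) by simp
qed

lemma mult_mat_zero_vec [simp]: "X \<in> carrier_mat n m \<Longrightarrow> X *\<^sub>v 0\<^sub>v m = 0\<^sub>v n"
  by (intro eq_vecI) auto

lemma smult_zero_left_vec [simp]: "v \<in> carrier_vec n \<Longrightarrow> (0::'a::comm_ring_1) \<cdot>\<^sub>v v = 0\<^sub>v n"
  by (intro eq_vecI) auto

text \<open>The classical computation with the string \<open>u, C u, C (C u), ...\<close>: the
  lowering steps decrease the eigenvalue by 2, and going back up with \<open>B\<close> detects where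
  the string can end.\<close>

lemma sl2_highest_weight:
  assumes sl2: "sl2_triple n A B C"
    and u: "u \<in> carrier_vec n" "u \<noteq> 0\<^sub>v n" "A *\<^sub>v u = w \<cdot>\<^sub>v u" "B *\<^sub>v u = 0\<^sub>v n"
  obtains m :: nat where "w = of_nat m" "\<And>i. i \<le> m \<Longrightarrow> eigenvalue A (of_nat m - 2 * of_nat i)"
proof -
  have c: "A \<in> carrier_mat n n" "B \<in> carrier_mat n n" "C \<in> carrier_mat n n"
    and AC: "comm A C = (-2) \<cdot>\<^sub>m C" and BC: "comm B C = A"
    using sl2 by (auto simp: sl2_triple_def)
  define f where "f i = ((\<lambda>v. C *\<^sub>v v) ^^ i) u" for i
  have f0: "f 0 = u" and fS: "f (Suc i) = C *\<^sub>v f i" for i by (simp_all add: f_def)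
  have fc: "f i \<in> carrier_vec n" for i by (induction i) (use u c in \<open>auto simp: f0 fS\<close>)
  have Af: "A *\<^sub>v f i = (w - 2 * of_nat i) \<cdot>\<^sub>v f i" for i
  proof (induction i)
    case 0 then show ?case using u by (simp add: f0)
  next
    case (Suc i)
    have "A *\<^sub>v f (Suc i) = C *\<^sub>v (A *\<^sub>v f i) + comm A C *\<^sub>v f i"
      unfolding fS by (rule comm_mult_vec[OF c(1,3) fc])
    also have "\<dots> = (w - 2 * of_nat i) \<cdot>\<^sub>v f (Suc i) + (-2) \<cdot>\<^sub>v f (Suc i)"
      using c fc[of i] by (simp add: Suc AC fS mult_mat_vec[of C n n] smult_mat_mult_vec[of C n n])
    finally show ?case by (simp add: add_smult_distrib_vec[symmetric] algebra_simps)
  qed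
  \<comment> \<open>Moving \<open>B\<close> past one \<open>C\<close> costs \<open>A\<close>, so the
    coefficient is the sum of the eigenvalues \<open>w - 2 * j\<close> for \<open>j\<close> from 0
    to \<open>i\<close>.\<close>
  have Bf: "B *\<^sub>v f (Suc i) = (of_nat (Suc i) * (w - of_nat i)) \<cdot>\<^sub>v f i" for i
  proof (induction i)
    case 0
    have "B *\<^sub>v f (Suc 0) = C *\<^sub>v (B *\<^sub>v f 0) + comm B C *\<^sub>v f 0"
      unfolding fS by (rule comm_mult_vec[OF c(2,3) fc])
    then show ?case using u c by (simp add: f0 BC)
  next
    case (Suc i)
    have "B *\<^sub>v f (Suc (Suc i)) = C *\<^sub>v (B *\<^sub>v f (Suc i)) + comm B C *\<^sub>v f (Suc i)"
      unfolding fS[of "Suc i"] by (rule comm_mult_vec[OF c(2,3) fc])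
    also have "\<dots> = (of_nat (Suc i) * (w - of_nat i)) \<cdot>\<^sub>v f (Suc i) + (w - 2 * of_nat (Suc i)) \<cdot>\<^sub>v f (Suc i)"
      using c fc[of i] by (simp only: Suc BC Af) (simp add: fS mult_mat_vec[of C n n])
    finally show ?case by (simp add: add_smult_distrib_vec[symmetric] algebra_simps)
  qed
  have eig: "eigenvalue A (w - 2 * of_nat i)" if "f i \<noteq> 0\<^sub>v n" for i
    using that fc Af c by (auto simp: eigenvalue_def eigenvector_def)
  \<comment> \<open>Otherwise the string would yield infinitely many distinct eigenvalues.\<close>
  have "\<exists>i. f i = 0\<^sub>v n"
  proof (rule ccontr)
    assume "\<not> ?thesis"
    then have "range (\<lambda>i. w - 2 * of_nat i) \<subseteq> {x. eigenvalue A x}" using eig by auto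
    moreover have "inj (\<lambda>i::nat. w - 2 * of_nat i)" by (auto simp: inj_def)
    ultimately show False
      using finite_eigenvalues[OF c(1)] range_inj_infinite finite_subset by blast
  qed
  then obtain k where k: "f k = 0\<^sub>v n" "\<And>i. i < k \<Longrightarrow> f i \<noteq> 0\<^sub>v n"
    using exists_least_iff[of "\<lambda>i. f i = 0\<^sub>v n"] by blast
  then obtain m where m: "k = Suc m" using u f0 by (cases k) auto
  \<comment> \<open>The first zero is at index \<open>m + 1\<close>. There \<open>B\<close> returns
    a multiple of the nonzero \<open>f m\<close>, so the factor \<open>w - m\<close> must
    vanish.\<close>
  have "(of_nat (Suc m) * (w - of_nat m)) \<cdot>\<^sub>v f m = 0\<^sub>v n"
    using Bf[of m] k(1) c(2) by (simp add: m)
  then have "of_nat (Suc m) * (w - of_nat m) = 0"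
    by (rule smult_vec_eq_zeroD) (use fc k m in auto)
  then have "w = of_nat m" by (simp del: of_nat_Suc)
  then show ?thesis using that[of m] eig k m by auto
qed

text \<open>The scalar \<open>c\<close> is kept general so that the same argument moves upward with
  \<open>B\<close> (\<open>c = 2\<close>) and downward with \<open>C\<close>
  (\<open>c = -2\<close>).\<close>

lemma sl2_raise:
  assumes A: "A \<in> carrier_mat n n" and B: "B \<in> carrier_mat n n" and AB: "comm A B = c \<cdot>\<^sub>m B"
    and "c \<noteq> 0" and eig: "eigenvalue (A :: complex mat) l"
  obtains u k where "u \<in> carrier_vec n" "u \<noteq> 0\<^sub>v n" "A *\<^sub>v u = (l + c * of_nat k) \<cdot>\<^sub>v u" "B *\<^sub>v u = 0\<^sub>v n"
proof -
  obtain u where u: "u \<in> carrier_vec n" "u \<noteq> 0\<^sub>v n" "A *\<^sub>v u = l \<cdot>\<^sub>v u"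
    using eig A by (auto simp: eigenvalue_def eigenvector_def)
  define f where "f i = ((\<lambda>v. B *\<^sub>v v) ^^ i) u" for i
  have f0: "f 0 = u" and fS: "f (Suc i) = B *\<^sub>v f i" for i by (simp_all add: f_def)
  have fc: "f i \<in> carrier_vec n" for i by (induction i) (use u B in \<open>auto simp: f0 fS\<close>)
  have Af: "A *\<^sub>v f i = (l + c * of_nat i) \<cdot>\<^sub>v f i" for i
  proof (induction i)
    case 0 then show ?case using u by (simp add: f0)
  next
    case (Suc i)
    have "A *\<^sub>v f (Suc i) = B *\<^sub>v (A *\<^sub>v f i) + comm A B *\<^sub>v f i"
      unfolding fS by (rule comm_mult_vec[OF A B fc])
    also have "\<dots> = (l + c * of_nat i) \<cdot>\<^sub>v f (Suc i) + c \<cdot>\<^sub>v f (Suc i)"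
      using A B fc[of i] by (simp add: Suc AB fS mult_mat_vec[of B n n] smult_mat_mult_vec[of B n n])
    finally show ?case by (simp add: add_smult_distrib_vec[symmetric] algebra_simps)
  qed
  have "\<exists>i. f i = 0\<^sub>v n"
  proof (rule ccontr)
    assume "\<not> ?thesis"
    then have "range (\<lambda>i. l + c * of_nat i) \<subseteq> {x. eigenvalue A x}"
      using fc Af A by (auto simp: eigenvalue_def eigenvector_def)
    moreover have "inj (\<lambda>i::nat. l + c * of_nat i)" using \<open>c \<noteq> 0\<close> by (auto simp: inj_def)
    ultimately show False
      using finite_eigenvalues[OF A] range_inj_infinite finite_subset by blast
  qed
  then obtain k where k: "f k = 0\<^sub>v n" "\<And>i. i < k \<Longrightarrow> f i \<noteq> 0\<^sub>v n"
    using exists_least_iff[of "\<lambda>i. f i = 0\<^sub>v n"] by blast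
  then obtain m where "k = Suc m" using u f0 by (cases k) auto
  then show ?thesis using that[of "f m" m] fc Af k fS by auto
qed

text \<open>For \<open>k \<ge> 0\<close>, raising an eigenvector ends at a highest weight
  \<open>m \<ge> k\<close>, and its string \<open>m, m - 2, ..., -m\<close> contains all the
  required \<open>j\<close>. For negative \<open>k\<close>, the same is done downward from a lowest
  weight, because the raised string is not known to reach down to \<open>k\<close>.\<close>

lemma sl2_eigenvalue_cases:
  assumes sl2: "sl2_triple n A B C" and eig: "eigenvalue A l"
  obtains k :: int where "l = of_int k"
    "\<And>j. even (k - j) \<Longrightarrow> \<bar>j\<bar> \<le> \<bar>k\<bar> \<Longrightarrow> eigenvalue A (of_int j)"
proof -
  have c: "A \<in> carrier_mat n n" "B \<in> carrier_mat n n" "C \<in> carrier_mat n n"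
    and rel: "comm A B = 2 \<cdot>\<^sub>m B" "comm A C = (-2) \<cdot>\<^sub>m C" "comm B C = A"
    using sl2 by (auto simp: sl2_triple_def)
  have nz: "(2::complex) \<noteq> 0" "(-2::complex) \<noteq> 0" by simp_all
  obtain u p where u: "u \<in> carrier_vec n" "u \<noteq> 0\<^sub>v n" "B *\<^sub>v u = 0\<^sub>v n"
    "A *\<^sub>v u = (l + 2 * of_nat p) \<cdot>\<^sub>v u"
    using sl2_raise[OF c(1,2) rel(1) nz(1) eig] by blast
  obtain m where m: "l + 2 * of_nat p = of_nat m"
    "\<And>i. i \<le> m \<Longrightarrow> eigenvalue A (of_nat m - 2 * of_nat i)"
    using sl2_highest_weight[OF sl2 u(1,2,4,3)] by blast
  \<comment> \<open>The flip that exchanges highest and lowest weights: a vector killed by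
    \<open>C\<close> is a highest weight vector for \<open>- A, C, B\<close>.\<close>
  have neg: "sl2_triple n (- A) C B"
  proof -
    have 1: "comm (- A) X = (-1) \<cdot>\<^sub>m comm A X" if "X \<in> carrier_mat n n" for X
      by (rule eq_matI) (use c that in \<open>auto simp: comm_index[where n = n] sum_negf[symmetric] intro!: sum.cong\<close>)
    have 2: "comm C B = (-1) \<cdot>\<^sub>m comm B C"
      by (rule eq_matI) (use c in \<open>auto simp: comm_index[where n = n] sum_negf[symmetric] intro!: sum.cong\<close>)
    show ?thesis
      unfolding sl2_triple_def 1[OF c(2)] 1[OF c(3)] 2 rel using c by (auto intro!: eq_matI)
  qed
  have negv: "(- A) *\<^sub>v v = w \<cdot>\<^sub>v v \<longleftrightarrow> A *\<^sub>v v = (- w) \<cdot>\<^sub>v v" if "v \<in> carrier_vec n" for v w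
    using that c by (auto simp: vec_eq_iff neg_eq_iff_add_eq_0 eq_neg_iff_add_eq_0 add.commute)
  have nege: "eigenvalue (- A) x \<longleftrightarrow> eigenvalue A (- x)" for x
    unfolding eigenvalue_def eigenvector_def by (metis negv c(1) carrier_matD(1) index_uminus_mat(2))
  obtain v q where v: "v \<in> carrier_vec n" "v \<noteq> 0\<^sub>v n" "C *\<^sub>v v = 0\<^sub>v n"
    "A *\<^sub>v v = (l + (-2) * of_nat q) \<cdot>\<^sub>v v"
    using sl2_raise[OF c(1,3) rel(2) nz(2) eig] by blast
  have "(- A) *\<^sub>v v = (- (l + (-2) * of_nat q)) \<cdot>\<^sub>v v" using v negv by simp
  then obtain m' where m': "- (l + (-2) * of_nat q) = of_nat m'"
    "\<And>i. i \<le> m' \<Longrightarrow> eigenvalue (- A) (of_nat m' - 2 * of_nat i)"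
    using sl2_highest_weight[OF neg v(1,2) _ v(3)] by blast
  define k where "k = int m - 2 * int p"
  have l: "l = of_int k" using m(1) by (simp add: k_def algebra_simps)
  have "(of_int k :: complex) = of_int (2 * int q - int m')" using m'(1) l by (simp add: algebra_simps)
  then have k': "k = 2 * int q - int m'" by (simp only: of_int_eq_iff)
  show ?thesis
  proof (rule that[OF l])
    fix j assume j: "even (k - j)" "\<bar>j\<bar> \<le> \<bar>k\<bar>"
    show "eigenvalue A (of_int j)"
    proof (cases "0 \<le> k")
      case True
      define i where "i = nat ((int m - j) div 2)"
      have "even (int m - j)" using j by (simp add: k_def)
      then have i: "int m - 2 * int i = j" "i \<le> m"
        using j True by (auto simp: i_def k_def)
      have "eigenvalue A (of_nat m - 2 * of_nat i)" by (rule m(2)[OF i(2)])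
      also have "of_nat m - 2 * of_nat i = (of_int (int m - 2 * int i) :: complex)" by simp
      finally show ?thesis by (simp only: i)
    next
      case False
      define i where "i = nat ((int m' + j) div 2)"
      have "even (int m' + j)" using j by (simp add: k')
      then have i: "2 * int i - int m' = j" "i \<le> m'"
        using j False by (auto simp: i_def k')
      have "eigenvalue A (- (of_nat m' - 2 * of_nat i))" using m'(2)[OF i(2)] nege by simp
      also have "- (of_nat m' - 2 * of_nat i) = (of_int (2 * int i - int m') :: complex)" by simp
      finally show ?thesis by (simp only: i)
    qed
  qed
qed

text \<open>The two eigenvalues that differ by the odd \<open>k\<close> have opposite parity. The
  string of the even one contains 0, that of the odd one contains 1 and -1.\<close>

lemma sl2_eigenvalues_odd_weight:
  assumes sl2: "sl2_triple n A B C" and X: "X \<in> carrier_mat n n" "X \<noteq> 0\<^sub>m n n"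
    and w: "comm A X = of_int k \<cdot>\<^sub>m X" and k: "odd k"
  shows "eigenvalue A 0" "eigenvalue A 1" "eigenvalue A (-1)"
proof -
  have A: "A \<in> carrier_mat n n" using sl2 by (simp add: sl2_triple_def)
  obtain l where l: "eigenvalue A l" "eigenvalue A (l - of_int k)"
    using eigenvalues_of_weight[OF A X(1) w X(2)] by blast
  obtain p where p: "l = of_int p" "\<And>j. even (p - j) \<Longrightarrow> \<bar>j\<bar> \<le> \<bar>p\<bar> \<Longrightarrow> eigenvalue A (of_int j)"
    using sl2_eigenvalue_cases[OF sl2 l(1)] by blast
  obtain q where q: "l - of_int k = of_int q" "\<And>j. even (q - j) \<Longrightarrow> \<bar>j\<bar> \<le> \<bar>q\<bar> \<Longrightarrow> eigenvalue A (of_int j)"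
    using sl2_eigenvalue_cases[OF sl2 l(2)] by blast
  have "(of_int (p - k) :: complex) = of_int q" using p(1) q(1) by simp
  then have pq: "q = p - k" by (simp only: of_int_eq_iff)
  have ev: "eigenvalue A (of_int j)" if "\<bar>j\<bar> \<le> 1" for j
  proof (cases "even (p - j)")
    case True
    then have "\<bar>j\<bar> \<le> \<bar>p\<bar>" using that by (cases "p = 0") auto
    then show ?thesis using p True by blast
  next
    case False
    then have e: "even (q - j)" using k pq by auto
    then have "\<bar>j\<bar> \<le> \<bar>q\<bar>" using that by (cases "q = 0") auto
    then show ?thesis using q e by blast
  qed
  show "eigenvalue A 0" "eigenvalue A 1" "eigenvalue A (-1)"
    using ev[of 0] ev[of 1] ev[of "-1"] by simp_all
qed

text \<open>Knowing all but one eigenvalue is enough: trace zero gives the last one, which may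
  repeat an element of \<open>xs\<close>.\<close>

lemma sl2_char_poly:
  assumes sl2: "sl2_triple (Suc (length xs)) A B C" and xs: "distinct xs" "\<And>x. x \<in> set xs \<Longrightarrow> eigenvalue A x"
  shows "char_poly A = (\<Prod>e\<leftarrow>xs @ [- sum_list xs]. [:- e, 1:])"
proof -
  have A: "A \<in> carrier_mat (Suc (length xs)) (Suc (length xs))" using sl2 by (simp add: sl2_triple_def)
  obtain es where es: "char_poly A = (\<Prod>e\<leftarrow>es. [:- e, 1:])" "length es = Suc (length xs)" "sum_list es = 0"
    using sl2_triple_spectrum[OF sl2] by blast
  have sub: "set xs \<subseteq> set es" using xs(2) eigenvalue_iff_factor[OF A es(1)] by auto
  have "mset xs \<subseteq># mset es"
  proof (rule mset_subset_eqI)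
    \<comment> \<open>Distinctness bounds each multiplicity in \<open>xs\<close> by one, so that
      inclusion of sets becomes inclusion of multisets.\<close>
    fix a show "count (mset xs) a \<le> count (mset es) a"
    proof (cases "a \<in> set xs")
      case True
      then have "count (mset xs) a = 1" using xs(1) by (simp add: distinct_count_atmost_1)
      moreover have "a \<in># mset es" using True sub by auto
      ultimately show ?thesis by (simp add: Suc_leI)
    next
      case False
      then have "a \<notin># mset xs" by simp
      then show ?thesis by (simp only: not_in_iff)
    qed
  qed
  then obtain T where T: "mset es = mset xs + T" by (metis mset_subset_eq_exists_conv)
  have "size T = 1" using arg_cong[OF T, of size] es(2) by simp
  then obtain t where t: "T = {#t#}" by (metis size_1_singleton_mset)
  have "sum_mset (mset es) = sum_list xs + t" unfolding T t by (simp add: sum_mset_sum_list)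
  then have t': "t = - sum_list xs" using es(3) by (simp add: sum_mset_sum_list eq_neg_iff_add_eq_0 add.commute)
  have "(\<Prod>e\<leftarrow>es. [:- e, 1:]) = prod_mset (image_mset (\<lambda>e. [:- e, 1:]) (mset es))"
    by (simp add: prod_mset_prod_list flip: mset_map)
  also have "\<dots> = (\<Prod>e\<leftarrow>xs @ [- sum_list xs]. [:- e, 1:])"
    unfolding T t t' by (simp add: prod_mset_prod_list mult.commute flip: mset_map)
  finally show ?thesis using es(1) by simp
qed

lemma mult_index3:
  assumes "X \<in> carrier_mat 3 3" "Y \<in> carrier_mat 3 3" "i < 3" "j < 3"
  shows "(X * Y) $$ (i, j) = X $$ (i, 0) * Y $$ (0, j) + X $$ (i, Suc 0) * Y $$ (Suc 0, j) + X $$ (i, 2) * Y $$ (2, j)"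
  using assms by (simp add: scalar_prod_def lessThan_atLeast0[symmetric] sum_lessThan_small)

section \<open>Representations of size 3\<close>

definition diag3 :: "complex \<Rightarrow> complex mat" where
  "diag3 a = mat_of_rows_list 3 [[a, 0, 0], [0, - a, 0], [0, 0, 0]]"

lemma diag3_carrier [simp]: "diag3 a \<in> carrier_mat 3 3"
  by (simp add: diag3_def mat_of_rows_list_simps)

lemma diagonalize3:
  fixes A :: "complex mat"
  assumes A: "A \<in> carrier_mat 3 3" and cp: "char_poly A = (\<Prod>e\<leftarrow>[a, - a, 0]. [:- e, 1:])" and a: "a \<noteq> 0"
  obtains P Q where "P \<in> carrier_mat 3 3" "Q \<in> carrier_mat 3 3" "P * Q = 1\<^sub>m 3" "Q * A * P = diag3 a"
proof -
  obtain P Q where PQ: "P \<in> carrier_mat 3 3" "Q \<in> carrier_mat 3 3" "P * Q = 1\<^sub>m 3" "Q * P = 1\<^sub>m 3"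
    and ut: "upper_triangular (Q * A * P)" and dg: "diag_mat (Q * A * P) = [a, - a, 0]"
    using schur_similar[OF A cp] by metis
  define T where "T = Q * A * P"
  have T: "T \<in> carrier_mat 3 3" using A PQ by (simp add: T_def)
  have T0: "T $$ (Suc 0, 0) = 0" "T $$ (2, 0) = 0" "T $$ (2, Suc 0) = 0"
    using ut T unfolding T_def[symmetric] upper_triangular_def by auto
  have "map (\<lambda>i. T $$ (i, i)) [0, 1, 2] = [a, - a, 0]"
    using dg T unfolding T_def[symmetric] diag_mat_def by (simp add: eval_nat_numeral)
  then have Td: "T $$ (0, 0) = a" "T $$ (Suc 0, Suc 0) = - a" "T $$ (2, 2) = 0" by simp_all
  \<comment> \<open>The entries solve \<open>T * U = U * diag3 a\<close> for a unitriangular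
    \<open>U\<close>: its columns are eigenvectors of \<open>T\<close> for \<open>a\<close>,
    \<open>-a\<close> and 0. The divisions by \<open>2 * a\<close> and \<open>a\<close> are by
    differences of eigenvalues.\<close>
  define x where "x = - T $$ (0, Suc 0) / (2 * a)"
  define z where "z = T $$ (Suc 0, 2) / a"
  define y where "y = - (T $$ (0, 2) + T $$ (0, Suc 0) * z) / a"
  define U where "U = mat_of_rows_list 3 [[1, x, y], [0, 1, z], [0, 0, 1]]"
  define V where "V = mat_of_rows_list 3 [[1, - x, x * z - y], [0, 1, - z], [0, 0, 1]]"
  have UV: "U \<in> carrier_mat 3 3" "V \<in> carrier_mat 3 3"
    by (simp_all add: U_def V_def mat_of_rows_list_simps)
  have "U * V = 1\<^sub>m 3"
    by (rule eq_matI) (auto simp: U_def V_def mat_of_rows_list_def scalar_prod_def eval_nat_numeral less_Suc_eq)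
  have off: "T $$ (0, Suc 0) = - (2 * a * x)" "T $$ (Suc 0, 2) = a * z" "T $$ (0, 2) = 2 * a * x * z - a * y"
    using a by (simp_all add: x_def y_def z_def)
  have "V * T * U = diag3 a"
    using T UV
    by (simp add: mat3_eq_iff all_less_small mult_index3 del: index_mult_mat(1))
      (simp add: T0 Td off U_def V_def diag3_def mat_of_rows_list_simps algebra_simps)
  show ?thesis
  proof (rule that[of "P * U" "V * Q"])
    show "P * U * (V * Q) = 1\<^sub>m 3"
      using PQ UV \<open>U * V = 1\<^sub>m 3\<close> mult_cancel_inverse[OF UV \<open>U * V = 1\<^sub>m 3\<close> PQ(2)]
      by (simp add: assoc_mult_mat[of _ 3 3 _ 3 _ 3])
    show "V * Q * A * (P * U) = diag3 a"
      using PQ UV A \<open>V * T * U = diag3 a\<close> by (simp add: T_def assoc_mult_mat[of _ 3 3 _ 3 _ 3])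
  qed (use PQ UV in auto)
qed

lemma complex_rep_conj:
  assumes "complex_rep n m S \<Psi>" and PQ: "P \<in> carrier_mat m m" "Q \<in> carrier_mat m m" "P * Q = 1\<^sub>m m"
  shows "complex_rep n m S (\<lambda>M. Q * \<Psi> M * P)"
proof -
  interpret complex_rep n m S \<Psi> by fact
  show ?thesis
  proof
    fix M N c assume M: "M \<in> complexified n S"
    note r = rep_carrier[OF M]
    show "c \<cdot>\<^sub>m M \<in> complexified n S" by (rule smult_closed[OF M])
    show "Q * \<Psi> M * P \<in> carrier_mat m m" using r PQ by simp
    show "Q * \<Psi> (c \<cdot>\<^sub>m M) * P = c \<cdot>\<^sub>m (Q * \<Psi> M * P)"
      using r PQ unfolding rep_smult[OF M]
      by (simp add: mult_smult_distrib[of _ m m _ m] mult_smult_assoc_mat[of _ m m _ m])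
    show "M = 0\<^sub>m n n" if "Q * \<Psi> M * P = 0\<^sub>m m m"
      using conj_eq_zeroD[OF r PQ that] rep_inj[OF M] by simp
    assume N: "N \<in> complexified n S"
    note r' = rep_carrier[OF N]
    show "comm M N \<in> complexified n S" "M + N \<in> complexified n S"
      by (rule comm_closed add_closed; fact)+
    show "Q * \<Psi> (M + N) * P = Q * \<Psi> M * P + Q * \<Psi> N * P"
      using r r' PQ unfolding rep_add[OF M N]
      by (simp add: mult_add_distrib_mat[of _ m m _ m] add_mult_distrib_mat[of _ m m _ _ m])
    show "Q * \<Psi> (comm M N) * P = comm (Q * \<Psi> M * P) (Q * \<Psi> N * P)"
      unfolding rep_comm[OF M N] comm_conj[OF r r' PQ] ..
  qed
qed

lemma (in complex_rep) rep_nonzero: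
  assumes "M \<in> complexified n S" "M \<noteq> 0\<^sub>m n n"
  shows "\<Psi> M \<noteq> 0\<^sub>m m m"
  using rep_inj assms by blast

lemma (in complex_rep) rep_zero:
  assumes "M \<in> complexified n S"
  shows "\<Psi> (0\<^sub>m n n) = 0\<^sub>m m m"
proof -
  have "M \<in> carrier_mat n n" using assms by (simp add: complexified_def)
  then have "0 \<cdot>\<^sub>m M = 0\<^sub>m n n" "0 \<cdot>\<^sub>m \<Psi> M = 0\<^sub>m m m"
    using rep_carrier[OF assms] by (auto intro!: eq_matI)
  then show ?thesis using rep_smult[OF assms, of 0] by simp
qed

lemma (in complex_rep) rep_sl2_triple:
  assumes "A \<in> complexified n S" "B \<in> complexified n S" "C \<in> complexified n S" "sl2_triple n A B C"
  shows "sl2_triple m (\<Psi> A) (\<Psi> B) (\<Psi> C)"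
  using assms rep_carrier rep_comm[of A B] rep_comm[of A C] rep_comm[of B C]
    rep_smult[of B 2] rep_smult[of C "-2"]
  by (simp add: sl2_triple_def)

text \<open>The cases \<open>a = 1\<close> and \<open>a = 2\<close> correspond to the two nontrivial
  sl2-modules of dimension 3: natural plus trivial, and adjoint.\<close>

lemma (in complex_rep) diagonal_rep3:
  assumes m: "m = 3"
    and ABC: "A \<in> complexified n S" "B \<in> complexified n S" "C \<in> complexified n S" "sl2_triple n A B C"
    and B: "B \<noteq> 0\<^sub>m n n"
  obtains \<Psi>' a where "complex_rep n 3 S \<Psi>'" "a = 1 \<or> a = 2" "\<Psi>' A = diag3 a"
proof -
  have sl2: "sl2_triple 3 (\<Psi> A) (\<Psi> B) (\<Psi> C)"
    using rep_sl2_triple[OF ABC] m by simp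
  then have A: "\<Psi> A \<in> carrier_mat 3 3" and B': "\<Psi> B \<in> carrier_mat 3 3" "comm (\<Psi> A) (\<Psi> B) = 2 \<cdot>\<^sub>m \<Psi> B"
    by (auto simp: sl2_triple_def)
  have nz: "\<Psi> B \<noteq> 0\<^sub>m 3 3" using rep_nonzero[OF ABC(2) B] m by simp
  obtain l where l: "eigenvalue (\<Psi> A) l" "eigenvalue (\<Psi> A) (l - 2)"
    using eigenvalues_of_weight[OF A B' nz] by blast
  \<comment> \<open>\<open>l\<close> and \<open>l - 2\<close> cannot both be 0.\<close>
  then obtain l' where l': "eigenvalue (\<Psi> A) l'" "l' \<noteq> 0"
    by (metis diff_0 neg_equal_0_iff_equal zero_neq_numeral)
  obtain k where k: "l' = of_int k"
    "\<And>j. even (k - j) \<Longrightarrow> \<bar>j\<bar> \<le> \<bar>k\<bar> \<Longrightarrow> eigenvalue (\<Psi> A) (of_int j)"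
    using sl2_eigenvalue_cases[OF sl2 l'(1)] by blast
  have k0: "k \<noteq> 0" using l' k by auto
  have "\<exists>a. (a = 1 \<or> a = 2) \<and> eigenvalue (\<Psi> A) a \<and> eigenvalue (\<Psi> A) (- a)"
  \<comment> \<open>A nonzero even \<open>k\<close> has absolute value at least 2, so 2 and -2 lie
    in its range; for odd \<open>k\<close> the pair is 1 and -1.\<close>
  proof (cases "even k")
    case True
    then have "2 \<le> \<bar>k\<bar>" using k0 by (auto elim!: evenE)
    then show ?thesis using k(2)[of 2] k(2)[of "-2"] True by auto
  next
    case False
    then show ?thesis using k(2)[of 1] k(2)[of "-1"] k0 by auto
  qed
  then obtain a where a: "a = 1 \<or> a = 2" "eigenvalue (\<Psi> A) a" "eigenvalue (\<Psi> A) (- a)" by blast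
  have "char_poly (\<Psi> A) = (\<Prod>e\<leftarrow>[a, - a] @ [- sum_list [a, - a]]. [:- e, 1:])"
    by (rule sl2_char_poly) (use sl2 a in \<open>auto simp: eval_nat_numeral\<close>)
  then have cp: "char_poly (\<Psi> A) = (\<Prod>e\<leftarrow>[a, - a, 0]. [:- e, 1:])" by simp
  have "a \<noteq> 0" using a(1) by auto
  then obtain P Q where PQ: "P \<in> carrier_mat 3 3" "Q \<in> carrier_mat 3 3" "P * Q = 1\<^sub>m 3" "Q * \<Psi> A * P = diag3 a"
    using diagonalize3[OF A cp] by blast
  show ?thesis
  proof (rule that[OF _ a(1)])
    show "complex_rep n 3 S (\<lambda>M. Q * \<Psi> M * P)"
      using complex_rep_conj[OF _ PQ(1-3)] complex_rep_axioms m by simp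
  qed (rule PQ(4))
qed

section \<open>Matrices of given weight for a diagonal A of size 3\<close>

lemma diag3_comm_index:
  assumes "X \<in> carrier_mat 3 3" "i < 3" "j < 3"
  shows "comm (diag3 a) X $$ (i, j) = ([a, - a, 0] ! i - [a, - a, 0] ! j) * X $$ (i, j)"
proof -
  have "i = 0 \<or> i = Suc 0 \<or> i = 2" "j = 0 \<or> j = Suc 0 \<or> j = 2" using assms by auto
  then show ?thesis
    by (elim disjE)
      (simp_all add: comm_index[OF diag3_carrier assms(1)] sum_lessThan_small,
       simp_all add: diag3_def mat_of_rows_list_simps algebra_simps)
qed

lemma diag3_weight_entry:
  assumes "X \<in> carrier_mat 3 3" "comm (diag3 a) X = w \<cdot>\<^sub>m X"
    and "i < 3" "j < 3" "[a, - a, 0] ! i - [a, - a, 0] ! j \<noteq> w"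
  shows "X $$ (i, j) = 0"
  using diag3_comm_index[OF assms(1,3,4), of a] assms by auto

text \<open>If neither vanished, then \<open>v = 2 * u\<close> and \<open>u = 2 * v\<close>, hence
  \<open>u = 4 * u\<close>; if one vanishes, so does the square of the other. This system arises
  both in the Heisenberg and in the adjoint case.\<close>

lemma quadratic_system_only_zero:
  fixes u v :: complex
  assumes "u * (v - 2 * u) = 0" "v * (u - 2 * v) = 0"
  shows "u = 0" "v = 0"
  using assms by auto

text \<open>For \<open>a = 1\<close>, put \<open>u = X $$ (0, 2) * Y $$ (2, 0)\<close> and
  \<open>v = X $$ (2, 1) * Y $$ (1, 2)\<close>. Then \<open>comm X Y\<close> is diagonal with
  entries \<open>u, -v, v - u\<close>, and the two surviving entries of
  \<open>comm X (comm X Y)\<close> give the quadratic system for \<open>u\<close> and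
  \<open>v\<close>.\<close>

lemma diag3_heisenberg:
  assumes a: "a = 1 \<or> a = 2" and c: "X \<in> carrier_mat 3 3" "Y \<in> carrier_mat 3 3"
    and w: "comm (diag3 a) X = 1 \<cdot>\<^sub>m X" "comm (diag3 a) Y = (-1) \<cdot>\<^sub>m Y"
    and z: "comm X (comm X Y) = 0\<^sub>m 3 3"
  shows "comm X Y = 0\<^sub>m 3 3"
  using a
proof
  assume a: "a = 1"
  note X0 = diag3_weight_entry[OF c(1) w(1)] and Y0 = diag3_weight_entry[OF c(2) w(2)]
  \<comment> \<open>For the eigenvalues 1, -1, 0, weight 1 lives at positions (0, 2) and (2, 1),
    weight -1 at their transposes.\<close>
  have X: "X $$ (0, 0) = 0" "X $$ (0, Suc 0) = 0" "X $$ (Suc 0, 0) = 0" "X $$ (Suc 0, Suc 0) = 0" "X $$ (Suc 0, 2) = 0"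
    "X $$ (2, 0) = 0" "X $$ (2, 2) = 0"
    by (rule X0; simp add: a)+
  have Y: "Y $$ (0, 0) = 0" "Y $$ (0, Suc 0) = 0" "Y $$ (Suc 0, 0) = 0" "Y $$ (Suc 0, Suc 0) = 0" "Y $$ (0, 2) = 0"
    "Y $$ (2, Suc 0) = 0" "Y $$ (2, 2) = 0"
    by (rule Y0; simp add: a)+
  note ix = comm_index[where n = 3] sum_lessThan_small
  have Z: "comm X Y $$ (i, j) = (X $$ (i, 0) * Y $$ (0, j) - Y $$ (i, 0) * X $$ (0, j))
    + (X $$ (i, Suc 0) * Y $$ (Suc 0, j) - Y $$ (i, Suc 0) * X $$ (Suc 0, j))
    + (X $$ (i, 2) * Y $$ (2, j) - Y $$ (i, 2) * X $$ (2, j))" if "i < 3" "j < 3" for i j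
    using c that by (simp add: ix)
  have "comm X (comm X Y) $$ (0, 2) = 0" "comm X (comm X Y) $$ (2, Suc 0) = 0" using z by simp_all
  then have e: "X $$ (0, 2) * (X $$ (2, Suc 0) * Y $$ (Suc 0, 2) - 2 * (X $$ (0, 2) * Y $$ (2, 0))) = 0"
    "X $$ (2, Suc 0) * (X $$ (0, 2) * Y $$ (2, 0) - 2 * (X $$ (2, Suc 0) * Y $$ (Suc 0, 2))) = 0"
    using c by (simp_all add: comm_index[OF c(1) comm_carrier[OF c]] sum_lessThan_small Z X Y algebra_simps)
  have "X $$ (0, 2) * Y $$ (2, 0) = 0" "X $$ (2, Suc 0) * Y $$ (Suc 0, 2) = 0"
    using quadratic_system_only_zero[of "X $$ (0, 2) * Y $$ (2, 0)" "X $$ (2, Suc 0) * Y $$ (Suc 0, 2)"] e by auto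
  then show ?thesis
    using c by (simp add: mat3_eq_iff all_less_small Z X Y) (auto simp: mult.commute)
next
  assume a: "a = 2"
  \<comment> \<open>All differences of the eigenvalues 2, -2, 0 are even, so weight 1 does not
    occur.\<close>
  have "X = 0\<^sub>m 3 3"
    using c(1) by (auto simp: mat3_eq_iff all_less_small a intro!: diag3_weight_entry[OF c(1) w(1)])
  then show ?thesis using c by (auto simp: comm_def)
qed

text \<open>Weight 2 leaves one entry of \<open>X\<close> for \<open>a = 1\<close> and two entries
  for \<open>a = 2\<close>. \<open>comm B C = diag3 a\<close> makes the matching entries of
  \<open>C\<close> nonzero, so the vanishing double commutator can be solved for the entries of
  \<open>X\<close>.\<close>

lemma diag3_adjoint:
  assumes a: "a = 1 \<or> a = 2" and sl2: "sl2_triple 3 (diag3 a) B C" and c: "X \<in> carrier_mat 3 3"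
    and w: "comm (diag3 a) X = 2 \<cdot>\<^sub>m X" and z: "comm X (comm C X) = 0\<^sub>m 3 3"
  shows "X = 0\<^sub>m 3 3"
proof -
  have BC: "B \<in> carrier_mat 3 3" "C \<in> carrier_mat 3 3" "comm (diag3 a) B = 2 \<cdot>\<^sub>m B"
    "comm (diag3 a) C = (-2) \<cdot>\<^sub>m C" "comm B C = diag3 a"
    using sl2 by (auto simp: sl2_triple_def)
  note X0 = diag3_weight_entry[OF c w] and B0 = diag3_weight_entry[OF BC(1,3)]
    and C0 = diag3_weight_entry[OF BC(2,4)]
  have Z: "comm C X $$ (i, j) = (C $$ (i, 0) * X $$ (0, j) - X $$ (i, 0) * C $$ (0, j))
    + (C $$ (i, Suc 0) * X $$ (Suc 0, j) - X $$ (i, Suc 0) * C $$ (Suc 0, j))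
    + (C $$ (i, 2) * X $$ (2, j) - X $$ (i, 2) * C $$ (2, j))" if "i < 3" "j < 3" for i j
    using c BC that by (simp add: comm_index[where n = 3] sum_lessThan_small)
  have e: "comm X (comm C X) $$ (0, Suc 0) = 0" "comm X (comm C X) $$ (0, 2) = 0" "comm X (comm C X) $$ (2, Suc 0) = 0"
    using z by simp_all
  have H: "comm B C $$ (0, 0) = a" "comm B C $$ (Suc 0, Suc 0) = - a"
    unfolding BC(5) by (simp_all add: diag3_def mat_of_rows_list_simps)
  note ix = comm_index[OF c comm_carrier[OF BC(2) c]] comm_index[OF BC(1,2)] sum_lessThan_small
  show ?thesis
    using a
  proof
    assume a: "a = 1"
    have X: "X $$ (0, 0) = 0" "X $$ (0, 2) = 0" "X $$ (Suc 0, 0) = 0" "X $$ (Suc 0, Suc 0) = 0" "X $$ (Suc 0, 2) = 0"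
      "X $$ (2, 0) = 0" "X $$ (2, Suc 0) = 0" "X $$ (2, 2) = 0"
      by (rule X0; simp add: a)+
    have B: "B $$ (0, 0) = 0" "B $$ (0, 2) = 0" "B $$ (Suc 0, 0) = 0" "B $$ (Suc 0, Suc 0) = 0" "B $$ (Suc 0, 2) = 0"
      "B $$ (2, 0) = 0" "B $$ (2, Suc 0) = 0" "B $$ (2, 2) = 0"
      by (rule B0; simp add: a)+
    have C: "C $$ (0, 0) = 0" "C $$ (0, 2) = 0" "C $$ (0, Suc 0) = 0" "C $$ (Suc 0, Suc 0) = 0" "C $$ (Suc 0, 2) = 0"
      "C $$ (2, 0) = 0" "C $$ (2, Suc 0) = 0" "C $$ (2, 2) = 0"
      by (rule C0; simp add: a)+
    \<comment> \<open>The corner entry of \<open>comm B C\<close> is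
      \<open>B $$ (0, 1) * C $$ (1, 0) = 1\<close>.\<close>
    have "C $$ (Suc 0, 0) \<noteq> 0" using H(1) a by (auto simp: ix B C)
    moreover have "2 * (C $$ (Suc 0, 0) * X $$ (0, Suc 0) * X $$ (0, Suc 0)) = 0"
      using e(1) by (simp add: ix Z X C)
    ultimately have "X $$ (0, Suc 0) = 0" by simp
    then show ?thesis using c X by (simp add: mat3_eq_iff all_less_small)
  next
    assume a: "a = 2"
    have X: "X $$ (0, 0) = 0" "X $$ (0, Suc 0) = 0" "X $$ (Suc 0, 0) = 0" "X $$ (Suc 0, Suc 0) = 0" "X $$ (Suc 0, 2) = 0"
      "X $$ (2, 0) = 0" "X $$ (2, 2) = 0"
      by (rule X0; simp add: a)+
    have B: "B $$ (0, 0) = 0" "B $$ (0, Suc 0) = 0" "B $$ (Suc 0, 0) = 0" "B $$ (Suc 0, Suc 0) = 0" "B $$ (Suc 0, 2) = 0"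
      "B $$ (2, 0) = 0" "B $$ (2, 2) = 0"
      by (rule B0; simp add: a)+
    have C: "C $$ (0, 0) = 0" "C $$ (0, Suc 0) = 0" "C $$ (Suc 0, 0) = 0" "C $$ (Suc 0, Suc 0) = 0" "C $$ (0, 2) = 0"
      "C $$ (2, Suc 0) = 0" "C $$ (2, 2) = 0"
      by (rule C0; simp add: a)+
    \<comment> \<open>The first two diagonal entries of \<open>comm B C\<close> read
      \<open>B $$ (0, 2) * C $$ (2, 0) = 2\<close> and
      \<open>- (C $$ (1, 2) * B $$ (2, 1)) = -2\<close>.\<close>
    have nz: "C $$ (2, 0) \<noteq> 0" "C $$ (Suc 0, 2) \<noteq> 0" using H a by (auto simp: ix B C)
    have "X $$ (0, 2) * (C $$ (Suc 0, 2) * X $$ (2, Suc 0) - 2 * (C $$ (2, 0) * X $$ (0, 2))) = 0"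
      "X $$ (2, Suc 0) * (C $$ (2, 0) * X $$ (0, 2) - 2 * (C $$ (Suc 0, 2) * X $$ (2, Suc 0))) = 0"
      using e(2,3) by (simp_all add: ix Z X C algebra_simps) auto
    then have "C $$ (2, 0) * X $$ (0, 2) = 0" "C $$ (Suc 0, 2) * X $$ (2, Suc 0) = 0"
      using quadratic_system_only_zero[of "C $$ (2, 0) * X $$ (0, 2)" "C $$ (Suc 0, 2) * X $$ (2, Suc 0)"] by auto
    then show ?thesis using c X nz by (simp add: mat3_eq_iff all_less_small)
  qed
qed

text \<open>The three eigenvalues are distinct, so weight 0 means diagonal.\<close>

lemma diag3_weight_zero_commute:
  assumes a: "a = 1 \<or> a = 2" and c: "G \<in> carrier_mat 3 3" "F \<in> carrier_mat 3 3"
    and w: "comm (diag3 a) G = 0 \<cdot>\<^sub>m G" "comm (diag3 a) F = 0 \<cdot>\<^sub>m F"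
  shows "comm G F = 0\<^sub>m 3 3"
proof -
  have "G $$ (i, j) = 0" "F $$ (i, j) = 0" if "i \<noteq> j" "i < 3" "j < 3" for i j
  proof -
    have "[a, - a, 0] ! i - [a, - a, 0] ! j \<noteq> 0"
      using that a by (auto simp: eval_nat_numeral less_Suc_eq)
    then show "G $$ (i, j) = 0" "F $$ (i, j) = 0"
      using diag3_weight_entry[OF c(1) w(1)] diag3_weight_entry[OF c(2) w(2)] that by auto
  qed
  then show ?thesis
    using c by (simp add: mat3_eq_iff all_less_small comm_index[OF c] sum_lessThan_small)
qed

text \<open>For \<open>a = 1\<close>, the only entry of \<open>comm X Y\<close> that can be nonzero
  is the determinant of the pairs of entries at (0, 2) and (2, 1), so commuting means
  proportional.\<close>

lemma diag3_commuting_dependent: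
  assumes a: "a = 1 \<or> a = 2" and c: "X \<in> carrier_mat 3 3" "Y \<in> carrier_mat 3 3"
    and w: "comm (diag3 a) X = 1 \<cdot>\<^sub>m X" "comm (diag3 a) Y = 1 \<cdot>\<^sub>m Y"
    and z: "comm X Y = 0\<^sub>m 3 3"
  obtains x y where "x \<noteq> 0 \<or> y \<noteq> 0" "x \<cdot>\<^sub>m X + y \<cdot>\<^sub>m Y = 0\<^sub>m 3 3"
proof -
  have "\<exists>x y. (x \<noteq> 0 \<or> y \<noteq> 0) \<and> x \<cdot>\<^sub>m X + y \<cdot>\<^sub>m Y = 0\<^sub>m 3 3"
    using a
  proof
    assume a: "a = 1"
    have X: "X $$ (0, 0) = 0" "X $$ (0, Suc 0) = 0" "X $$ (Suc 0, 0) = 0" "X $$ (Suc 0, Suc 0) = 0" "X $$ (Suc 0, 2) = 0"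
      "X $$ (2, 0) = 0" "X $$ (2, 2) = 0"
      by (rule diag3_weight_entry[OF c(1) w(1)]; simp add: a)+
    have Y: "Y $$ (0, 0) = 0" "Y $$ (0, Suc 0) = 0" "Y $$ (Suc 0, 0) = 0" "Y $$ (Suc 0, Suc 0) = 0" "Y $$ (Suc 0, 2) = 0"
      "Y $$ (2, 0) = 0" "Y $$ (2, 2) = 0"
      by (rule diag3_weight_entry[OF c(2) w(2)]; simp add: a)+
    have "comm X Y $$ (0, Suc 0) = 0" using z by simp
    then have det: "X $$ (0, 2) * Y $$ (2, Suc 0) = Y $$ (0, 2) * X $$ (2, Suc 0)"
      by (simp add: comm_index[OF c] sum_lessThan_small X Y)
    \<comment> \<open>The relation is read off from the entries at (0, 2), or from those at (2, 1)
      when both of the former vanish. If this still gives \<open>x = y = 0\<close>, then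
      \<open>X\<close> itself is zero.\<close>
    define x y where "x = (if X $$ (0, 2) = 0 \<and> Y $$ (0, 2) = 0 then Y $$ (2, Suc 0) else Y $$ (0, 2))"
      and "y = (if X $$ (0, 2) = 0 \<and> Y $$ (0, 2) = 0 then - X $$ (2, Suc 0) else - X $$ (0, 2))"
    show ?thesis
    proof (cases "x = 0 \<and> y = 0")
      case True
      then have "X = 0\<^sub>m 3 3"
        using c X by (auto simp: mat3_eq_iff all_less_small x_def y_def split: if_splits)
      then have "1 \<cdot>\<^sub>m X + 0 \<cdot>\<^sub>m Y = 0\<^sub>m 3 3" using c by (auto intro!: eq_matI)
      then show ?thesis using one_neq_zero by blast
    next
      case False
      have "x \<cdot>\<^sub>m X + y \<cdot>\<^sub>m Y = 0\<^sub>m 3 3"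
        using c det by (simp add: mat3_eq_iff all_less_small X Y) (auto simp: x_def y_def algebra_simps)
      then show ?thesis using False by blast
    qed
  next
    assume a: "a = 2"
    have "X = 0\<^sub>m 3 3"
      using c(1) by (auto simp: mat3_eq_iff all_less_small a intro!: diag3_weight_entry[OF c(1) w(1)])
    then have "1 \<cdot>\<^sub>m X + 0 \<cdot>\<^sub>m Y = 0\<^sub>m 3 3" using c by (auto intro!: eq_matI)
    then show ?thesis using one_neq_zero by blast
  qed
  then show ?thesis using that by blast
qed

section \<open>Representations of size 2 and 4\<close>

text \<open>The fourth eigenvalue, 0, is forced by the trace. Listing -1 first puts it in the upper
  left corner of the triangular form, where its eigenvectors are easy to describe.\<close>

lemma sl2_triple_char_poly4:
  assumes sl2: "sl2_triple 4 A B C" and X: "X \<in> carrier_mat 4 4" "X \<noteq> 0\<^sub>m 4 4"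
    and w: "comm A X = of_int k \<cdot>\<^sub>m X" and k: "odd k"
  shows "char_poly A = (\<Prod>e\<leftarrow>[-1, 1, 0, 0]. [:- e, 1:])"
proof -
  have "char_poly A = (\<Prod>e\<leftarrow>[-1, 1, 0] @ [- sum_list [-1, 1, 0]]. [:- e, 1:])"
    by (rule sl2_char_poly) (use sl2 sl2_eigenvalues_odd_weight[OF sl2 X w k] in \<open>auto simp: eval_nat_numeral\<close>)
  then show ?thesis by simp
qed

lemma no_odd_weight_in_dim2:
  assumes sl2: "sl2_triple 2 A B C" and X: "X \<in> carrier_mat 2 2" "X \<noteq> 0\<^sub>m 2 2"
    and w: "comm A X = of_int k \<cdot>\<^sub>m X" and k: "odd k"
  shows False
proof -
  have A: "A \<in> carrier_mat 2 2" using sl2 by (simp add: sl2_triple_def)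
  obtain es where es: "char_poly A = (\<Prod>e\<leftarrow>es. [:- e, 1:])" "length es = 2"
    using char_poly_factorized[OF A] by auto
  have "{0, 1, -1} \<subseteq> set es"
    using sl2_eigenvalues_odd_weight[OF sl2 X w k] eigenvalue_iff_factor[OF A es(1)] by auto
  then have "card {0, 1, -1 :: complex} \<le> length es"
    using card_mono[of "set es" "{0, 1, -1}"] card_length[of es] by simp
  then show False using es by simp
qed

lemma no_weight3_in_dim4:
  assumes sl2: "sl2_triple 4 A B C" and X: "X \<in> carrier_mat 4 4" "X \<noteq> 0\<^sub>m 4 4"
    and w: "comm A X = 3 \<cdot>\<^sub>m X"
  shows False
proof -
  have A: "A \<in> carrier_mat 4 4" using sl2 by (simp add: sl2_triple_def)
  obtain l where l: "eigenvalue A l" "eigenvalue A (l - 3)"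
    using eigenvalues_of_weight[OF A X(1) w X(2)] by blast
  have "char_poly A = (\<Prod>e\<leftarrow>[-1, 1, 0, 0]. [:- e, 1:])"
    by (rule sl2_triple_char_poly4[OF sl2 X, of 3]) (use w in simp_all)
  from eigenvalue_iff_factor[OF A this] show False using l by auto
qed

section \<open>The obstruction from complex conjugation in size 4\<close>

lemma map_vec_cnj_mult:
  assumes "M \<in> carrier_mat n n" "v \<in> carrier_vec n"
  shows "map_vec cnj (M *\<^sub>v v) = map_mat cnj M *\<^sub>v map_vec cnj v"
  using assms by (intro eq_vecI) (auto simp: scalar_prod_def)

lemma map_vec_cnj_smult: "map_vec cnj (c \<cdot>\<^sub>v v) = cnj c \<cdot>\<^sub>v map_vec cnj v"
  by (intro eq_vecI) auto

text \<open>Conjugation is an antilinear involution which swaps the weight spaces for \<open>1\<close> and \<open>-1\<close>.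
  Both are lines, so it would make the two-dimensional module of \<open>su(2)\<close> real.\<close>

lemma no_compact_odd_weight_in_dim4:
  assumes sl2: "sl2_triple 4 A B C" and X: "X \<in> carrier_mat 4 4" "X \<noteq> 0\<^sub>m 4 4"
    and w: "comm A X = of_int k \<cdot>\<^sub>m X" and k: "odd k"
    and cnjA: "map_mat cnj A = (-1) \<cdot>\<^sub>m A" and cnjB: "map_mat cnj B = (-1) \<cdot>\<^sub>m C"
  shows False
proof -
  have c: "A \<in> carrier_mat 4 4" "B \<in> carrier_mat 4 4" "C \<in> carrier_mat 4 4"
    and rel: "comm A B = 2 \<cdot>\<^sub>m B" "comm A C = (-2) \<cdot>\<^sub>m C" "comm B C = A"
    using sl2 by (auto simp: sl2_triple_def)
  have cp: "char_poly A = (\<Prod>e\<leftarrow>[-1, 1, 0, 0]. [:- e, 1:])"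
    by (rule sl2_triple_char_poly4[OF sl2 X w k])
  note eig = eigenvalue_iff_factor[OF c(1) cp]
  obtain P Q where PQ: "P \<in> carrier_mat 4 4" "Q \<in> carrier_mat 4 4" "P * Q = 1\<^sub>m 4" "Q * P = 1\<^sub>m 4"
    and ut: "upper_triangular (Q * A * P)" and dg: "diag_mat (Q * A * P) = [-1, 1, 0, 0]"
    using schur_similar[OF c(1) cp] by metis
  define T where "T = Q * A * P"
  have T: "T \<in> carrier_mat 4 4" using c PQ by (simp add: T_def)
  have T0: "T $$ (i, j) = 0" if "j < i" "i < 4" for i j
    using ut T that unfolding T_def[symmetric] upper_triangular_def by auto
  have "map (\<lambda>i. T $$ (i, i)) [0, 1, 2, 3] = [-1, 1, 0, 0]"
    using dg T unfolding T_def[symmetric] diag_mat_def by (simp add: eval_nat_numeral)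
  then have Td: "T $$ (Suc 0, Suc 0) = 1" "T $$ (2, 2) = 0" "T $$ (3, 3) = 0" by simp_all
  have PQv: "P *\<^sub>v (Q *\<^sub>v y) = y" if "y \<in> carrier_vec 4" for y
    using assoc_mult_mat_vec[OF PQ(1,2) that] PQ(3) that by simp
  \<comment> \<open>Back substitution in triangular form: the later diagonal entries 1, 0, 0 all
    differ from -1, so an eigenvector for -1 has only its first coordinate.\<close>
  have first: "(Q *\<^sub>v u) $ i = 0"
    if u: "u \<in> carrier_vec 4" "A *\<^sub>v u = (-1) \<cdot>\<^sub>v u" and i: "i \<in> {1, 2, 3}" for u i
  proof -
    define x where "x = Q *\<^sub>v u"
    have x: "x \<in> carrier_vec 4" using u PQ by (simp add: x_def)
    have "T *\<^sub>v x = Q *\<^sub>v (A *\<^sub>v (P *\<^sub>v (Q *\<^sub>v u)))"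
      using u PQ c by (simp only: T_def x_def assoc_mult_mat_vec[of _ 4 4 _ 4] mult_mat_vec_carrier mult_carrier_mat)
    also have "\<dots> = (-1) \<cdot>\<^sub>v x" using u PQ by (simp add: x_def PQv mult_mat_vec[of Q 4 4])
    finally have Tx': "T *\<^sub>v x = (-1) \<cdot>\<^sub>v x" .
    have Tx: "(\<Sum>j<4. T $$ (i, j) * x $ j) = - x $ i" if "i < 4" for i
    proof -
      have "(\<Sum>j<4. T $$ (i, j) * x $ j) = (T *\<^sub>v x) $ i"
        using that T x by (simp add: scalar_prod_def lessThan_atLeast0)
      then show ?thesis unfolding Tx' using that x by simp
    qed
    have x3: "x $ 3 = 0" using Tx[of 3] by (simp add: small_mat_simps T0 Td)
    then have x2: "x $ 2 = 0" using Tx[of 2] by (simp add: small_mat_simps T0 Td)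
    then have "x $ Suc 0 = 0" using Tx[of "Suc 0"] x3 by (simp add: small_mat_simps T0 Td)
    then show ?thesis using x2 x3 i by (auto simp: x_def)
  qed
  have line: "\<exists>\<alpha>. u' = \<alpha> \<cdot>\<^sub>v u"
    if u: "u \<in> carrier_vec 4" "u \<noteq> 0\<^sub>v 4" "A *\<^sub>v u = (-1) \<cdot>\<^sub>v u"
      and u': "u' \<in> carrier_vec 4" "A *\<^sub>v u' = (-1) \<cdot>\<^sub>v u'" for u u'
  proof -
    define x where "x = Q *\<^sub>v u"
    define x' where "x' = Q *\<^sub>v u'"
    have xc: "x \<in> carrier_vec 4" "x' \<in> carrier_vec 4" using u u' PQ by (simp_all add: x_def x'_def)
    have x0: "x $ i = 0" "x' $ i = 0" if "i < 4" "i \<noteq> 0" for i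
    proof -
      have "i \<in> {1, 2, 3}" using that by auto
      then show "x $ i = 0" "x' $ i = 0" using first[OF u(1,3)] first[OF u'] by (simp_all add: x_def x'_def)
    qed
    have "x $ 0 \<noteq> 0"
    proof
      assume "x $ 0 = 0"
      then have "x $ i = 0" if "i < 4" for i using x0(1) that by (cases "i = 0") auto
      then have "x = 0\<^sub>v 4" using xc by (intro eq_vecI) auto
      then have "u = 0\<^sub>v 4" using PQv[OF u(1)] PQ by (simp add: x_def)
      then show False using u by simp
    qed
    then have "\<exists>r. x' $ 0 = r * x $ 0" by (metis nonzero_eq_divide_eq)
    then obtain r where r: "x' $ 0 = r * x $ 0" ..
    have "x' $ i = r * x $ i" if "i < 4" for i
      using x0[of i] r that by (cases "i = 0") simp_all
    then have "x' = r \<cdot>\<^sub>v x" using xc by (intro eq_vecI) auto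
    then have "u' = P *\<^sub>v (r \<cdot>\<^sub>v x)" using PQv[OF u'(1)] by (simp add: x'_def)
    also have "\<dots> = r \<cdot>\<^sub>v u"
      using PQ xc PQv[OF u(1)] by (simp add: mult_mat_vec[of P 4 4] x_def)
    finally show ?thesis by blast
  qed
  have "eigenvalue A 1" using eig by simp
  then obtain v where v: "v \<in> carrier_vec 4" "v \<noteq> 0\<^sub>v 4" "A *\<^sub>v v = 1 \<cdot>\<^sub>v v"
    using c by (auto simp: eigenvalue_def eigenvector_def)
  \<comment> \<open>A nonzero \<open>B v\<close> would be an eigenvector for 3, which is not in the
    spectrum.\<close>
  have Bv: "B *\<^sub>v v = 0\<^sub>v 4"
  proof (rule ccontr)
    assume nz: "B *\<^sub>v v \<noteq> 0\<^sub>v 4"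
    have "A *\<^sub>v (B *\<^sub>v v) = B *\<^sub>v (A *\<^sub>v v) + comm A B *\<^sub>v v"
      by (rule comm_mult_vec[OF c(1,2) v(1)])
    also have "\<dots> = 3 \<cdot>\<^sub>v (B *\<^sub>v v)"
      using v c by (simp add: rel smult_mat_mult_vec[of B 4 4]) (auto intro!: eq_vecI)
    finally have "eigenvalue A 3"
      using nz c v by (auto simp: eigenvalue_def eigenvector_def intro!: exI[of _ "B *\<^sub>v v"])
    then show False using eig by simp
  qed
  \<comment> \<open>Conjugation sends \<open>A\<close> to \<open>- A\<close>, so \<open>u\<close>
    spans the eigenline for -1, on which \<open>C v\<close> lies as well.\<close>
  define u where "u = map_vec cnj v"
  have cnju: "map_vec cnj u = v" by (auto simp: u_def intro!: eq_vecI)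
  have u: "u \<in> carrier_vec 4" using v by (simp add: u_def)
  have unz: "u \<noteq> 0\<^sub>v 4" 
  proof
    assume "u = 0\<^sub>v 4"
    then have "v = 0\<^sub>v 4" using cnju by (auto intro!: eq_vecI)
    then show False using v by simp
  qed
  have "map_vec cnj (A *\<^sub>v v) = (-1) \<cdot>\<^sub>v (A *\<^sub>v u)"
    unfolding map_vec_cnj_mult[OF c(1) v(1)] cnjA u_def[symmetric] by (rule smult_mat_mult_vec[OF c(1) u])
  then have "(-1) \<cdot>\<^sub>v (A *\<^sub>v u) = u" unfolding v(3) by (simp add: u_def)
  moreover have "A *\<^sub>v u = (-1) \<cdot>\<^sub>v ((-1) \<cdot>\<^sub>v (A *\<^sub>v u))" by (simp add: smult_smult_assoc)
  ultimately have Au: "A *\<^sub>v u = (-1) \<cdot>\<^sub>v u" by simp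
  have "A *\<^sub>v (C *\<^sub>v v) = C *\<^sub>v (A *\<^sub>v v) + comm A C *\<^sub>v v"
    by (rule comm_mult_vec[OF c(1,3) v(1)])
  also have "\<dots> = (-1) \<cdot>\<^sub>v (C *\<^sub>v v)"
    using v c by (simp add: rel smult_mat_mult_vec[of C 4 4]) (auto intro!: eq_vecI)
  finally obtain \<alpha> where \<alpha>: "C *\<^sub>v v = \<alpha> \<cdot>\<^sub>v u"
    using line[OF u unz Au, of "C *\<^sub>v v"] c v by auto
  have "B *\<^sub>v (C *\<^sub>v v) = C *\<^sub>v (B *\<^sub>v v) + comm B C *\<^sub>v v"
    by (rule comm_mult_vec[OF c(2,3) v(1)])
  then have v': "\<alpha> \<cdot>\<^sub>v (B *\<^sub>v u) = v"
    using v c u by (simp add: \<alpha> Bv rel mult_mat_vec[of B 4 4])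
  \<comment> \<open>Two relations now meet: \<open>\<alpha> B u = v\<close> from
    \<open>B (C v) = A v = v\<close>, and the conjugate of \<open>B u\<close>, which is
    \<open>- C v = - \<alpha> u\<close>. Conjugating the former and inserting the latter yields
    \<open>\<bar>\<alpha>\<bar>^2 = -1\<close>.\<close>
  have "map_vec cnj (B *\<^sub>v u) = (- \<alpha>) \<cdot>\<^sub>v u"
    using c u v by (simp add: map_vec_cnj_mult[OF c(2) u] cnjB cnju smult_mat_mult_vec[of C 4 4] \<alpha> smult_smult_assoc)
  then have "(cnj \<alpha> * - \<alpha>) \<cdot>\<^sub>v u = u"
    using arg_cong[OF v', of "map_vec cnj"] by (simp add: map_vec_cnj_smult smult_smult_assoc u_def)
  then have "(cnj \<alpha> * - \<alpha> - 1) \<cdot>\<^sub>v u = 0\<^sub>v 4"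
    using u by (auto simp: vec_eq_iff algebra_simps)
  then have "cnj \<alpha> * - \<alpha> - 1 = 0" using smult_vec_eq_zeroD u unz by blast
  then have "- of_real ((cmod \<alpha>)\<^sup>2) = (1 :: complex)"
    by (simp add: complex_norm_square[symmetric] mult.commute algebra_simps del: of_real_power)
  then have "- (cmod \<alpha>)\<^sup>2 = (1 :: real)" by (metis of_real_eq_1_iff of_real_minus)
  then show False by (smt (verit) zero_le_power2)
qed

section \<open>Obstructions to representations of small size\<close>

text \<open>The zero triple satisfies \<open>sl2_triple\<close>; \<open>B_nonzero\<close> excludes
  it.\<close>

locale sl2_complex_rep = complex_rep n m S \<Psi> for n m S \<Psi> +
  fixes A B C :: "complex mat"
  assumes ABC: "A \<in> complexified n S" "B \<in> complexified n S" "C \<in> complexified n S"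
    and sl2: "sl2_triple n A B C" and B_nonzero: "B \<noteq> 0\<^sub>m n n"
begin

lemma obtain_diagonal:
  assumes "m = 3"
  obtains \<Psi>' a where "sl2_complex_rep n 3 S \<Psi>' A B C" "a = 1 \<or> a = 2" "\<Psi>' A = diag3 a"
proof -
  obtain \<Psi>' a where "complex_rep n 3 S \<Psi>'" "a = 1 \<or> a = 2" "\<Psi>' A = diag3 a"
    using diagonal_rep3[OF assms ABC sl2 B_nonzero] by blast
  then show ?thesis
    using that ABC sl2 B_nonzero by (simp add: sl2_complex_rep_def sl2_complex_rep_axioms_def)
qed

lemma rep_weight:
  assumes "X \<in> complexified n S" "comm A X = w \<cdot>\<^sub>m X"
  shows "comm (\<Psi> A) (\<Psi> X) = w \<cdot>\<^sub>m \<Psi> X"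
  using rep_comm[OF ABC(1) assms(1)] rep_smult[OF assms(1)] assms(2) by simp

lemma not_dim2_odd_weight:
  assumes "X \<in> complexified n S" "X \<noteq> 0\<^sub>m n n" "comm A X = of_int k \<cdot>\<^sub>m X" "odd k"
  shows "m \<noteq> 2"
  using no_odd_weight_in_dim2 rep_sl2_triple[OF ABC sl2] rep_carrier[OF assms(1)]
    rep_nonzero[OF assms(1,2)] rep_weight[OF assms(1,3)] assms(4) by blast

lemma not_dim4_weight3:
  assumes "X \<in> complexified n S" "X \<noteq> 0\<^sub>m n n" "comm A X = 3 \<cdot>\<^sub>m X"
  shows "m \<noteq> 4"
  using no_weight3_in_dim4 rep_sl2_triple[OF ABC sl2] rep_carrier[OF assms(1)]
    rep_nonzero[OF assms(1,2)] rep_weight[OF assms(1,3)] by blast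

text \<open>The two conjugation rules say that the real points of the span of \<open>A\<close>,
  \<open>B\<close>, \<open>C\<close> form su(2).\<close>

lemma not_dim4_compact:
  assumes X: "X \<in> complexified n S" "X \<noteq> 0\<^sub>m n n" "comm A X = of_int k \<cdot>\<^sub>m X" "odd k"
    and cnj: "\<And>M. M \<in> complexified n S \<Longrightarrow> \<Psi> (map_mat cnj M) = map_mat cnj (\<Psi> M)"
    and AB: "map_mat cnj A = (-1) \<cdot>\<^sub>m A" "map_mat cnj B = (-1) \<cdot>\<^sub>m C"
  shows "m \<noteq> 4"
proof
  assume m: "m = 4"
  have "map_mat cnj (\<Psi> A) = (-1) \<cdot>\<^sub>m \<Psi> A" "map_mat cnj (\<Psi> B) = (-1) \<cdot>\<^sub>m \<Psi> C"
    using ABC by (simp_all only: cnj[symmetric] AB rep_smult)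
  then show False
    using no_compact_odd_weight_in_dim4 rep_sl2_triple[OF ABC sl2] rep_carrier[OF X(1)]
      rep_nonzero[OF X(1,2)] rep_weight[OF X(1,3)] X(4) m by blast
qed

text \<open>For \<open>L6_2\<close> and \<open>L7_4\<close>, where \<open>X\<close> and
  \<open>Y\<close> span the natural module inside a Heisenberg algebra.\<close>

lemma not_dim3_heisenberg:
  assumes X: "X \<in> complexified n S" "comm A X = 1 \<cdot>\<^sub>m X"
    and Y: "Y \<in> complexified n S" "comm A Y = (-1) \<cdot>\<^sub>m Y"
    and XY: "comm X (comm X Y) = 0\<^sub>m n n" "comm X Y \<noteq> 0\<^sub>m n n"
  shows "m \<noteq> 3"
proof
  assume "m = 3"
  then obtain \<Psi>' a where \<Psi>': "sl2_complex_rep n 3 S \<Psi>' A B C" "a = 1 \<or> a = 2" "\<Psi>' A = diag3 a"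
    using obtain_diagonal by blast
  interpret D: sl2_complex_rep n 3 S \<Psi>' A B C by fact
  have "comm (\<Psi>' X) (comm (\<Psi>' X) (\<Psi>' Y)) = 0\<^sub>m 3 3"
    using D.rep_zero[OF X(1)] X(1) Y(1) XY(1)
    by (simp add: D.rep_comm[symmetric] comm_closed)
  then have "comm (\<Psi>' X) (\<Psi>' Y) = 0\<^sub>m 3 3"
    using diag3_heisenberg[OF \<Psi>'(2) D.rep_carrier[OF X(1)] D.rep_carrier[OF Y(1)]]
      D.rep_weight[OF X] D.rep_weight[OF Y] \<Psi>'(3) by simp
  then show False
    using D.rep_nonzero[OF comm_closed[OF X(1) Y(1)] XY(2)] D.rep_comm[OF X(1) Y(1)] by simp
qed

text \<open>For \<open>L6_1\<close>, \<open>L6_4\<close>, \<open>L7_1\<close> and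
  \<open>L7_5\<close>: \<open>X\<close> is a highest weight vector of a three-dimensional abelian
  ideal, which also contains \<open>comm C X\<close>.\<close>

lemma not_dim3_adjoint:
  assumes X: "X \<in> complexified n S" "comm A X = 2 \<cdot>\<^sub>m X" "X \<noteq> 0\<^sub>m n n"
    and CX: "comm X (comm C X) = 0\<^sub>m n n"
  shows "m \<noteq> 3"
proof
  assume "m = 3"
  then obtain \<Psi>' a where \<Psi>': "sl2_complex_rep n 3 S \<Psi>' A B C" "a = 1 \<or> a = 2" "\<Psi>' A = diag3 a"
    using obtain_diagonal by blast
  interpret D: sl2_complex_rep n 3 S \<Psi>' A B C by fact
  have "comm (\<Psi>' X) (comm (\<Psi>' C) (\<Psi>' X)) = 0\<^sub>m 3 3"
    using D.rep_zero[OF X(1)] X(1) ABC CX by (simp add: D.rep_comm[symmetric] comm_closed)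
  then have "\<Psi>' X = 0\<^sub>m 3 3"
    using diag3_adjoint[OF \<Psi>'(2) _ D.rep_carrier[OF X(1)]] D.rep_sl2_triple[OF ABC sl2]
      D.rep_weight[OF X(1,2)] \<Psi>'(3) by simp
  then show False using D.rep_nonzero[OF X(1,3)] by simp
qed

text \<open>For \<open>L7_3\<close>, whose radical contains a nonabelian plane that commutes with
  sl2.\<close>

lemma not_dim3_weight_zero:
  assumes G: "G \<in> complexified n S" "comm A G = 0 \<cdot>\<^sub>m G"
    and F: "F \<in> complexified n S" "comm A F = 0 \<cdot>\<^sub>m F"
    and GF: "comm G F \<noteq> 0\<^sub>m n n"
  shows "m \<noteq> 3"
proof
  assume "m = 3"
  then obtain \<Psi>' a where \<Psi>': "sl2_complex_rep n 3 S \<Psi>' A B C" "a = 1 \<or> a = 2" "\<Psi>' A = diag3 a"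
    using obtain_diagonal by blast
  interpret D: sl2_complex_rep n 3 S \<Psi>' A B C by fact
  have "comm (\<Psi>' G) (\<Psi>' F) = 0\<^sub>m 3 3"
    using diag3_weight_zero_commute[OF \<Psi>'(2) D.rep_carrier[OF G(1)] D.rep_carrier[OF F(1)]]
      D.rep_weight[OF G] D.rep_weight[OF F] \<Psi>'(3) by simp
  then show False
    using D.rep_nonzero[OF comm_closed[OF G(1) F(1)] GF] D.rep_comm[OF G(1) F(1)] by simp
qed

text \<open>For \<open>L7_7\<close>, with highest weight vectors of two copies of the natural
  module.\<close>

lemma not_dim3_commuting:
  assumes X: "X \<in> complexified n S" "comm A X = 1 \<cdot>\<^sub>m X"
    and Y: "Y \<in> complexified n S" "comm A Y = 1 \<cdot>\<^sub>m Y"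
    and XY: "comm X Y = 0\<^sub>m n n"
    and indep: "\<And>x y. x \<cdot>\<^sub>m X + y \<cdot>\<^sub>m Y = 0\<^sub>m n n \<Longrightarrow> x = 0 \<and> y = 0"
  shows "m \<noteq> 3"
proof
  assume "m = 3"
  then obtain \<Psi>' a where \<Psi>': "sl2_complex_rep n 3 S \<Psi>' A B C" "a = 1 \<or> a = 2" "\<Psi>' A = diag3 a"
    using obtain_diagonal by blast
  interpret D: sl2_complex_rep n 3 S \<Psi>' A B C by fact
  have "comm (\<Psi>' X) (\<Psi>' Y) = 0\<^sub>m 3 3"
    using D.rep_zero[OF X(1)] X(1) Y(1) XY by (simp add: D.rep_comm[symmetric])
  then obtain x y where xy: "x \<noteq> 0 \<or> y \<noteq> 0" "x \<cdot>\<^sub>m \<Psi>' X + y \<cdot>\<^sub>m \<Psi>' Y = 0\<^sub>m 3 3"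
    using diag3_commuting_dependent[OF \<Psi>'(2) D.rep_carrier[OF X(1)] D.rep_carrier[OF Y(1)]]
      D.rep_weight[OF X] D.rep_weight[OF Y] \<Psi>'(3) by metis
  have "\<Psi>' (x \<cdot>\<^sub>m X + y \<cdot>\<^sub>m Y) = 0\<^sub>m 3 3"
    using xy(2) X(1) Y(1) by (simp add: D.rep_add D.rep_smult smult_closed)
  then have "x \<cdot>\<^sub>m X + y \<cdot>\<^sub>m Y = 0\<^sub>m n n"
    using D.rep_inj X(1) Y(1) by (simp add: add_closed smult_closed)
  then show False using indep xy(1) by blast
qed

end

section \<open>The individual Lie algebras\<close>

text \<open>The families of matrices are polymorphic: over the reals they are the Lie algebra, over the
  complex numbers its complexification.\<close>

definition m5_1 :: "'a::comm_ring_1 \<Rightarrow> 'a \<Rightarrow> 'a \<Rightarrow> 'a \<Rightarrow> 'a \<Rightarrow> 'a mat" where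
  "m5_1 a b c d e = mat_of_rows_list 3
    [[a, b, d],
     [c, - a, e],
     [0, 0, 0]]"

definition S5_1 :: "real mat set" where
  "S5_1 = {m5_1 a b c d e | a b c d e. True}"

lemma m5_1_mem [simp]: "m5_1 a b c d e \<in> S5_1"
  unfolding S5_1_def by blast

lemma S5_1E: "X \<in> S5_1 \<Longrightarrow> (\<And>a b c d e. X = m5_1 a b c d e \<Longrightarrow> thesis) \<Longrightarrow> thesis"
  unfolding S5_1_def by blast

lemma L5_1_eq: "L5_1 = matrix_lie_alg 3 S5_1"
  by (simp add: L5_1_def S5_1_def m5_1_def)

lemma m5_1_add: "m5_1 a b c d e + m5_1 a' b' c' d' e' =
    m5_1 (a + a') (b + b') (c + c') (d + d') (e + e')"
  and m5_1_smult: "r \<cdot>\<^sub>m m5_1 a b c d e = m5_1 (r * a) (r * b) (r * c) (r * d) (r * e)"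
  and m5_1_zero: "m5_1 0 0 0 0 0 = 0\<^sub>m 3 3"
  by (rule square_mat_eqI[where n = 3]; simp add: m5_1_def small_mat_simps algebra_simps)+

text \<open>Such a bracket formula serves twice: over the reals it gives closure under commutators,
  over the complex numbers it gives the triple and the weights.\<close>

lemma m5_1_comm: "comm (m5_1 a b c d e) (m5_1 a' b' c' d' e') =
    m5_1 (b * c' - c * b') (2 * a * b' - 2 * b * a') (2 * c * a' - 2 * a * c') (a * d' - d * a'
    + b * e' - e * b') (c * d' - d * c' - a * e' + e * a')"
  by (rule square_mat_eqI[where n = 3];
      simp add: m5_1_def small_mat_simps comm_index[where n = 3] algebra_simps)

lemma m5_1_complexified [simp]: "m5_1 a b c d e \<in> complexified 3 S5_1"
proof -
  have "map_mat Re (m5_1 a b c d e) = m5_1 (Re a) (Re b) (Re c) (Re d) (Re e)"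
    "map_mat Im (m5_1 a b c d e) = m5_1 (Im a) (Im b) (Im c) (Im d) (Im e)"
    by (rule square_mat_eqI[where n = 3]; simp add: m5_1_def small_mat_simps algebra_simps)+
  moreover have "m5_1 a b c d e \<in> carrier_mat 3 3" by (simp add: m5_1_def small_mat_simps)
  ultimately show ?thesis by (simp add: complexified_def)
qed

lemma S5_1_carrier: "S5_1 \<subseteq> carrier_mat 3 3"
  by (auto elim!: S5_1E simp: m5_1_def small_mat_simps)

lemma faithful_L5_1: "faithful_representation L5_1 3 (\<lambda>X. X)"
  unfolding L5_1_eq
proof (rule faithful_representation_matrix_lie_alg)
  show "0\<^sub>m 3 3 \<in> S5_1" by (simp flip: m5_1_zero)
qed (use S5_1_carrier in \<open>auto elim!: S5_1E simp: m5_1_add m5_1_smult m5_1_comm\<close>)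

text \<open>The Euclidean algebra: so(3) acting on its natural space of dimension 3.\<close>

definition m6_1 :: "'a::comm_ring_1 \<Rightarrow> 'a \<Rightarrow> 'a \<Rightarrow> 'a \<Rightarrow> 'a \<Rightarrow> 'a \<Rightarrow> 'a mat" where
  "m6_1 a b c d e f = mat_of_rows_list 4
    [[0, c, - b, d],
     [- c, 0, a, e],
     [b, - a, 0, f],
     [0, 0, 0, 0]]"

definition S6_1 :: "real mat set" where
  "S6_1 = {m6_1 a b c d e f | a b c d e f. True}"

lemma m6_1_mem [simp]: "m6_1 a b c d e f \<in> S6_1"
  unfolding S6_1_def by blast

lemma S6_1E: "X \<in> S6_1 \<Longrightarrow> (\<And>a b c d e f. X = m6_1 a b c d e f \<Longrightarrow> thesis) \<Longrightarrow> thesis"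
  unfolding S6_1_def by blast

lemma L6_1_eq: "L6_1 = matrix_lie_alg 4 S6_1"
  by (simp add: L6_1_def S6_1_def m6_1_def)

lemma m6_1_add: "m6_1 a b c d e f + m6_1 a' b' c' d' e' f' =
    m6_1 (a + a') (b + b') (c + c') (d + d') (e + e') (f + f')"
  and m6_1_smult: "r \<cdot>\<^sub>m m6_1 a b c d e f = m6_1 (r * a) (r * b) (r * c) (r * d) (r * e) (r * f)"
  and m6_1_zero: "m6_1 0 0 0 0 0 0 = 0\<^sub>m 4 4"
  by (rule square_mat_eqI[where n = 4]; simp add: m6_1_def small_mat_simps algebra_simps)+

lemma m6_1_comm: "comm (m6_1 a b c d e f) (m6_1 a' b' c' d' e' f') =
    m6_1 (c * b' - b * c') (a * c' - c * a') (b * a' - a * b') (c * e' - e * c' - b * f' + f *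
    b') (- c * d' + d * c' + a * f' - f * a') (b * d' - d * b' - a * e' + e * a')"
  by (rule square_mat_eqI[where n = 4];
      simp add: m6_1_def small_mat_simps comm_index[where n = 4] algebra_simps)

lemma m6_1_complexified [simp]: "m6_1 a b c d e f \<in> complexified 4 S6_1"
proof -
  have "map_mat Re (m6_1 a b c d e f) = m6_1 (Re a) (Re b) (Re c) (Re d) (Re e) (Re f)"
    "map_mat Im (m6_1 a b c d e f) = m6_1 (Im a) (Im b) (Im c) (Im d) (Im e) (Im f)"
    by (rule square_mat_eqI[where n = 4]; simp add: m6_1_def small_mat_simps algebra_simps)+
  moreover have "m6_1 a b c d e f \<in> carrier_mat 4 4" by (simp add: m6_1_def small_mat_simps)
  ultimately show ?thesis by (simp add: complexified_def)
qed

lemma S6_1_carrier: "S6_1 \<subseteq> carrier_mat 4 4"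
  by (auto elim!: S6_1E simp: m6_1_def small_mat_simps)

lemma faithful_L6_1: "faithful_representation L6_1 4 (\<lambda>X. X)"
  unfolding L6_1_eq
proof (rule faithful_representation_matrix_lie_alg)
  show "0\<^sub>m 4 4 \<in> S6_1" by (simp flip: m6_1_zero)
qed (use S6_1_carrier in \<open>auto elim!: S6_1E simp: m6_1_add m6_1_smult m6_1_comm\<close>)

text \<open>sl2 acting on the Heisenberg algebra with coordinates \<open>d, e\<close> and centre
  \<open>f\<close>.\<close>

definition m6_2 :: "'a::comm_ring_1 \<Rightarrow> 'a \<Rightarrow> 'a \<Rightarrow> 'a \<Rightarrow> 'a \<Rightarrow> 'a \<Rightarrow> 'a mat" where
  "m6_2 a b c d e f = mat_of_rows_list 4
    [[a, b, 0, d],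
     [c, - a, 0, e],
     [e, - d, 0, f],
     [0, 0, 0, 0]]"

definition S6_2 :: "real mat set" where
  "S6_2 = {m6_2 a b c d e f | a b c d e f. True}"

lemma m6_2_mem [simp]: "m6_2 a b c d e f \<in> S6_2"
  unfolding S6_2_def by blast

lemma S6_2E: "X \<in> S6_2 \<Longrightarrow> (\<And>a b c d e f. X = m6_2 a b c d e f \<Longrightarrow> thesis) \<Longrightarrow> thesis"
  unfolding S6_2_def by blast

lemma L6_2_eq: "L6_2 = matrix_lie_alg 4 S6_2"
  by (simp add: L6_2_def S6_2_def m6_2_def)

lemma m6_2_add: "m6_2 a b c d e f + m6_2 a' b' c' d' e' f' =
    m6_2 (a + a') (b + b') (c + c') (d + d') (e + e') (f + f')"
  and m6_2_smult: "r \<cdot>\<^sub>m m6_2 a b c d e f = m6_2 (r * a) (r * b) (r * c) (r * d) (r * e) (r * f)"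
  and m6_2_zero: "m6_2 0 0 0 0 0 0 = 0\<^sub>m 4 4"
  by (rule square_mat_eqI[where n = 4]; simp add: m6_2_def small_mat_simps algebra_simps)+

lemma m6_2_comm: "comm (m6_2 a b c d e f) (m6_2 a' b' c' d' e' f') =
    m6_2 (b * c' - c * b') (2 * a * b' - 2 * b * a') (2 * c * a' - 2 * a * c') (a * d' - d * a'
    + b * e' - e * b') (c * d' - d * c' - a * e' + e * a') (2 * e * d' - 2 * d * e')"
  by (rule square_mat_eqI[where n = 4];
      simp add: m6_2_def small_mat_simps comm_index[where n = 4] algebra_simps)

lemma m6_2_complexified [simp]: "m6_2 a b c d e f \<in> complexified 4 S6_2"
proof -
  have "map_mat Re (m6_2 a b c d e f) = m6_2 (Re a) (Re b) (Re c) (Re d) (Re e) (Re f)"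
    "map_mat Im (m6_2 a b c d e f) = m6_2 (Im a) (Im b) (Im c) (Im d) (Im e) (Im f)"
    by (rule square_mat_eqI[where n = 4]; simp add: m6_2_def small_mat_simps algebra_simps)+
  moreover have "m6_2 a b c d e f \<in> carrier_mat 4 4" by (simp add: m6_2_def small_mat_simps)
  ultimately show ?thesis by (simp add: complexified_def)
qed

lemma S6_2_carrier: "S6_2 \<subseteq> carrier_mat 4 4"
  by (auto elim!: S6_2E simp: m6_2_def small_mat_simps)

lemma faithful_L6_2: "faithful_representation L6_2 4 (\<lambda>X. X)"
  unfolding L6_2_eq
proof (rule faithful_representation_matrix_lie_alg)
  show "0\<^sub>m 4 4 \<in> S6_2" by (simp flip: m6_2_zero)
qed (use S6_2_carrier in \<open>auto elim!: S6_2E simp: m6_2_add m6_2_smult m6_2_comm\<close>)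

text \<open>sl2 on its natural module, with a scaling \<open>f\<close>. The parameter stays real and
  enters through \<open>of_real\<close>, so that one family covers both fields.\<close>

definition m6_3 :: "real \<Rightarrow> 'a::{real_algebra_1,comm_ring_1} \<Rightarrow> 'a \<Rightarrow> 'a \<Rightarrow> 'a \<Rightarrow> 'a \<Rightarrow> 'a \<Rightarrow> 'a mat" where
  "m6_3 l a b c d e f = mat_of_rows_list 3
    [[a + of_real l * f, b, d],
     [- c, of_real l * f - a, e],
     [0, 0, (1 + of_real l) * f]]"

definition S6_3 :: "real \<Rightarrow> real mat set" where
  "S6_3 l = {m6_3 l a b c d e f | a b c d e f. True}"

lemma m6_3_mem [simp]: "m6_3 l a b c d e f \<in> S6_3 l"
  unfolding S6_3_def by blast

lemma S6_3E: "X \<in> S6_3 l \<Longrightarrow> (\<And>a b c d e f. X = m6_3 l a b c d e f \<Longrightarrow> thesis) \<Longrightarrow> thesis"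
  unfolding S6_3_def by blast

lemma L6_3_eq: "L6_3 l = matrix_lie_alg 3 (S6_3 l)"
  by (simp add: L6_3_def S6_3_def m6_3_def)

lemma m6_3_add: "m6_3 l a b c d e f + m6_3 l a' b' c' d' e' f' =
    m6_3 l (a + a') (b + b') (c + c') (d + d') (e + e') (f + f')"
  and m6_3_smult: "r \<cdot>\<^sub>m m6_3 l a b c d e f = m6_3 l (r * a) (r * b) (r * c) (r * d) (r * e) (r * f)"
  and m6_3_zero: "m6_3 l 0 0 0 0 0 0 = 0\<^sub>m 3 3"
  by (rule square_mat_eqI[where n = 3]; simp add: m6_3_def small_mat_simps algebra_simps)+

text \<open>The six coordinates of the bracket do not contain \<open>l\<close>: this is why the
  isomorphism type is the same for all parameters.\<close>

lemma m6_3_comm: "comm (m6_3 l a b c d e f) (m6_3 l a' b' c' d' e' f') =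
    m6_3 l (- b * c' + c * b') (2 * a * b' - 2 * b * a') (2 * c * a' - 2 * a * c') (a * d' - d *
    a' + b * e' - e * b' + d * f' - f * d') (- c * d' + d * c' - a * e' + e * a' + e * f' - f *
    e') 0"
  by (rule square_mat_eqI[where n = 3];
      simp add: m6_3_def small_mat_simps comm_index[where n = 3] algebra_simps)

lemma m6_3_complexified [simp]: "m6_3 l a b c d e f \<in> complexified 3 (S6_3 l)"
proof -
  have "map_mat Re (m6_3 l a b c d e f) = m6_3 l (Re a) (Re b) (Re c) (Re d) (Re e) (Re f)"
    "map_mat Im (m6_3 l a b c d e f) = m6_3 l (Im a) (Im b) (Im c) (Im d) (Im e) (Im f)"
    by (rule square_mat_eqI[where n = 3]; simp add: m6_3_def small_mat_simps algebra_simps)+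
  moreover have "m6_3 l a b c d e f \<in> carrier_mat 3 3" by (simp add: m6_3_def small_mat_simps)
  ultimately show ?thesis by (simp add: complexified_def)
qed

lemma S6_3_carrier: "S6_3 l \<subseteq> carrier_mat 3 3"
  by (auto elim!: S6_3E simp: m6_3_def small_mat_simps)

lemma faithful_L6_3: "faithful_representation (L6_3 l) 3 (\<lambda>X. X)"
  unfolding L6_3_eq
proof (rule faithful_representation_matrix_lie_alg)
  show "0\<^sub>m 3 3 \<in> S6_3 l" by (simp flip: m6_3_zero[of l])
qed (use S6_3_carrier in \<open>auto elim!: S6_3E simp: m6_3_add m6_3_smult m6_3_comm\<close>)

text \<open>sl2 acting on an abelian copy of its adjoint module.\<close>

definition m6_4 :: "'a::comm_ring_1 \<Rightarrow> 'a \<Rightarrow> 'a \<Rightarrow> 'a \<Rightarrow> 'a \<Rightarrow> 'a \<Rightarrow> 'a mat" where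
  "m6_4 a b c d e f = mat_of_rows_list 4
    [[2 * a, 2 * b, 0, d],
     [c, 0, b, e],
     [0, 2 * c, - 2 * a, f],
     [0, 0, 0, 0]]"

definition S6_4 :: "real mat set" where
  "S6_4 = {m6_4 a b c d e f | a b c d e f. True}"

lemma m6_4_mem [simp]: "m6_4 a b c d e f \<in> S6_4"
  unfolding S6_4_def by blast

lemma S6_4E: "X \<in> S6_4 \<Longrightarrow> (\<And>a b c d e f. X = m6_4 a b c d e f \<Longrightarrow> thesis) \<Longrightarrow> thesis"
  unfolding S6_4_def by blast

lemma L6_4_eq: "L6_4 = matrix_lie_alg 4 S6_4"
  by (simp add: L6_4_def S6_4_def m6_4_def)

lemma m6_4_add: "m6_4 a b c d e f + m6_4 a' b' c' d' e' f' =
    m6_4 (a + a') (b + b') (c + c') (d + d') (e + e') (f + f')"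
  and m6_4_smult: "r \<cdot>\<^sub>m m6_4 a b c d e f = m6_4 (r * a) (r * b) (r * c) (r * d) (r * e) (r * f)"
  and m6_4_zero: "m6_4 0 0 0 0 0 0 = 0\<^sub>m 4 4"
  by (rule square_mat_eqI[where n = 4]; simp add: m6_4_def small_mat_simps algebra_simps)+

lemma m6_4_comm: "comm (m6_4 a b c d e f) (m6_4 a' b' c' d' e' f') =
    m6_4 (b * c' - c * b') (- 2 * b * a' + 2 * a * b') (2 * c * a' - 2 * a * c') (2 * a * d' - 2
    * d * a' + 2 * b * e' - 2 * e * b') (c * d' - d * c' + b * f' - f * b') (2 * c * e' - 2 * e
    * c' - 2 * a * f' + 2 * f * a')"
  by (rule square_mat_eqI[where n = 4];
      simp add: m6_4_def small_mat_simps comm_index[where n = 4] algebra_simps)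

lemma m6_4_complexified [simp]: "m6_4 a b c d e f \<in> complexified 4 S6_4"
proof -
  have "map_mat Re (m6_4 a b c d e f) = m6_4 (Re a) (Re b) (Re c) (Re d) (Re e) (Re f)"
    "map_mat Im (m6_4 a b c d e f) = m6_4 (Im a) (Im b) (Im c) (Im d) (Im e) (Im f)"
    by (rule square_mat_eqI[where n = 4]; simp add: m6_4_def small_mat_simps algebra_simps)+
  moreover have "m6_4 a b c d e f \<in> carrier_mat 4 4" by (simp add: m6_4_def small_mat_simps)
  ultimately show ?thesis by (simp add: complexified_def)
qed

lemma S6_4_carrier: "S6_4 \<subseteq> carrier_mat 4 4"
  by (auto elim!: S6_4E simp: m6_4_def small_mat_simps)

lemma faithful_L6_4: "faithful_representation L6_4 4 (\<lambda>X. X)"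
  unfolding L6_4_eq
proof (rule faithful_representation_matrix_lie_alg)
  show "0\<^sub>m 4 4 \<in> S6_4" by (simp flip: m6_4_zero)
qed (use S6_4_carrier in \<open>auto elim!: S6_4E simp: m6_4_add m6_4_smult m6_4_comm\<close>)

definition m7_1 :: "real \<Rightarrow> real \<Rightarrow> 'a::{real_algebra_1,comm_ring_1} \<Rightarrow> 'a \<Rightarrow> 'a \<Rightarrow> 'a \<Rightarrow> 'a \<Rightarrow> 'a \<Rightarrow> 'a \<Rightarrow> 'a mat" where
  "m7_1 l \<nu> a b c d e f g = mat_of_rows_list 4
    [[of_real l * g, c, - b, d],
     [- c, of_real l * g, a, e],
     [b, - a, of_real l * g, f],
     [0, 0, 0, of_real \<nu> * g]]"

definition S7_1 :: "real \<Rightarrow> real \<Rightarrow> real mat set" where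
  "S7_1 l \<nu> = {m7_1 l \<nu> a b c d e f g | a b c d e f g. True}"

lemma m7_1_mem [simp]: "m7_1 l \<nu> a b c d e f g \<in> S7_1 l \<nu>"
  unfolding S7_1_def by blast

lemma S7_1E: "X \<in> S7_1 l \<nu> \<Longrightarrow> (\<And>a b c d e f g. X = m7_1 l \<nu> a b c d e f g \<Longrightarrow> thesis) \<Longrightarrow> thesis"
  unfolding S7_1_def by blast

lemma L7_1_eq: "L7_1 l \<nu> = matrix_lie_alg 4 (S7_1 l \<nu>)"
  by (simp add: L7_1_def S7_1_def m7_1_def)

lemma m7_1_add: "m7_1 l \<nu> a b c d e f g + m7_1 l \<nu> a' b' c' d' e' f' g' =
    m7_1 l \<nu> (a + a') (b + b') (c + c') (d + d') (e + e') (f + f') (g + g')"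
  and m7_1_smult: "r \<cdot>\<^sub>m m7_1 l \<nu> a b c d e f g = m7_1 l \<nu> (r * a) (r * b) (r * c) (r * d) (r * e) (r * f) (r * g)"
  and m7_1_zero: "m7_1 l \<nu> 0 0 0 0 0 0 0 = 0\<^sub>m 4 4"
  by (rule square_mat_eqI[where n = 4]; simp add: m7_1_def small_mat_simps algebra_simps)+

lemma m7_1_comm: "comm (m7_1 l \<nu> a b c d e f g) (m7_1 l \<nu> a' b' c' d' e' f' g') =
    m7_1 l \<nu> (c * b' - b * c') (a * c' - c * a') (b * a' - a * b') (of_real l * g * d' -
    of_real l * d * g' + c * e' - e * c' - b * f' + f * b' + of_real \<nu> * d * g' - of_real
    \<nu> * g * d') (- c * d' + d * c' + of_real l * g * e' - of_real l * e * g' + a * f' - f *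
    a' + of_real \<nu> * e * g' - of_real \<nu> * g * e') (b * d' - d * b' - a * e' + e * a' +
    of_real l * g * f' - of_real l * f * g' + of_real \<nu> * f * g' - of_real \<nu> * g * f')
    0"
  by (rule square_mat_eqI[where n = 4];
      simp add: m7_1_def small_mat_simps comm_index[where n = 4] algebra_simps)

lemma m7_1_complexified [simp]: "m7_1 l \<nu> a b c d e f g \<in> complexified 4 (S7_1 l \<nu>)"
proof -
  have "map_mat Re (m7_1 l \<nu> a b c d e f g) = m7_1 l \<nu> (Re a) (Re b) (Re c) (Re d) (Re e) (Re f) (Re g)"
    "map_mat Im (m7_1 l \<nu> a b c d e f g) = m7_1 l \<nu> (Im a) (Im b) (Im c) (Im d) (Im e) (Im f) (Im g)"
    by (rule square_mat_eqI[where n = 4]; simp add: m7_1_def small_mat_simps algebra_simps)+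
  moreover have "m7_1 l \<nu> a b c d e f g \<in> carrier_mat 4 4" by (simp add: m7_1_def small_mat_simps)
  ultimately show ?thesis by (simp add: complexified_def)
qed

lemma S7_1_carrier: "S7_1 l \<nu> \<subseteq> carrier_mat 4 4"
  by (auto elim!: S7_1E simp: m7_1_def small_mat_simps)

lemma faithful_L7_1: "faithful_representation (L7_1 l \<nu>) 4 (\<lambda>X. X)"
  unfolding L7_1_eq
proof (rule faithful_representation_matrix_lie_alg)
  show "0\<^sub>m 4 4 \<in> S7_1 l \<nu>" by (simp flip: m7_1_zero[of l \<nu>])
qed (use S7_1_carrier in \<open>auto elim!: S7_1E simp: m7_1_add m7_1_smult m7_1_comm\<close>)

text \<open>The block of size 4 is left multiplication by the quaternion
  \<open>a i + b j + c k\<close> in the basis 1, i, j, k: su(2) acting on the quaternions.\<close>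

definition m7_2 :: "'a::comm_ring_1 \<Rightarrow> 'a \<Rightarrow> 'a \<Rightarrow> 'a \<Rightarrow> 'a \<Rightarrow> 'a \<Rightarrow> 'a \<Rightarrow> 'a mat" where
  "m7_2 a b c d e f g = mat_of_rows_list 5
    [[0, - a, - b, - c, d],
     [a, 0, - c, b, e],
     [b, c, 0, - a, f],
     [c, - b, a, 0, g],
     [0, 0, 0, 0, 0]]"

definition S7_2 :: "real mat set" where
  "S7_2 = {m7_2 a b c d e f g | a b c d e f g. True}"

lemma m7_2_mem [simp]: "m7_2 a b c d e f g \<in> S7_2"
  unfolding S7_2_def by blast

lemma S7_2E: "X \<in> S7_2 \<Longrightarrow> (\<And>a b c d e f g. X = m7_2 a b c d e f g \<Longrightarrow> thesis) \<Longrightarrow> thesis"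
  unfolding S7_2_def by blast

lemma L7_2_eq: "L7_2 = matrix_lie_alg 5 S7_2"
  by (simp add: L7_2_def S7_2_def m7_2_def)

lemma m7_2_add: "m7_2 a b c d e f g + m7_2 a' b' c' d' e' f' g' =
    m7_2 (a + a') (b + b') (c + c') (d + d') (e + e') (f + f') (g + g')"
  and m7_2_smult: "r \<cdot>\<^sub>m m7_2 a b c d e f g = m7_2 (r * a) (r * b) (r * c) (r * d) (r * e) (r * f) (r * g)"
  and m7_2_zero: "m7_2 0 0 0 0 0 0 0 = 0\<^sub>m 5 5"
  by (rule square_mat_eqI[where n = 5]; simp add: m7_2_def small_mat_simps algebra_simps)+

lemma m7_2_comm: "comm (m7_2 a b c d e f g) (m7_2 a' b' c' d' e' f' g') =
    m7_2 (- 2 * c * b' + 2 * b * c') (2 * c * a' - 2 * a * c') (- 2 * b * a' + 2 * a * b') (- a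
    * e' + e * a' - b * f' + f * b' - c * g' + g * c') (a * d' - d * a' - c * f' + f * c' + b *
    g' - g * b') (b * d' - d * b' + c * e' - e * c' - a * g' + g * a') (c * d' - d * c' - b * e'
    + e * b' + a * f' - f * a')"
  by (rule square_mat_eqI[where n = 5];
      simp add: m7_2_def small_mat_simps comm_index[where n = 5] algebra_simps)

lemma m7_2_complexified [simp]: "m7_2 a b c d e f g \<in> complexified 5 S7_2"
proof -
  have "map_mat Re (m7_2 a b c d e f g) = m7_2 (Re a) (Re b) (Re c) (Re d) (Re e) (Re f) (Re g)"
    "map_mat Im (m7_2 a b c d e f g) = m7_2 (Im a) (Im b) (Im c) (Im d) (Im e) (Im f) (Im g)"
    by (rule square_mat_eqI[where n = 5]; simp add: m7_2_def small_mat_simps algebra_simps)+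
  moreover have "m7_2 a b c d e f g \<in> carrier_mat 5 5" by (simp add: m7_2_def small_mat_simps)
  ultimately show ?thesis by (simp add: complexified_def)
qed

lemma S7_2_carrier: "S7_2 \<subseteq> carrier_mat 5 5"
  by (auto elim!: S7_2E simp: m7_2_def small_mat_simps)

lemma faithful_L7_2: "faithful_representation L7_2 5 (\<lambda>X. X)"
  unfolding L7_2_eq
proof (rule faithful_representation_matrix_lie_alg)
  show "0\<^sub>m 5 5 \<in> S7_2" by (simp flip: m7_2_zero)
qed (use S7_2_carrier in \<open>auto elim!: S7_2E simp: m7_2_add m7_2_smult m7_2_comm\<close>)

text \<open>\<open>g\<close> scales the natural module \<open>d, e\<close> by
  \<open>l - \<nu>\<close> and the sl2-invariant line \<open>f\<close> by 1.\<close>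

definition m7_3 :: "real \<Rightarrow> real \<Rightarrow> 'a::{real_algebra_1,comm_ring_1} \<Rightarrow> 'a \<Rightarrow> 'a \<Rightarrow> 'a \<Rightarrow> 'a \<Rightarrow> 'a \<Rightarrow> 'a \<Rightarrow> 'a mat" where
  "m7_3 l \<nu> a b c d e f g = mat_of_rows_list 4
    [[a + of_real l * g, b, 0, d],
     [c, of_real l * g - a, 0, e],
     [0, 0, (of_real \<nu> + 1) * g, f],
     [0, 0, 0, of_real \<nu> * g]]"

definition S7_3 :: "real \<Rightarrow> real \<Rightarrow> real mat set" where
  "S7_3 l \<nu> = {m7_3 l \<nu> a b c d e f g | a b c d e f g. True}"

lemma m7_3_mem [simp]: "m7_3 l \<nu> a b c d e f g \<in> S7_3 l \<nu>"
  unfolding S7_3_def by blast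

lemma S7_3E: "X \<in> S7_3 l \<nu> \<Longrightarrow> (\<And>a b c d e f g. X = m7_3 l \<nu> a b c d e f g \<Longrightarrow> thesis) \<Longrightarrow> thesis"
  unfolding S7_3_def by blast

lemma L7_3_eq: "L7_3 l \<nu> = matrix_lie_alg 4 (S7_3 l \<nu>)"
  by (simp add: L7_3_def S7_3_def m7_3_def)

lemma m7_3_add: "m7_3 l \<nu> a b c d e f g + m7_3 l \<nu> a' b' c' d' e' f' g' =
    m7_3 l \<nu> (a + a') (b + b') (c + c') (d + d') (e + e') (f + f') (g + g')"
  and m7_3_smult: "r \<cdot>\<^sub>m m7_3 l \<nu> a b c d e f g = m7_3 l \<nu> (r * a) (r * b) (r * c) (r * d) (r * e) (r * f) (r * g)"
  and m7_3_zero: "m7_3 l \<nu> 0 0 0 0 0 0 0 = 0\<^sub>m 4 4"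
  by (rule square_mat_eqI[where n = 4]; simp add: m7_3_def small_mat_simps algebra_simps)+

lemma m7_3_comm: "comm (m7_3 l \<nu> a b c d e f g) (m7_3 l \<nu> a' b' c' d' e' f' g') =
    m7_3 l \<nu> (b * c' - c * b') (2 * a * b' - 2 * b * a') (2 * c * a' - 2 * a * c') (a * d' +
    of_real l * g * d' - d * a' - of_real l * d * g' + b * e' - e * b' + of_real \<nu> * d * g'
    - of_real \<nu> * g * d') (c * d' - d * c' + of_real l * g * e' - a * e' - of_real l * e *
    g' + e * a' + of_real \<nu> * e * g' - of_real \<nu> * g * e') (g * f' - f * g') 0"
  by (rule square_mat_eqI[where n = 4];
      simp add: m7_3_def small_mat_simps comm_index[where n = 4] algebra_simps)

lemma m7_3_complexified [simp]: "m7_3 l \<nu> a b c d e f g \<in> complexified 4 (S7_3 l \<nu>)"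
proof -
  have "map_mat Re (m7_3 l \<nu> a b c d e f g) = m7_3 l \<nu> (Re a) (Re b) (Re c) (Re d) (Re e) (Re f) (Re g)"
    "map_mat Im (m7_3 l \<nu> a b c d e f g) = m7_3 l \<nu> (Im a) (Im b) (Im c) (Im d) (Im e) (Im f) (Im g)"
    by (rule square_mat_eqI[where n = 4]; simp add: m7_3_def small_mat_simps algebra_simps)+
  moreover have "m7_3 l \<nu> a b c d e f g \<in> carrier_mat 4 4" by (simp add: m7_3_def small_mat_simps)
  ultimately show ?thesis by (simp add: complexified_def)
qed

lemma S7_3_carrier: "S7_3 l \<nu> \<subseteq> carrier_mat 4 4"
  by (auto elim!: S7_3E simp: m7_3_def small_mat_simps)

lemma faithful_L7_3: "faithful_representation (L7_3 l \<nu>) 4 (\<lambda>X. X)"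
  unfolding L7_3_eq
proof (rule faithful_representation_matrix_lie_alg)
  show "0\<^sub>m 4 4 \<in> S7_3 l \<nu>" by (simp flip: m7_3_zero[of l \<nu>])
qed (use S7_3_carrier in \<open>auto elim!: S7_3E simp: m7_3_add m7_3_smult m7_3_comm\<close>)

text \<open>sl2 on the Heisenberg algebra, extended by the grading \<open>g\<close>, which scales
  \<open>d, e\<close> by \<open>\<nu> - l\<close> and the centre \<open>f\<close> by twice
  that.\<close>

definition m7_4 :: "real \<Rightarrow> real \<Rightarrow> 'a::{real_algebra_1,comm_ring_1} \<Rightarrow> 'a \<Rightarrow> 'a \<Rightarrow> 'a \<Rightarrow> 'a \<Rightarrow> 'a \<Rightarrow> 'a \<Rightarrow> 'a mat" where
  "m7_4 l \<nu> a b c d e f g = mat_of_rows_list 4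
    [[a + of_real l * g, b, 0, d],
     [c, of_real l * g - a, 0, e],
     [- e, d, of_real \<nu> * g, f],
     [0, 0, 0, (2 * of_real l - of_real \<nu>) * g]]"

definition S7_4 :: "real \<Rightarrow> real \<Rightarrow> real mat set" where
  "S7_4 l \<nu> = {m7_4 l \<nu> a b c d e f g | a b c d e f g. True}"

lemma m7_4_mem [simp]: "m7_4 l \<nu> a b c d e f g \<in> S7_4 l \<nu>"
  unfolding S7_4_def by blast

lemma S7_4E: "X \<in> S7_4 l \<nu> \<Longrightarrow> (\<And>a b c d e f g. X = m7_4 l \<nu> a b c d e f g \<Longrightarrow> thesis) \<Longrightarrow> thesis"
  unfolding S7_4_def by blast

lemma L7_4_eq: "L7_4 l \<nu> = matrix_lie_alg 4 (S7_4 l \<nu>)"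
  by (simp add: L7_4_def S7_4_def m7_4_def)

lemma m7_4_add: "m7_4 l \<nu> a b c d e f g + m7_4 l \<nu> a' b' c' d' e' f' g' =
    m7_4 l \<nu> (a + a') (b + b') (c + c') (d + d') (e + e') (f + f') (g + g')"
  and m7_4_smult: "r \<cdot>\<^sub>m m7_4 l \<nu> a b c d e f g = m7_4 l \<nu> (r * a) (r * b) (r * c) (r * d) (r * e) (r * f) (r * g)"
  and m7_4_zero: "m7_4 l \<nu> 0 0 0 0 0 0 0 = 0\<^sub>m 4 4"
  by (rule square_mat_eqI[where n = 4]; simp add: m7_4_def small_mat_simps algebra_simps)+

lemma m7_4_comm: "comm (m7_4 l \<nu> a b c d e f g) (m7_4 l \<nu> a' b' c' d' e' f' g') =
    m7_4 l \<nu> (b * c' - c * b') (2 * a * b' - 2 * b * a') (2 * c * a' - 2 * a * c') (a * d' -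
    of_real l * g * d' - d * a' + of_real l * d * g' + b * e' - e * b' - of_real \<nu> * d * g'
    + of_real \<nu> * g * d') (c * d' - d * c' - of_real l * g * e' - a * e' + of_real l * e *
    g' + e * a' - of_real \<nu> * e * g' + of_real \<nu> * g * e') (- 2 * e * d' + 2 * d * e' +
    2 * of_real \<nu> * g * f' - 2 * of_real \<nu> * f * g' + 2 * of_real l * f * g' - 2 *
    of_real l * g * f') 0"
  by (rule square_mat_eqI[where n = 4];
      simp add: m7_4_def small_mat_simps comm_index[where n = 4] algebra_simps)

lemma m7_4_complexified [simp]: "m7_4 l \<nu> a b c d e f g \<in> complexified 4 (S7_4 l \<nu>)"
proof -
  have "map_mat Re (m7_4 l \<nu> a b c d e f g) = m7_4 l \<nu> (Re a) (Re b) (Re c) (Re d) (Re e) (Re f) (Re g)"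
    "map_mat Im (m7_4 l \<nu> a b c d e f g) = m7_4 l \<nu> (Im a) (Im b) (Im c) (Im d) (Im e) (Im f) (Im g)"
    by (rule square_mat_eqI[where n = 4]; simp add: m7_4_def small_mat_simps algebra_simps)+
  moreover have "m7_4 l \<nu> a b c d e f g \<in> carrier_mat 4 4" by (simp add: m7_4_def small_mat_simps)
  ultimately show ?thesis by (simp add: complexified_def)
qed

lemma S7_4_carrier: "S7_4 l \<nu> \<subseteq> carrier_mat 4 4"
  by (auto elim!: S7_4E simp: m7_4_def small_mat_simps)

lemma faithful_L7_4: "faithful_representation (L7_4 l \<nu>) 4 (\<lambda>X. X)"
  unfolding L7_4_eq
proof (rule faithful_representation_matrix_lie_alg)
  show "0\<^sub>m 4 4 \<in> S7_4 l \<nu>" by (simp flip: m7_4_zero[of l \<nu>])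
qed (use S7_4_carrier in \<open>auto elim!: S7_4E simp: m7_4_add m7_4_smult m7_4_comm\<close>)

definition m7_5 :: "real \<Rightarrow> real \<Rightarrow> 'a::{real_algebra_1,comm_ring_1} \<Rightarrow> 'a \<Rightarrow> 'a \<Rightarrow> 'a \<Rightarrow> 'a \<Rightarrow> 'a \<Rightarrow> 'a \<Rightarrow> 'a mat" where
  "m7_5 l \<nu> a b c d e f g = mat_of_rows_list 4
    [[2 * a + of_real l * g, 2 * c, 0, f],
     [b, of_real l * g, c, e],
     [0, 2 * b, of_real l * g - 2 * a, d],
     [0, 0, 0, of_real \<nu> * g]]"

definition S7_5 :: "real \<Rightarrow> real \<Rightarrow> real mat set" where
  "S7_5 l \<nu> = {m7_5 l \<nu> a b c d e f g | a b c d e f g. True}"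

lemma m7_5_mem [simp]: "m7_5 l \<nu> a b c d e f g \<in> S7_5 l \<nu>"
  unfolding S7_5_def by blast

lemma S7_5E: "X \<in> S7_5 l \<nu> \<Longrightarrow> (\<And>a b c d e f g. X = m7_5 l \<nu> a b c d e f g \<Longrightarrow> thesis) \<Longrightarrow> thesis"
  unfolding S7_5_def by blast

lemma L7_5_eq: "L7_5 l \<nu> = matrix_lie_alg 4 (S7_5 l \<nu>)"
  by (simp add: L7_5_def S7_5_def m7_5_def)

lemma m7_5_add: "m7_5 l \<nu> a b c d e f g + m7_5 l \<nu> a' b' c' d' e' f' g' =
    m7_5 l \<nu> (a + a') (b + b') (c + c') (d + d') (e + e') (f + f') (g + g')"
  and m7_5_smult: "r \<cdot>\<^sub>m m7_5 l \<nu> a b c d e f g = m7_5 l \<nu> (r * a) (r * b) (r * c) (r * d) (r * e) (r * f) (r * g)"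
  and m7_5_zero: "m7_5 l \<nu> 0 0 0 0 0 0 0 = 0\<^sub>m 4 4"
  by (rule square_mat_eqI[where n = 4]; simp add: m7_5_def small_mat_simps algebra_simps)+

lemma m7_5_comm: "comm (m7_5 l \<nu> a b c d e f g) (m7_5 l \<nu> a' b' c' d' e' f' g') =
    m7_5 l \<nu> (c * b' - b * c') (2 * b * a' - 2 * a * b') (- 2 * c * a' + 2 * a * c') (2 * b
    * e' - 2 * e * b' + of_real l * g * d' - 2 * a * d' - of_real l * d * g' + 2 * d * a' +
    of_real \<nu> * d * g' - of_real \<nu> * g * d') (b * f' - f * b' + of_real l * g * e' -
    of_real l * e * g' + c * d' - d * c' + of_real \<nu> * e * g' - of_real \<nu> * g * e') (2 *
    a * f' + of_real l * g * f' - 2 * f * a' - of_real l * f * g' + 2 * c * e' - 2 * e * c' +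
    of_real \<nu> * f * g' - of_real \<nu> * g * f') 0"
  by (rule square_mat_eqI[where n = 4];
      simp add: m7_5_def small_mat_simps comm_index[where n = 4] algebra_simps)

lemma m7_5_complexified [simp]: "m7_5 l \<nu> a b c d e f g \<in> complexified 4 (S7_5 l \<nu>)"
proof -
  have "map_mat Re (m7_5 l \<nu> a b c d e f g) = m7_5 l \<nu> (Re a) (Re b) (Re c) (Re d) (Re e) (Re f) (Re g)"
    "map_mat Im (m7_5 l \<nu> a b c d e f g) = m7_5 l \<nu> (Im a) (Im b) (Im c) (Im d) (Im e) (Im f) (Im g)"
    by (rule square_mat_eqI[where n = 4]; simp add: m7_5_def small_mat_simps algebra_simps)+
  moreover have "m7_5 l \<nu> a b c d e f g \<in> carrier_mat 4 4" by (simp add: m7_5_def small_mat_simps)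
  ultimately show ?thesis by (simp add: complexified_def)
qed

lemma S7_5_carrier: "S7_5 l \<nu> \<subseteq> carrier_mat 4 4"
  by (auto elim!: S7_5E simp: m7_5_def small_mat_simps)

lemma faithful_L7_5: "faithful_representation (L7_5 l \<nu>) 4 (\<lambda>X. X)"
  unfolding L7_5_eq
proof (rule faithful_representation_matrix_lie_alg)
  show "0\<^sub>m 4 4 \<in> S7_5 l \<nu>" by (simp flip: m7_5_zero[of l \<nu>])
qed (use S7_5_carrier in \<open>auto elim!: S7_5E simp: m7_5_add m7_5_smult m7_5_comm\<close>)

text \<open>sl2 acting on its irreducible module of dimension 4, the binary cubics.\<close>

definition m7_6 :: "'a::comm_ring_1 \<Rightarrow> 'a \<Rightarrow> 'a \<Rightarrow> 'a \<Rightarrow> 'a \<Rightarrow> 'a \<Rightarrow> 'a \<Rightarrow> 'a mat" where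
  "m7_6 a b c d e f g = mat_of_rows_list 5
    [[3 * a, 3 * b, 0, 0, d],
     [c, a, 2 * b, 0, e],
     [0, 2 * c, - a, b, f],
     [0, 0, 3 * c, - 3 * a, g],
     [0, 0, 0, 0, 0]]"

definition S7_6 :: "real mat set" where
  "S7_6 = {m7_6 a b c d e f g | a b c d e f g. True}"

lemma m7_6_mem [simp]: "m7_6 a b c d e f g \<in> S7_6"
  unfolding S7_6_def by blast

lemma S7_6E: "X \<in> S7_6 \<Longrightarrow> (\<And>a b c d e f g. X = m7_6 a b c d e f g \<Longrightarrow> thesis) \<Longrightarrow> thesis"
  unfolding S7_6_def by blast

lemma L7_6_eq: "L7_6 = matrix_lie_alg 5 S7_6"
  by (simp add: L7_6_def S7_6_def m7_6_def)

lemma m7_6_add: "m7_6 a b c d e f g + m7_6 a' b' c' d' e' f' g' =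
    m7_6 (a + a') (b + b') (c + c') (d + d') (e + e') (f + f') (g + g')"
  and m7_6_smult: "r \<cdot>\<^sub>m m7_6 a b c d e f g = m7_6 (r * a) (r * b) (r * c) (r * d) (r * e) (r * f) (r * g)"
  and m7_6_zero: "m7_6 0 0 0 0 0 0 0 = 0\<^sub>m 5 5"
  by (rule square_mat_eqI[where n = 5]; simp add: m7_6_def small_mat_simps algebra_simps)+

lemma m7_6_comm: "comm (m7_6 a b c d e f g) (m7_6 a' b' c' d' e' f' g') =
    m7_6 (- c * b' + b * c') (2 * a * b' - 2 * b * a') (2 * c * a' - 2 * a * c') (3 * a * d' - 3
    * d * a' + 3 * b * e' - 3 * e * b') (c * d' - d * c' + a * e' - e * a' + 2 * b * f' - 2 * f
    * b') (2 * c * e' - 2 * e * c' - a * f' + f * a' + b * g' - g * b') (3 * c * f' - 3 * f * c'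
    - 3 * a * g' + 3 * g * a')"
  by (rule square_mat_eqI[where n = 5];
      simp add: m7_6_def small_mat_simps comm_index[where n = 5] algebra_simps)

lemma m7_6_complexified [simp]: "m7_6 a b c d e f g \<in> complexified 5 S7_6"
proof -
  have "map_mat Re (m7_6 a b c d e f g) = m7_6 (Re a) (Re b) (Re c) (Re d) (Re e) (Re f) (Re g)"
    "map_mat Im (m7_6 a b c d e f g) = m7_6 (Im a) (Im b) (Im c) (Im d) (Im e) (Im f) (Im g)"
    by (rule square_mat_eqI[where n = 5]; simp add: m7_6_def small_mat_simps algebra_simps)+
  moreover have "m7_6 a b c d e f g \<in> carrier_mat 5 5" by (simp add: m7_6_def small_mat_simps)
  ultimately show ?thesis by (simp add: complexified_def)
qed

lemma S7_6_carrier: "S7_6 \<subseteq> carrier_mat 5 5"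
  by (auto elim!: S7_6E simp: m7_6_def small_mat_simps)

lemma faithful_L7_6: "faithful_representation L7_6 5 (\<lambda>X. X)"
  unfolding L7_6_eq
proof (rule faithful_representation_matrix_lie_alg)
  show "0\<^sub>m 5 5 \<in> S7_6" by (simp flip: m7_6_zero)
qed (use S7_6_carrier in \<open>auto elim!: S7_6E simp: m7_6_add m7_6_smult m7_6_comm\<close>)

definition m7_7 :: "'a::comm_ring_1 \<Rightarrow> 'a \<Rightarrow> 'a \<Rightarrow> 'a \<Rightarrow> 'a \<Rightarrow> 'a \<Rightarrow> 'a \<Rightarrow> 'a mat" where
  "m7_7 a b c d e f g = mat_of_rows_list 4
    [[a, b, d, f],
     [c, - a, e, g],
     [0, 0, 0, 0],
     [0, 0, 0, 0]]"

definition S7_7 :: "real mat set" where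
  "S7_7 = {m7_7 a b c d e f g | a b c d e f g. True}"

lemma m7_7_mem [simp]: "m7_7 a b c d e f g \<in> S7_7"
  unfolding S7_7_def by blast

lemma S7_7E: "X \<in> S7_7 \<Longrightarrow> (\<And>a b c d e f g. X = m7_7 a b c d e f g \<Longrightarrow> thesis) \<Longrightarrow> thesis"
  unfolding S7_7_def by blast

lemma L7_7_eq: "L7_7 = matrix_lie_alg 4 S7_7"
  by (simp add: L7_7_def S7_7_def m7_7_def)

lemma m7_7_add: "m7_7 a b c d e f g + m7_7 a' b' c' d' e' f' g' =
    m7_7 (a + a') (b + b') (c + c') (d + d') (e + e') (f + f') (g + g')"
  and m7_7_smult: "r \<cdot>\<^sub>m m7_7 a b c d e f g = m7_7 (r * a) (r * b) (r * c) (r * d) (r * e) (r * f) (r * g)"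
  and m7_7_zero: "m7_7 0 0 0 0 0 0 0 = 0\<^sub>m 4 4"
  by (rule square_mat_eqI[where n = 4]; simp add: m7_7_def small_mat_simps algebra_simps)+

lemma m7_7_comm: "comm (m7_7 a b c d e f g) (m7_7 a' b' c' d' e' f' g') =
    m7_7 (b * c' - c * b') (2 * a * b' - 2 * b * a') (2 * c * a' - 2 * a * c') (a * d' - d * a'
    + b * e' - e * b') (c * d' - d * c' - a * e' + e * a') (a * f' - f * a' + b * g' - g * b')
    (c * f' - f * c' - a * g' + g * a')"
  by (rule square_mat_eqI[where n = 4];
      simp add: m7_7_def small_mat_simps comm_index[where n = 4] algebra_simps)

lemma m7_7_complexified [simp]: "m7_7 a b c d e f g \<in> complexified 4 S7_7"
proof -
  have "map_mat Re (m7_7 a b c d e f g) = m7_7 (Re a) (Re b) (Re c) (Re d) (Re e) (Re f) (Re g)"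
    "map_mat Im (m7_7 a b c d e f g) = m7_7 (Im a) (Im b) (Im c) (Im d) (Im e) (Im f) (Im g)"
    by (rule square_mat_eqI[where n = 4]; simp add: m7_7_def small_mat_simps algebra_simps)+
  moreover have "m7_7 a b c d e f g \<in> carrier_mat 4 4" by (simp add: m7_7_def small_mat_simps)
  ultimately show ?thesis by (simp add: complexified_def)
qed

lemma S7_7_carrier: "S7_7 \<subseteq> carrier_mat 4 4"
  by (auto elim!: S7_7E simp: m7_7_def small_mat_simps)

lemma faithful_L7_7: "faithful_representation L7_7 4 (\<lambda>X. X)"
  unfolding L7_7_eq
proof (rule faithful_representation_matrix_lie_alg)
  show "0\<^sub>m 4 4 \<in> S7_7" by (simp flip: m7_7_zero)
qed (use S7_7_carrier in \<open>auto elim!: S7_7E simp: m7_7_add m7_7_smult m7_7_comm\<close>)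

section \<open>Minimal dimensions\<close>

lemma rows_nonzero:
  fixes rs :: "'a::comm_ring_1 list list"
  assumes "i < length rs" "j < k" "rs ! i ! j \<noteq> 0"
  shows "mat_of_rows_list k rs \<noteq> 0\<^sub>m n k"
proof
  assume "mat_of_rows_list k rs = 0\<^sub>m n k"
  then have "mat_of_rows_list k rs $$ (i, j) = 0\<^sub>m n k $$ (i, j)"
    and "dim_row (mat_of_rows_list k rs) = dim_row (0\<^sub>m n k :: 'a mat)"
    by simp_all
  then show False using assms by (simp add: small_mat_simps)
qed

text \<open>Only size \<open>n - 1\<close> has to be excluded, since any smaller representation can
  be padded up to it. The conjugation rule is what the complexified representation retains of its
  real origin.\<close>

lemma mu_matrix_lie_alg_eqI:
  assumes faithful: "faithful_representation (matrix_lie_alg n S) n \<phi>" and S: "S \<subseteq> carrier_mat n n"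
    and no_rep: "\<And>k \<Psi>. \<lbrakk>n = Suc k; complex_rep n k S \<Psi>;
      \<And>M. M \<in> complexified n S \<Longrightarrow> \<Psi> (map_mat cnj M) = map_mat cnj (\<Psi> M)\<rbrakk> \<Longrightarrow> False"
  shows "mu (matrix_lie_alg n S) = n"
  unfolding mu_def
proof (rule Least_equality)
  show "\<exists>\<phi>. faithful_representation (matrix_lie_alg n S) n \<phi>" using faithful by blast
next
  fix N assume "\<exists>\<phi>. faithful_representation (matrix_lie_alg n S) N \<phi>"
  then obtain \<phi> where rep: "faithful_representation (matrix_lie_alg n S) N \<phi>" ..
  show "n \<le> N"
  proof (rule ccontr)
    assume "\<not> n \<le> N"
    then obtain k where k: "n = Suc k" "N \<le> k" by (cases n) auto
    show False using complex_rep_exists[OF rep S k(2)] no_rep[OF k(1)] by blast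
  qed
qed

lemma mu_L5_1: "mu L5_1 = 3"
  unfolding L5_1_eq
proof (rule mu_matrix_lie_alg_eqI)
  show "faithful_representation (matrix_lie_alg 3 S5_1) 3 (\<lambda>X. X)"
    using faithful_L5_1 by (simp add: L5_1_eq)
  show "S5_1 \<subseteq> carrier_mat 3 3" by (rule S5_1_carrier)
  fix k \<Psi>
  assume k: "3 = Suc k" and rep: "complex_rep 3 k S5_1 \<Psi>"
    and "\<And>M. M \<in> complexified 3 S5_1 \<Longrightarrow> \<Psi> (map_mat cnj M) = map_mat cnj (\<Psi> M)"
  let ?A = "m5_1 1 0 0 0 0 :: complex mat"
  let ?B = "m5_1 0 1 0 0 0 :: complex mat"
  let ?C = "m5_1 0 0 1 0 0 :: complex mat"
  have "?B \<noteq> 0\<^sub>m 3 3"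
    unfolding m5_1_def by (rule rows_nonzero[of "0" _ "Suc 0"]) simp_all
  then interpret sl2_complex_rep 3 k S5_1 \<Psi> ?A ?B ?C
    by (intro sl2_complex_rep.intro rep sl2_complex_rep_axioms.intro)
      (simp_all add: sl2_triple_def complexified_carrier[OF m5_1_complexified] m5_1_comm m5_1_smult algebra_simps)
  let ?X = "m5_1 0 0 0 1 0 :: complex mat"
  have "?X \<noteq> 0\<^sub>m 3 3"
    unfolding m5_1_def by (rule rows_nonzero[of "0" _ "2"]) simp_all
  then have "k \<noteq> 2"
    by (intro not_dim2_odd_weight[of ?X 1]) (simp_all add: m5_1_comm m5_1_smult algebra_simps)
  then show False using k by simp
qed

lemma mu_L6_1: "mu L6_1 = 4"
  unfolding L6_1_eq
proof (rule mu_matrix_lie_alg_eqI)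
  show "faithful_representation (matrix_lie_alg 4 S6_1) 4 (\<lambda>X. X)"
    using faithful_L6_1 by (simp add: L6_1_eq)
  show "S6_1 \<subseteq> carrier_mat 4 4" by (rule S6_1_carrier)
  fix k \<Psi>
  assume k: "4 = Suc k" and rep: "complex_rep 4 k S6_1 \<Psi>"
    and "\<And>M. M \<in> complexified 4 S6_1 \<Longrightarrow> \<Psi> (map_mat cnj M) = map_mat cnj (\<Psi> M)"
  \<comment> \<open>\<open>A = 2\<i>J\<^sub>3\<close>, \<open>B = J\<^sub>1 + \<i>J\<^sub>2\<close>, \<open>C = - J\<^sub>1 + \<i>J\<^sub>2\<close> for real \<open>J\<^sub>1, J\<^sub>2, J\<^sub>3\<close> with
    \<open>[J\<^sub>1, J\<^sub>2] = J\<^sub>3\<close> and its cyclic permutations; likewise for \<open>L7_1\<close> and \<open>L7_2\<close>.\<close>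
  let ?A = "m6_1 0 0 (-2 * \<i>) 0 0 0 :: complex mat"
  let ?B = "m6_1 (-1) (- \<i>) 0 0 0 0 :: complex mat"
  let ?C = "m6_1 1 (- \<i>) 0 0 0 0 :: complex mat"
  have "?B \<noteq> 0\<^sub>m 4 4"
    unfolding m6_1_def by (rule rows_nonzero[of "Suc 0" _ "2"]) simp_all
  then interpret sl2_complex_rep 4 k S6_1 \<Psi> ?A ?B ?C
    by (intro sl2_complex_rep.intro rep sl2_complex_rep_axioms.intro)
      (simp_all add: sl2_triple_def complexified_carrier[OF m6_1_complexified] m6_1_comm m6_1_smult algebra_simps)
  \<comment> \<open>The isotropic vector (1, \<open>\<i>\<close>, 0) spans the highest weight line
    of so(3) on complex 3-space.\<close>
  let ?X = "m6_1 0 0 0 1 \<i> 0 :: complex mat"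
  have "?X \<noteq> 0\<^sub>m 4 4"
    unfolding m6_1_def by (rule rows_nonzero[of "0" _ "3"]) simp_all
  then have "k \<noteq> 3"
    by (intro not_dim3_adjoint[of ?X])
      (simp_all add: m6_1_comm m6_1_smult m6_1_zero algebra_simps)
  then show False using k by simp
qed

lemma mu_L6_2: "mu L6_2 = 4"
  unfolding L6_2_eq
proof (rule mu_matrix_lie_alg_eqI)
  show "faithful_representation (matrix_lie_alg 4 S6_2) 4 (\<lambda>X. X)"
    using faithful_L6_2 by (simp add: L6_2_eq)
  show "S6_2 \<subseteq> carrier_mat 4 4" by (rule S6_2_carrier)
  fix k \<Psi>
  assume k: "4 = Suc k" and rep: "complex_rep 4 k S6_2 \<Psi>"
    and "\<And>M. M \<in> complexified 4 S6_2 \<Longrightarrow> \<Psi> (map_mat cnj M) = map_mat cnj (\<Psi> M)"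
  let ?A = "m6_2 1 0 0 0 0 0 :: complex mat"
  let ?B = "m6_2 0 1 0 0 0 0 :: complex mat"
  let ?C = "m6_2 0 0 1 0 0 0 :: complex mat"
  have "?B \<noteq> 0\<^sub>m 4 4"
    unfolding m6_2_def by (rule rows_nonzero[of "0" _ "Suc 0"]) simp_all
  then interpret sl2_complex_rep 4 k S6_2 \<Psi> ?A ?B ?C
    by (intro sl2_complex_rep.intro rep sl2_complex_rep_axioms.intro)
      (simp_all add: sl2_triple_def complexified_carrier[OF m6_2_complexified] m6_2_comm m6_2_smult algebra_simps)
  let ?X = "m6_2 0 0 0 1 0 0 :: complex mat"
  let ?Y = "m6_2 0 0 0 0 1 0 :: complex mat"
  have "comm ?X ?Y \<noteq> 0\<^sub>m 4 4"
    unfolding m6_2_comm unfolding m6_2_def by (rule rows_nonzero[of "2" _ "3"]) simp_all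
  then have "k \<noteq> 3"
    by (intro not_dim3_heisenberg[of ?X ?Y])
      (simp_all add: m6_2_comm m6_2_smult m6_2_zero algebra_simps)
  then show False using k by simp
qed

lemma mu_L6_3: "mu (L6_3 l) = 3"
  unfolding L6_3_eq
proof (rule mu_matrix_lie_alg_eqI)
  show "faithful_representation (matrix_lie_alg 3 (S6_3 l)) 3 (\<lambda>X. X)"
    using faithful_L6_3[of l] by (simp add: L6_3_eq)
  show "S6_3 l \<subseteq> carrier_mat 3 3" by (rule S6_3_carrier)
  fix k \<Psi>
  assume k: "3 = Suc k" and rep: "complex_rep 3 k (S6_3 l) \<Psi>"
    and "\<And>M. M \<in> complexified 3 (S6_3 l) \<Longrightarrow> \<Psi> (map_mat cnj M) = map_mat cnj (\<Psi> M)"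
  let ?A = "m6_3 l 1 0 0 0 0 0 :: complex mat"
  let ?B = "m6_3 l 0 1 0 0 0 0 :: complex mat"
  \<comment> \<open>The family carries \<open>- c\<close> below the diagonal, so the usual lowering
    matrix has \<open>c = -1\<close>.\<close>
  let ?C = "m6_3 l 0 0 (-1) 0 0 0 :: complex mat"
  have "?B \<noteq> 0\<^sub>m 3 3"
    unfolding m6_3_def by (rule rows_nonzero[of "0" _ "Suc 0"]) simp_all
  then interpret sl2_complex_rep 3 k "S6_3 l" \<Psi> ?A ?B ?C
    by (intro sl2_complex_rep.intro rep sl2_complex_rep_axioms.intro)
      (simp_all add: sl2_triple_def complexified_carrier[OF m6_3_complexified] m6_3_comm m6_3_smult algebra_simps)
  let ?X = "m6_3 l 0 0 0 1 0 0 :: complex mat"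
  have "?X \<noteq> 0\<^sub>m 3 3"
    unfolding m6_3_def by (rule rows_nonzero[of "0" _ "2"]) simp_all
  then have "k \<noteq> 2"
    by (intro not_dim2_odd_weight[of ?X 1]) (simp_all add: m6_3_comm m6_3_smult algebra_simps)
  then show False using k by simp
qed

lemma mu_L6_4: "mu L6_4 = 4"
  unfolding L6_4_eq
proof (rule mu_matrix_lie_alg_eqI)
  show "faithful_representation (matrix_lie_alg 4 S6_4) 4 (\<lambda>X. X)"
    using faithful_L6_4 by (simp add: L6_4_eq)
  show "S6_4 \<subseteq> carrier_mat 4 4" by (rule S6_4_carrier)
  fix k \<Psi>
  assume k: "4 = Suc k" and rep: "complex_rep 4 k S6_4 \<Psi>"
    and "\<And>M. M \<in> complexified 4 S6_4 \<Longrightarrow> \<Psi> (map_mat cnj M) = map_mat cnj (\<Psi> M)"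
  let ?A = "m6_4 1 0 0 0 0 0 :: complex mat"
  let ?B = "m6_4 0 1 0 0 0 0 :: complex mat"
  let ?C = "m6_4 0 0 1 0 0 0 :: complex mat"
  have "?B \<noteq> 0\<^sub>m 4 4"
    unfolding m6_4_def by (rule rows_nonzero[of "0" _ "Suc 0"]) simp_all
  then interpret sl2_complex_rep 4 k S6_4 \<Psi> ?A ?B ?C
    by (intro sl2_complex_rep.intro rep sl2_complex_rep_axioms.intro)
      (simp_all add: sl2_triple_def complexified_carrier[OF m6_4_complexified] m6_4_comm m6_4_smult algebra_simps)
  let ?X = "m6_4 0 0 0 1 0 0 :: complex mat"
  have "?X \<noteq> 0\<^sub>m 4 4"
    unfolding m6_4_def by (rule rows_nonzero[of "0" _ "3"]) simp_all
  then have "k \<noteq> 3"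
    by (intro not_dim3_adjoint[of ?X])
      (simp_all add: m6_4_comm m6_4_smult m6_4_zero algebra_simps)
  then show False using k by simp
qed

lemma mu_L7_1: "mu (L7_1 l \<nu>) = 4"
  unfolding L7_1_eq
proof (rule mu_matrix_lie_alg_eqI)
  show "faithful_representation (matrix_lie_alg 4 (S7_1 l \<nu>)) 4 (\<lambda>X. X)"
    using faithful_L7_1[of l \<nu>] by (simp add: L7_1_eq)
  show "S7_1 l \<nu> \<subseteq> carrier_mat 4 4" by (rule S7_1_carrier)
  fix k \<Psi>
  assume k: "4 = Suc k" and rep: "complex_rep 4 k (S7_1 l \<nu>) \<Psi>"
    and "\<And>M. M \<in> complexified 4 (S7_1 l \<nu>) \<Longrightarrow> \<Psi> (map_mat cnj M) = map_mat cnj (\<Psi> M)"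
  let ?A = "m7_1 l \<nu> 0 0 (-2 * \<i>) 0 0 0 0 :: complex mat"
  let ?B = "m7_1 l \<nu> (-1) (- \<i>) 0 0 0 0 0 :: complex mat"
  let ?C = "m7_1 l \<nu> 1 (- \<i>) 0 0 0 0 0 :: complex mat"
  have "?B \<noteq> 0\<^sub>m 4 4"
    unfolding m7_1_def by (rule rows_nonzero[of "Suc 0" _ "2"]) simp_all
  then interpret sl2_complex_rep 4 k "S7_1 l \<nu>" \<Psi> ?A ?B ?C
    by (intro sl2_complex_rep.intro rep sl2_complex_rep_axioms.intro)
      (simp_all add: sl2_triple_def complexified_carrier[OF m7_1_complexified] m7_1_comm m7_1_smult algebra_simps)
  let ?X = "m7_1 l \<nu> 0 0 0 1 \<i> 0 0 :: complex mat"
  have "?X \<noteq> 0\<^sub>m 4 4"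
    unfolding m7_1_def by (rule rows_nonzero[of "0" _ "3"]) simp_all
  then have "k \<noteq> 3"
    by (intro not_dim3_adjoint[of ?X])
      (simp_all add: m7_1_comm m7_1_smult m7_1_zero algebra_simps)
  then show False using k by simp
qed

lemma mu_L7_2: "mu L7_2 = 5"
  unfolding L7_2_eq
proof (rule mu_matrix_lie_alg_eqI)
  show "faithful_representation (matrix_lie_alg 5 S7_2) 5 (\<lambda>X. X)"
    using faithful_L7_2 by (simp add: L7_2_eq)
  show "S7_2 \<subseteq> carrier_mat 5 5" by (rule S7_2_carrier)
  fix k \<Psi>
  assume k: "5 = Suc k" and rep: "complex_rep 5 k S7_2 \<Psi>"
    and cnj: "\<And>M. M \<in> complexified 5 S7_2 \<Longrightarrow> \<Psi> (map_mat cnj M) = map_mat cnj (\<Psi> M)"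
  let ?A = "m7_2 0 0 \<i> 0 0 0 0 :: complex mat"
  \<comment> \<open>The halves occur because the quaternion units satisfy [i, j] = 2k: the
    generators with the normalized so(3) relations are half the units.\<close>
  let ?B = "m7_2 (1 / 2) (\<i> / 2) 0 0 0 0 0 :: complex mat"
  let ?C = "m7_2 (- 1 / 2) (\<i> / 2) 0 0 0 0 0 :: complex mat"
  have "?B \<noteq> 0\<^sub>m 5 5"
    unfolding m7_2_def by (rule rows_nonzero[of "Suc 0" _ "0"]) simp_all
  then interpret sl2_complex_rep 5 k S7_2 \<Psi> ?A ?B ?C
    by (intro sl2_complex_rep.intro rep sl2_complex_rep_axioms.intro)
      (simp_all add: sl2_triple_def complexified_carrier[OF m7_2_complexified] m7_2_comm m7_2_smult algebra_simps)
  \<comment> \<open>The vector (1, 0, 0, \<open>\<i>\<close>) is fixed by \<open>\<i>\<close> times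
    left multiplication by k, hence has weight 1.\<close>
  let ?X = "m7_2 0 0 0 1 0 0 \<i> :: complex mat"
  have "?X \<noteq> 0\<^sub>m 5 5"
    unfolding m7_2_def by (rule rows_nonzero[of "0" _ "4"]) simp_all
  moreover have "map_mat cnj ?A = (-1) \<cdot>\<^sub>m ?A" "map_mat cnj ?B = (-1) \<cdot>\<^sub>m ?C"
    by (rule square_mat_eqI[where n = 5]; simp add: m7_2_def small_mat_simps)+
  ultimately have "k \<noteq> 4"
    by (intro not_dim4_compact[of ?X 1] cnj) (simp_all add: m7_2_comm m7_2_smult algebra_simps)
  then show False using k by simp
qed

lemma mu_L7_3: "mu (L7_3 l \<nu>) = 4"
  unfolding L7_3_eq
proof (rule mu_matrix_lie_alg_eqI)
  show "faithful_representation (matrix_lie_alg 4 (S7_3 l \<nu>)) 4 (\<lambda>X. X)"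
    using faithful_L7_3[of l \<nu>] by (simp add: L7_3_eq)
  show "S7_3 l \<nu> \<subseteq> carrier_mat 4 4" by (rule S7_3_carrier)
  fix k \<Psi>
  assume k: "4 = Suc k" and rep: "complex_rep 4 k (S7_3 l \<nu>) \<Psi>"
    and "\<And>M. M \<in> complexified 4 (S7_3 l \<nu>) \<Longrightarrow> \<Psi> (map_mat cnj M) = map_mat cnj (\<Psi> M)"
  let ?A = "m7_3 l \<nu> 1 0 0 0 0 0 0 :: complex mat"
  let ?B = "m7_3 l \<nu> 0 1 0 0 0 0 0 :: complex mat"
  let ?C = "m7_3 l \<nu> 0 0 1 0 0 0 0 :: complex mat"
  have "?B \<noteq> 0\<^sub>m 4 4"
    unfolding m7_3_def by (rule rows_nonzero[of "0" _ "Suc 0"]) simp_all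
  then interpret sl2_complex_rep 4 k "S7_3 l \<nu>" \<Psi> ?A ?B ?C
    by (intro sl2_complex_rep.intro rep sl2_complex_rep_axioms.intro)
      (simp_all add: sl2_triple_def complexified_carrier[OF m7_3_complexified] m7_3_comm m7_3_smult algebra_simps)
  \<comment> \<open>The scaling direction and the line it scales: both commute with sl2, and their
    bracket is \<open>?Y\<close>.\<close>
  let ?X = "m7_3 l \<nu> 0 0 0 0 0 0 1 :: complex mat"
  let ?Y = "m7_3 l \<nu> 0 0 0 0 0 1 0 :: complex mat"
  have "comm ?X ?Y \<noteq> 0\<^sub>m 4 4"
    unfolding m7_3_comm unfolding m7_3_def by (rule rows_nonzero[of "2" _ "3"]) simp_all
  then have "k \<noteq> 3"
    by (intro not_dim3_weight_zero[of ?X ?Y])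
      (simp_all add: m7_3_comm m7_3_smult m7_3_zero algebra_simps)
  then show False using k by simp
qed

lemma mu_L7_4: "mu (L7_4 l \<nu>) = 4"
  unfolding L7_4_eq
proof (rule mu_matrix_lie_alg_eqI)
  show "faithful_representation (matrix_lie_alg 4 (S7_4 l \<nu>)) 4 (\<lambda>X. X)"
    using faithful_L7_4[of l \<nu>] by (simp add: L7_4_eq)
  show "S7_4 l \<nu> \<subseteq> carrier_mat 4 4" by (rule S7_4_carrier)
  fix k \<Psi>
  assume k: "4 = Suc k" and rep: "complex_rep 4 k (S7_4 l \<nu>) \<Psi>"
    and "\<And>M. M \<in> complexified 4 (S7_4 l \<nu>) \<Longrightarrow> \<Psi> (map_mat cnj M) = map_mat cnj (\<Psi> M)"
  let ?A = "m7_4 l \<nu> 1 0 0 0 0 0 0 :: complex mat"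
  let ?B = "m7_4 l \<nu> 0 1 0 0 0 0 0 :: complex mat"
  let ?C = "m7_4 l \<nu> 0 0 1 0 0 0 0 :: complex mat"
  have "?B \<noteq> 0\<^sub>m 4 4"
    unfolding m7_4_def by (rule rows_nonzero[of "0" _ "Suc 0"]) simp_all
  then interpret sl2_complex_rep 4 k "S7_4 l \<nu>" \<Psi> ?A ?B ?C
    by (intro sl2_complex_rep.intro rep sl2_complex_rep_axioms.intro)
      (simp_all add: sl2_triple_def complexified_carrier[OF m7_4_complexified] m7_4_comm m7_4_smult algebra_simps)
  let ?X = "m7_4 l \<nu> 0 0 0 1 0 0 0 :: complex mat"
  let ?Y = "m7_4 l \<nu> 0 0 0 0 1 0 0 :: complex mat"
  have "comm ?X ?Y \<noteq> 0\<^sub>m 4 4"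
    unfolding m7_4_comm unfolding m7_4_def by (rule rows_nonzero[of "2" _ "3"]) simp_all
  then have "k \<noteq> 3"
    by (intro not_dim3_heisenberg[of ?X ?Y])
      (simp_all add: m7_4_comm m7_4_smult m7_4_zero algebra_simps)
  then show False using k by simp
qed

lemma mu_L7_5: "mu (L7_5 l \<nu>) = 4"
  unfolding L7_5_eq
proof (rule mu_matrix_lie_alg_eqI)
  show "faithful_representation (matrix_lie_alg 4 (S7_5 l \<nu>)) 4 (\<lambda>X. X)"
    using faithful_L7_5[of l \<nu>] by (simp add: L7_5_eq)
  show "S7_5 l \<nu> \<subseteq> carrier_mat 4 4" by (rule S7_5_carrier)
  fix k \<Psi>
  assume k: "4 = Suc k" and rep: "complex_rep 4 k (S7_5 l \<nu>) \<Psi>"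
    and "\<And>M. M \<in> complexified 4 (S7_5 l \<nu>) \<Longrightarrow> \<Psi> (map_mat cnj M) = map_mat cnj (\<Psi> M)"
  let ?A = "m7_5 l \<nu> 1 0 0 0 0 0 0 :: complex mat"
  \<comment> \<open>In this family \<open>c\<close> stands above the diagonal and \<open>b\<close>
    below, so the two letters exchange roles; accordingly \<open>f\<close> is the highest weight
    coordinate.\<close>
  let ?B = "m7_5 l \<nu> 0 0 1 0 0 0 0 :: complex mat"
  let ?C = "m7_5 l \<nu> 0 1 0 0 0 0 0 :: complex mat"
  have "?B \<noteq> 0\<^sub>m 4 4"
    unfolding m7_5_def by (rule rows_nonzero[of "0" _ "Suc 0"]) simp_all
  then interpret sl2_complex_rep 4 k "S7_5 l \<nu>" \<Psi> ?A ?B ?C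
    by (intro sl2_complex_rep.intro rep sl2_complex_rep_axioms.intro)
      (simp_all add: sl2_triple_def complexified_carrier[OF m7_5_complexified] m7_5_comm m7_5_smult algebra_simps)
  let ?X = "m7_5 l \<nu> 0 0 0 0 0 1 0 :: complex mat"
  have "?X \<noteq> 0\<^sub>m 4 4"
    unfolding m7_5_def by (rule rows_nonzero[of "0" _ "3"]) simp_all
  then have "k \<noteq> 3"
    by (intro not_dim3_adjoint[of ?X])
      (simp_all add: m7_5_comm m7_5_smult m7_5_zero algebra_simps)
  then show False using k by simp
qed

lemma mu_L7_6: "mu L7_6 = 5"
  unfolding L7_6_eq
proof (rule mu_matrix_lie_alg_eqI)
  show "faithful_representation (matrix_lie_alg 5 S7_6) 5 (\<lambda>X. X)"
    using faithful_L7_6 by (simp add: L7_6_eq)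
  show "S7_6 \<subseteq> carrier_mat 5 5" by (rule S7_6_carrier)
  fix k \<Psi>
  assume k: "5 = Suc k" and rep: "complex_rep 5 k S7_6 \<Psi>"
    and "\<And>M. M \<in> complexified 5 S7_6 \<Longrightarrow> \<Psi> (map_mat cnj M) = map_mat cnj (\<Psi> M)"
  let ?A = "m7_6 1 0 0 0 0 0 0 :: complex mat"
  let ?B = "m7_6 0 1 0 0 0 0 0 :: complex mat"
  let ?C = "m7_6 0 0 1 0 0 0 0 :: complex mat"
  have "?B \<noteq> 0\<^sub>m 5 5"
    unfolding m7_6_def by (rule rows_nonzero[of "0" _ "Suc 0"]) simp_all
  then interpret sl2_complex_rep 5 k S7_6 \<Psi> ?A ?B ?C
    by (intro sl2_complex_rep.intro rep sl2_complex_rep_axioms.intro)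
      (simp_all add: sl2_triple_def complexified_carrier[OF m7_6_complexified] m7_6_comm m7_6_smult algebra_simps)
  \<comment> \<open>The highest weight vector of the four-dimensional module, of weight 3.\<close>
  let ?X = "m7_6 0 0 0 1 0 0 0 :: complex mat"
  have "?X \<noteq> 0\<^sub>m 5 5"
    unfolding m7_6_def by (rule rows_nonzero[of "0" _ "4"]) simp_all
  then have "k \<noteq> 4"
    by (intro not_dim4_weight3[of ?X]) (simp_all add: m7_6_comm m7_6_smult algebra_simps)
  then show False using k by simp
qed

lemma mu_L7_7: "mu L7_7 = 4"
  unfolding L7_7_eq
proof (rule mu_matrix_lie_alg_eqI)
  show "faithful_representation (matrix_lie_alg 4 S7_7) 4 (\<lambda>X. X)"
    using faithful_L7_7 by (simp add: L7_7_eq)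
  show "S7_7 \<subseteq> carrier_mat 4 4" by (rule S7_7_carrier)
  fix k \<Psi>
  assume k: "4 = Suc k" and rep: "complex_rep 4 k S7_7 \<Psi>"
    and "\<And>M. M \<in> complexified 4 S7_7 \<Longrightarrow> \<Psi> (map_mat cnj M) = map_mat cnj (\<Psi> M)"
  let ?A = "m7_7 1 0 0 0 0 0 0 :: complex mat"
  let ?B = "m7_7 0 1 0 0 0 0 0 :: complex mat"
  let ?C = "m7_7 0 0 1 0 0 0 0 :: complex mat"
  have "?B \<noteq> 0\<^sub>m 4 4"
    unfolding m7_7_def by (rule rows_nonzero[of "0" _ "Suc 0"]) simp_all
  then interpret sl2_complex_rep 4 k S7_7 \<Psi> ?A ?B ?C
    by (intro sl2_complex_rep.intro rep sl2_complex_rep_axioms.intro)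
      (simp_all add: sl2_triple_def complexified_carrier[OF m7_7_complexified] m7_7_comm m7_7_smult algebra_simps)
  let ?X = "m7_7 0 0 0 1 0 0 0 :: complex mat"
  let ?Y = "m7_7 0 0 0 0 0 1 0 :: complex mat"
  have "x = 0 \<and> y = 0" if "x \<cdot>\<^sub>m ?X + y \<cdot>\<^sub>m ?Y = 0\<^sub>m 4 4" for x y
  proof -
    have "m7_7 0 0 0 x 0 y 0 = 0\<^sub>m 4 4" using that by (simp add: m7_7_smult m7_7_add)
    then have "m7_7 0 0 0 x 0 y 0 $$ (0, 2) = 0" "m7_7 0 0 0 x 0 y 0 $$ (0, 3) = 0" by simp_all
    then show ?thesis by (simp add: m7_7_def small_mat_simps)
  qed
  then have "k \<noteq> 3"
    by (intro not_dim3_commuting[of ?X ?Y])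
      (simp_all add: m7_7_comm m7_7_smult m7_7_zero algebra_simps)
  then show False using k by simp
qed

theorem mainTheorem1:
  shows "mu L5_1 = 3 \<and> (\<forall>l. mu (L6_3 l) = 3) \<and>
    mu L6_1 = 4 \<and> mu L6_2 = 4 \<and> mu L6_4 = 4 \<and>
    (\<forall>l \<nu>. l \<noteq> \<nu> \<longrightarrow> mu (L7_1 l \<nu>) = 4) \<and>
    (\<forall>l \<nu>. l \<noteq> \<nu> \<longrightarrow> mu (L7_3 l \<nu>) = 4) \<and>
    (\<forall>l \<nu>. l \<noteq> \<nu> \<longrightarrow> mu (L7_4 l \<nu>) = 4) \<and>
    (\<forall>l \<nu>. l \<noteq> \<nu> \<longrightarrow> mu (L7_5 l \<nu>) = 4) \<and>
    mu L7_7 = 4 \<and>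
    mu L7_2 = 5 \<and> mu L7_6 = 5"
  by (simp add: mu_L5_1 mu_L6_1 mu_L6_2 mu_L6_3 mu_L6_4
      mu_L7_1 mu_L7_2 mu_L7_3 mu_L7_4 mu_L7_5 mu_L7_6 mu_L7_7)

end
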